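(* Let $\mathcal{Q}$ be a union stabilizer (USt) code of length $n$ whose set of word operators has the form $\mathcal{W}=\{t_j\prod_{i=1}^{k}g_i^{\alpha_i}: j=1,\ldots,m,\ \alpha_i\in\{0,1\}\}$, with group $\mathbb{W}_0=\langle g_1,\ldots,g_k\rangle$ of size $2^k$ and $m$ translations, so that $\mathcal{Q}$ has dimension $K=m\,2^k$. Then the error-detecting measurement for $\mathcal{Q}$, i.e. the two-outcome measurement of the operator $M_{\mathcal{Q}}=2P_{\mathcal{Q}}-\mathbb{1}$, where $P_{\mathcal{Q}}$ is the orthogonal projector onto $\mathcal{Q}$, can be implemented by a quantum circuit (acting on the $n$ code qubits and ancilla qubits) using no more than $2m(n-k)(n+3)$ two-qubit gates.
   Context: $\mathbb{P}_n=\pm\{1,i\}\{I,X,Y,Z\}^{\otimes n}$ is the $n$-qubit Pauli group; the weight of $E\in\mathbb{P}_n$ is the number of non-identity tensor factors. A stabilizer state $|s\rangle$ is the unique (up to phase) $n$-qubit state stabilized by a maximal Abelian subgroup $\mathbb{S}\subset\mathbb{P}_n$ with $-\mathbb{1}\notin\mathbb{S}$ (the word stabilizer). A codeword-stabilized (CWS) code $((n,K,d))$ is $\mathcal{Q}=\mathrm{span}\{W_i|s\rangle\}_{i=1}^K$ for a stabilizer state $|s\rangle$ and a set $\mathcal{W}=\{W_i\}_{i=1}^K\subset\mathbb{P}_n$ of mutually commuting word operators, with the states $W_i|s\rangle$ mutually orthogonal. A union stabilizer (USt) code is a CWS code whose word operator set has the form $\mathcal{W}=\{t_j\prod_{i=1}^k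 g_i^{\alpha_i}\}$ where $g_1,\dots,g_k\in\mathbb{P}_n$ generate an Abelian group $\mathbb{W}_0$ of size $2^k$ such that $\mathcal{Q}_0=\mathrm{span}\{W|s\rangle: W\in\mathbb{W}_0\}$ has dimension $2^k$ (an additive/stabilizer code), and $t_1,\dots,t_m\in\mathbb{P}_n$ are translations such that the spaces $t_j(\mathcal{Q}_0)$ are mutually orthogonal. A measurement of an operator $M$ with eigenvalues $\pm1$ projects the state onto the $+1$ or the $-1$ eigenspace of $M$ (recording the outcome in an ancilla) without otherwise disturbing it. Gate counts are in terms of two-qubit gates (multi-qubit gates such as Toffoli gates and controlled $n$-qubit Pauli operators being decomposed into two-qubit gates). *)

theory Defs
  imports Complex_Main "Jordan_Normal_Form.Schur_Decomposition"
begin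

text \<open>An N-qubit state is a vector of dimension 2^N; basis index r encodes the
classical bit string whose j-th qubit value is (r div 2^j) mod 2.\<close>

definition qb :: "nat \<Rightarrow> nat \<Rightarrow> nat" where
  "qb r j = (r div 2 ^ j) mod 2"

text \<open>Tensor product of vectors: u lives on the first (low) qubits, v on the following ones.\<close>
definition kron_vec :: "complex vec \<Rightarrow> complex vec \<Rightarrow> complex vec" where
  "kron_vec u v = vec (dim_vec u * dim_vec v) (\<lambda>i. u $ (i mod dim_vec u) * v $ (i div dim_vec u))"

definition unitary_mat :: "nat \<Rightarrow> complex mat \<Rightarrow> bool" where
  "unitary_mat d U \<longleftrightarrow> U \<in> carrier_mat d d \<and> U * mat_adjoint U = 1\<^sub>m d"

definition pauli1 :: "nat \<Rightarrow> complex mat" where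
  "pauli1 p = (if p = 1 then mat_of_rows_list 2 [[0, 1], [1, 0]]
               else if p = 2 then mat_of_rows_list 2 [[0, -\<i>], [\<i>, 0]]
               else if p = 3 then mat_of_rows_list 2 [[1, 0], [0, -1]]
               else 1\<^sub>m 2)"

text \<open>The n-qubit Pauli operator i^c (P_{f 0} \<otimes> ... \<otimes> P_{f (n-1)}), written out entrywise.\<close>
definition pauli_op :: "nat \<Rightarrow> nat \<Rightarrow> (nat \<Rightarrow> nat) \<Rightarrow> complex mat" where
  "pauli_op n c f = mat (2 ^ n) (2 ^ n)
     (\<lambda>(r, s). \<i> ^ c * (\<Prod>j<n. pauli1 (f j) $$ (qb r j, qb s j)))"

definition pauli_group :: "nat \<Rightarrow> complex mat set" where
  "pauli_group n = {pauli_op n c f | c f. c < 4 \<and> (\<forall>j<n. f j < 4)}"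

definition abelian_stab_subgroup :: "nat \<Rightarrow> complex mat set \<Rightarrow> bool" where
  "abelian_stab_subgroup n S \<longleftrightarrow>
     S \<subseteq> pauli_group n \<and> 1\<^sub>m (2 ^ n) \<in> S \<and>
     (\<forall>A\<in>S. \<forall>B\<in>S. A * B \<in> S) \<and>
     (\<forall>A\<in>S. \<forall>B\<in>S. A * B = B * A) \<and>
     - (1\<^sub>m (2 ^ n)) \<notin> S"

definition maximal_stab_subgroup :: "nat \<Rightarrow> complex mat set \<Rightarrow> bool" where
  "maximal_stab_subgroup n S \<longleftrightarrow> abelian_stab_subgroup n S \<and>
     (\<forall>T. abelian_stab_subgroup n T \<and> S \<subseteq> T \<longrightarrow> T = S)"

definition stabilizer_state :: "nat \<Rightarrow> complex vec \<Rightarrow> bool" where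
  "stabilizer_state n s \<longleftrightarrow> s \<in> carrier_vec (2 ^ n) \<and> s \<noteq> 0\<^sub>v (2 ^ n) \<and>
     (\<exists>S. maximal_stab_subgroup n S \<and> (\<forall>M\<in>S. M *\<^sub>v s = s))"

definition span_list :: "nat \<Rightarrow> complex vec list \<Rightarrow> complex vec set" where
  "span_list d vs = {mat_of_cols d vs *\<^sub>v c | c. c \<in> carrier_vec (length vs)}"

definition lin_indep_list :: "nat \<Rightarrow> complex vec list \<Rightarrow> bool" where
  "lin_indep_list d vs \<longleftrightarrow> (\<forall>c \<in> carrier_vec (length vs).
      mat_of_cols d vs *\<^sub>v c = 0\<^sub>v d \<longrightarrow> c = 0\<^sub>v (length vs))"

definition orth_projector :: "nat \<Rightarrow> complex vec set \<Rightarrow> complex mat \<Rightarrow> bool" where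
  "orth_projector d V P \<longleftrightarrow> P \<in> carrier_mat d d \<and> P * P = P \<and> mat_adjoint P = P \<and>
     (\<forall>v \<in> carrier_vec d. P *\<^sub>v v \<in> V) \<and> (\<forall>v \<in> V. P *\<^sub>v v = v)"

text \<open>g-product: prod_{i<k} g_i^{alpha_i}, where alpha_i is the i-th bit of the number a < 2^k.\<close>
fun gprod :: "nat \<Rightarrow> (nat \<Rightarrow> complex mat) \<Rightarrow> nat \<Rightarrow> nat \<Rightarrow> complex mat" where
  "gprod n g 0 a = 1\<^sub>m (2 ^ n)"
| "gprod n g (Suc i) a = (if qb a i = 1 then gprod n g i a * g i else gprod n g i a)"

text \<open>Gates: a single-qubit gate on qubit q, or a two-qubit gate on qubits q1, q2
  (the 4x4 matrix uses local index (bit of q1) + 2 * (bit of q2)).\<close>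
datatype gate = G1 nat "complex mat" | G2 nat nat "complex mat"

fun gate_ok :: "nat \<Rightarrow> gate \<Rightarrow> bool" where
  "gate_ok N (G1 q U) \<longleftrightarrow> q < N \<and> unitary_mat 2 U"
| "gate_ok N (G2 q1 q2 U) \<longleftrightarrow> q1 < N \<and> q2 < N \<and> q1 \<noteq> q2 \<and> unitary_mat 4 U"

fun gate_mat :: "nat \<Rightarrow> gate \<Rightarrow> complex mat" where
  "gate_mat N (G1 q U) = mat (2 ^ N) (2 ^ N) (\<lambda>(r, c).
      if (\<forall>j<N. j \<noteq> q \<longrightarrow> qb r j = qb c j) then U $$ (qb r q, qb c q) else 0)"
| "gate_mat N (G2 q1 q2 U) = mat (2 ^ N) (2 ^ N) (\<lambda>(r, c).
      if (\<forall>j<N. j \<noteq> q1 \<and> j \<noteq> q2 \<longrightarrow> qb r j = qb c j)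
      then U $$ (qb r q1 + 2 * qb r q2, qb c q1 + 2 * qb c q2) else 0)"

fun circuit_mat :: "nat \<Rightarrow> gate list \<Rightarrow> complex mat" where
  "circuit_mat N [] = 1\<^sub>m (2 ^ N)"
| "circuit_mat N (g # gs) = circuit_mat N gs * gate_mat N g"

fun is_two_qubit :: "gate \<Rightarrow> bool" where
  "is_two_qubit (G1 _ _) = False"
| "is_two_qubit (G2 _ _ _) = True"

definition two_qubit_count :: "gate list \<Rightarrow> nat" where
  "two_qubit_count gs = length (filter is_two_qubit gs)"

text \<open>A circuit gs on n code qubits (0..n-1) and a \<ge> 1 ancillas (n..n+a-1), ancillas
  initialised to |0...0>, implements the two-outcome measurement {P, 1-P}: the outcome is
  recorded in ancilla qubit n (0 for the P-outcome, i.e. eigenvalue +1 of 2P-1), the code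
  register is left in the (unnormalised) post-measurement state, and the remaining ancillas end
  in states chi0 / chi1 that depend only on the outcome, not on the input.\<close>
definition implements_measurement :: "nat \<Rightarrow> nat \<Rightarrow> complex mat \<Rightarrow> gate list \<Rightarrow> bool" where
  "implements_measurement n a P gs \<longleftrightarrow> 1 \<le> a \<and> (\<forall>g\<in>set gs. gate_ok (n + a) g) \<and>
     (\<exists>chi0 chi1. chi0 \<in> carrier_vec (2 ^ (a - 1)) \<and> chi1 \<in> carrier_vec (2 ^ (a - 1)) \<and>
       (\<forall>psi \<in> carrier_vec (2 ^ n).
          circuit_mat (n + a) gs *\<^sub>v kron_vec psi (unit_vec (2 ^ a) 0) =
            kron_vec (P *\<^sub>v psi) (kron_vec (unit_vec 2 0) chi0) +
            kron_vec ((1\<^sub>m (2 ^ n) - P) *\<^sub>v psi) (kron_vec (unit_vec 2 1) chi1)))"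

end

theory Submission
  imports Defs "HOL-Library.FuncSet"
begin

text \<open>Expanding \<open>|s\<rangle>\<langle>s|\<close> in Pauli operators and conjugating by the word operators shows that the
projector onto \<open>Q0\<close> is the normalized sum over the elementary abelian group of all Pauli operators that stabilize
\<open>s\<close> and commute with every \<open>g i\<close>; this group has order \<open>2 ^ (n - k)\<close>. Hence the projector
onto each translate \<open>t j Q0\<close> is a product of \<open>n - k\<close> commuting factors \<open>(1 + M) / 2\<close>.

For every translate a block of gates flips the outcome qubit on that space: a chain of ancillas records whether the
first \<open>i\<close> factors all gave \<open>+1\<close>, each link costing two controlled Hadamard gates and \<open>n\<close> controlled
Pauli gates, then one CNOT copies the last ancilla, and the chain is uncomputed. This takes \<open>2 (n - k) (n + 2) + 1\<close>
two-qubit gates per translate, which is within the bound when \<open>k < n\<close>; for \<open>k = n\<close> the projector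
is \<open>0\<close> or \<open>1\<close>.\<close>

section \<open>Tensor products of one-qubit operators\<close>

text \<open>The obstacle is the conjunction of \<open>n - k\<close> eigenvalue conditions: a single
  operator controlled on all of them would be expensive, so the conjunction is accumulated flag by
  flag, each flag depending only on its predecessor. The flags must be erased again, because
  otherwise the final ancilla state would reveal which condition failed and would depend on the
  input within the rejected subspace. Erasing works because the factors commute: after the inner
  steps each component is still an eigenvector of the earlier factors, so every link meets the
  eigenvalue that it has recorded.

  Blocks for different translates can be concatenated because their projectors are mutually
  orthogonal: a component whose outcome has been flipped is annihilated by all later projectors and
  is never flipped back.

  The one CNOT per translate explains the step from \<open>n + 2\<close> to \<open>n + 3\<close>: it
  is absorbed by the slack \<open>2 * (n - k)\<close>, which is positive only for
  \<open>k < n\<close>. For \<open>k = n\<close> the bound leaves no two-qubit gate at all, hence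
  the separate treatment.\<close>

lemma qb_eq_bit: "qb r j = of_bool (bit r j)"
  by (simp add: qb_def bit_iff_odd odd_iff_mod_2_eq_one)

lemma qb_less_2 [simp]: "qb r j < 2"
  by (simp add: qb_def)

lemma qb_add_pow_low: "j < n \<Longrightarrow> qb (2 ^ n + x) j = qb x j"
proof -
  assume "j < n"
  then obtain d where "n = j + Suc d"
    using less_natE by auto
  then have "2 ^ n + x = x + 2 ^ j * (2 * 2 ^ d)"
    by (simp add: power_add)
  then have "(2 ^ n + x) div 2 ^ j = 2 * 2 ^ d + x div 2 ^ j"
    by (metis div_mult_self2 power_not_zero zero_neq_numeral)
  then show ?thesis
    by (simp add: qb_def)
qed

lemma qb_add_pow_top: "x < 2 ^ n \<Longrightarrow> qb (2 ^ n + x) n = 1"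
  by (simp add: qb_def)

lemma qb_top: "x < 2 ^ n \<Longrightarrow> qb x n = 0"
  by (simp add: qb_def)

lemma eq_iff_qb:
  assumes "r < 2 ^ n" "s < 2 ^ n"
  shows "r = s \<longleftrightarrow> (\<forall>j<n. qb r j = qb s j)"
proof
  assume h: "\<forall>j<n. qb r j = qb s j"
  have "bit r j = bit s j" for j
  proof (cases "j < n")
    case True
    then have "qb r j = qb s j" using h by blast
    then show ?thesis by (simp only: qb_eq_bit of_bool_eq_iff)
  next
    case False
    then have "(2::nat) ^ n \<le> 2 ^ j" by simp
    then have "r < 2 ^ j" "s < 2 ^ j" using assms by linarith+
    then show ?thesis by (simp add: bit_iff_odd)
  qed
  then show "r = s" by (simp add: bit_eq_iff)
qed simp

lemma sum_lessThan_add: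
  "sum f {..<a + b :: nat} = sum f {..<a} + (\<Sum>i<b. f (a + i) :: 'a :: comm_monoid_add)"
  by (induction b) (auto simp: add.assoc)

text \<open>A number below \<open>2 ^ n\<close> is a string of independent bits, so this is the
  distributive law; splitting at the top bit gives the induction. It reduces products and traces of
  tensor products to one qubit.\<close>

lemma sum_prod_qb:
  fixes F :: "nat \<Rightarrow> nat \<Rightarrow> complex"
  shows "(\<Sum>x<2 ^ n. \<Prod>j<n. F j (qb x j)) = (\<Prod>j<n. F j 0 + F j 1)"
proof (induction n)
  case (Suc n)
  have "(\<Sum>x<2 ^ Suc n. \<Prod>j<Suc n. F j (qb x j)) =
      (\<Sum>x<2 ^ n. \<Prod>j<Suc n. F j (qb x j)) + (\<Sum>x<2 ^ n. \<Prod>j<Suc n. F j (qb (2 ^ n + x) j))"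
    using sum_lessThan_add[of _ "2 ^ n" "2 ^ n"] by (simp add: mult_2)
  also have "(\<Sum>x<2 ^ n. \<Prod>j<Suc n. F j (qb x j)) = (\<Sum>x<2 ^ n. (\<Prod>j<n. F j (qb x j)) * F n 0)"
    by (intro sum.cong) (auto simp: qb_top)
  also have "(\<Sum>x<2 ^ n. \<Prod>j<Suc n. F j (qb (2 ^ n + x) j)) =
      (\<Sum>x<2 ^ n. (\<Prod>j<n. F j (qb x j)) * F n 1)"
    by (intro sum.cong) (auto simp: qb_add_pow_top qb_add_pow_low)
  finally show ?case
    by (simp add: Suc.IH flip: sum_distrib_right distrib_left)
qed simp

section \<open>Adjoints of square complex matrices\<close>

lemma mat_adjoint_carrier [simp]: "A \<in> carrier_mat n n \<Longrightarrow> mat_adjoint A \<in> carrier_mat n n"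
  for A :: "complex mat"
  by (auto simp: mat_adjoint_def mat_of_rows_def)

lemma mat_adjoint_index:
  fixes A :: "complex mat"
  assumes "A \<in> carrier_mat n n" "i < n" "j < n"
  shows "mat_adjoint A $$ (i, j) = cnj (A $$ (j, i))"
  using assms by (auto simp: mat_adjoint_def mat_of_rows_def)

lemma mat_adjoint_eqI:
  fixes A B :: "complex mat"
  assumes "A \<in> carrier_mat n n" "B \<in> carrier_mat n n"
    "\<And>i j. i < n \<Longrightarrow> j < n \<Longrightarrow> B $$ (i, j) = cnj (A $$ (j, i))"
  shows "mat_adjoint A = B"
  using assms carrier_matD[OF mat_adjoint_carrier[OF assms(1)]]
  by (intro eq_matI) (auto simp: mat_adjoint_index)

lemma mat_adjoint_mult:
  fixes A B :: "complex mat"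
  assumes "A \<in> carrier_mat n n" "B \<in> carrier_mat n n"
  shows "mat_adjoint (A * B) = mat_adjoint B * mat_adjoint A"
proof (rule mat_adjoint_eqI[of _ n])
  show "A * B \<in> carrier_mat n n" "mat_adjoint B * mat_adjoint A \<in> carrier_mat n n"
    using assms by (auto intro!: mult_carrier_mat[of _ n n])
  fix i j assume ij: "i < n" "j < n"
  have "(mat_adjoint B * mat_adjoint A) $$ (i, j) = (\<Sum>k<n. cnj (B $$ (k, i)) * cnj (A $$ (j, k)))"
    using assms carrier_matD[OF mat_adjoint_carrier[OF assms(1)]] carrier_matD[OF mat_adjoint_carrier[OF assms(2)]] ij
    by (auto simp: scalar_prod_def mat_adjoint_index atLeast0LessThan intro!: sum.cong)
  also have "\<dots> = cnj ((A * B) $$ (j, i))"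
    using assms ij by (auto simp: scalar_prod_def atLeast0LessThan mult.commute intro!: sum.cong)
  finally show "(mat_adjoint B * mat_adjoint A) $$ (i, j) = cnj ((A * B) $$ (j, i))" .
qed

definition tens :: "nat \<Rightarrow> (nat \<Rightarrow> complex mat) \<Rightarrow> complex mat" where
  "tens n A = mat (2 ^ n) (2 ^ n) (\<lambda>(r, s). \<Prod>j<n. A j $$ (qb r j, qb s j))"

lemma tens_carrier [simp]: "tens n A \<in> carrier_mat (2 ^ n) (2 ^ n)"
  by (simp add: tens_def)

lemma tens_index:
  "r < 2 ^ n \<Longrightarrow> s < 2 ^ n \<Longrightarrow> tens n A $$ (r, s) = (\<Prod>j<n. A j $$ (qb r j, qb s j))"
  by (simp add: tens_def)

lemma tens_cong: "(\<And>j. j < n \<Longrightarrow> A j = B j) \<Longrightarrow> tens n A = tens n B"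
  by (intro eq_matI) (auto simp: tens_def)

lemma mult_2_index:
  fixes A B :: "complex mat"
  assumes "A \<in> carrier_mat 2 2" "B \<in> carrier_mat 2 2" "i < 2" "j < 2"
  shows "(A * B) $$ (i, j) = A $$ (i, 0) * B $$ (0, j) + A $$ (i, 1) * B $$ (1, j)"
  using assms by (auto simp: scalar_prod_def numeral_2_eq_2)

lemma tens_mult:
  assumes "\<And>j. j < n \<Longrightarrow> A j \<in> carrier_mat 2 2" "\<And>j. j < n \<Longrightarrow> B j \<in> carrier_mat 2 2"
  shows "tens n A * tens n B = tens n (\<lambda>j. A j * B j)"
proof (rule eq_matI)
  fix r s assume "r < dim_row (tens n (\<lambda>j. A j * B j))" "s < dim_col (tens n (\<lambda>j. A j * B j))"
  then have rs: "r < 2 ^ n" "s < 2 ^ n" by (auto simp: tens_def)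
  have "(tens n A * tens n B) $$ (r, s) =
      (\<Sum>x<2 ^ n. \<Prod>j<n. A j $$ (qb r j, qb x j) * B j $$ (qb x j, qb s j))"
    using rs by (auto simp: tens_def scalar_prod_def atLeast0LessThan prod.distrib intro!: sum.cong)
  also have "\<dots> = (\<Prod>j<n. A j $$ (qb r j, 0) * B j $$ (0, qb s j) + A j $$ (qb r j, 1) * B j $$ (1, qb s j))"
    by (rule sum_prod_qb[of "\<lambda>j b. A j $$ (qb r j, b) * B j $$ (b, qb s j)"])
  also have "\<dots> = tens n (\<lambda>j. A j * B j) $$ (r, s)"
    using rs assms by (auto simp: tens_index mult_2_index intro!: prod.cong)
  finally show "(tens n A * tens n B) $$ (r, s) = tens n (\<lambda>j. A j * B j) $$ (r, s)" .
qed (auto simp: tens_def)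

lemma tens_smult:
  assumes "\<And>j. j < n \<Longrightarrow> A j \<in> carrier_mat 2 2"
  shows "tens n (\<lambda>j. c j \<cdot>\<^sub>m A j) = (\<Prod>j<n. c j) \<cdot>\<^sub>m tens n A"
proof (rule eq_matI)
  fix r s assume "r < dim_row ((\<Prod>j<n. c j) \<cdot>\<^sub>m tens n A)" "s < dim_col ((\<Prod>j<n. c j) \<cdot>\<^sub>m tens n A)"
  then have rs: "r < 2 ^ n" "s < 2 ^ n" by (auto simp: tens_def)
  have "(\<Prod>j<n. (c j \<cdot>\<^sub>m A j) $$ (qb r j, qb s j)) = (\<Prod>j<n. c j * A j $$ (qb r j, qb s j))"
    using carrier_matD[OF assms] by (intro prod.cong) auto
  then show "tens n (\<lambda>j. c j \<cdot>\<^sub>m A j) $$ (r, s) = ((\<Prod>j<n. c j) \<cdot>\<^sub>m tens n A) $$ (r, s)"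
    using rs by (simp add: tens_def prod.distrib)
qed (auto simp: tens_def)

lemma tens_one: "tens n (\<lambda>_. 1\<^sub>m 2) = 1\<^sub>m (2 ^ n)"
proof (rule eq_matI)
  fix r s assume "r < dim_row (1\<^sub>m (2 ^ n) :: complex mat)" "s < dim_col (1\<^sub>m (2 ^ n) :: complex mat)"
  then have rs: "r < 2 ^ n" "s < 2 ^ n" by auto
  have "(\<Prod>j<n. 1\<^sub>m 2 $$ (qb r j, qb s j)) = (\<Prod>j<n. if qb r j = qb s j then 1 else 0 :: complex)"
    by (intro prod.cong) auto
  also have "\<dots> = (if \<forall>j<n. qb r j = qb s j then 1 else 0)"
    by auto
  finally show "tens n (\<lambda>_. 1\<^sub>m 2) $$ (r, s) = 1\<^sub>m (2 ^ n) $$ (r, s)"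
    using rs by (simp add: tens_index flip: eq_iff_qb[OF rs])
qed (auto simp: tens_def)

lemma tens_adjoint:
  assumes "\<And>j. j < n \<Longrightarrow> A j \<in> carrier_mat 2 2"
  shows "mat_adjoint (tens n A) = tens n (\<lambda>j. mat_adjoint (A j))"
  using assms by (intro mat_adjoint_eqI[of _ "2 ^ n"]) (auto simp: tens_index mat_adjoint_index[of _ 2] intro!: prod.cong)

section \<open>Pauli operators\<close>

lemma pauli1_dim [simp]: "dim_row (pauli1 p) = 2" "dim_col (pauli1 p) = 2"
  by (simp_all add: pauli1_def mat_of_rows_list_def)

lemma pauli1_carrier [simp]: "pauli1 p \<in> carrier_mat 2 2"
  by (rule carrier_matI) simp_all

lemma pauli1_mult_carrier [simp]: "pauli1 p * pauli1 q \<in> carrier_mat 2 2"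
  by (rule mult_carrier_mat[of _ 2 2]) auto

lemma pauli1_index:
  "pauli1 p $$ (0, 0) = (if p = 3 then 1 else if p = 1 \<or> p = 2 then 0 else 1)"
  "pauli1 p $$ (0, Suc 0) = (if p = 1 then 1 else if p = 2 then - \<i> else 0)"
  "pauli1 p $$ (Suc 0, 0) = (if p = 1 then 1 else if p = 2 then \<i> else 0)"
  "pauli1 p $$ (Suc 0, Suc 0) = (if p = 3 then - 1 else if p = 1 \<or> p = 2 then 0 else 1)"
  by (auto simp: pauli1_def mat_of_rows_list_def)

lemma eq_mat2I:
  fixes A B :: "complex mat"
  assumes "A \<in> carrier_mat 2 2" "B \<in> carrier_mat 2 2"
    "A $$ (0, 0) = B $$ (0, 0)" "A $$ (0, Suc 0) = B $$ (0, Suc 0)"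
    "A $$ (Suc 0, 0) = B $$ (Suc 0, 0)" "A $$ (Suc 0, Suc 0) = B $$ (Suc 0, Suc 0)"
  shows "A = B"
  using assms by (intro eq_matI) (auto simp: less_2_cases_iff)

lemma pauli1_adjoint: "mat_adjoint (pauli1 p) = pauli1 p"
  by (rule mat_adjoint_eqI[of _ 2]) (auto simp: less_2_cases_iff pauli1_index)

lemma pauli1_square: "pauli1 p * pauli1 p = 1\<^sub>m 2"
  by (rule eq_mat2I) (auto simp: mult_2_index pauli1_index simp del: index_mult_mat(1))

lemma pauli1_commute:
  "\<exists>c \<in> {1, -1}. pauli1 p * pauli1 q = c \<cdot>\<^sub>m (pauli1 q * pauli1 p)"
proof -
  \<comment> \<open>Every label outside 1, 2, 3 denotes the identity, which commutes with
    everything.\<close>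
  define c :: complex where
    "c = (if p = q \<or> p \<notin> {1, 2, 3} \<or> q \<notin> {1, 2, 3} then 1 else - 1)"
  have "pauli1 p * pauli1 q = c \<cdot>\<^sub>m (pauli1 q * pauli1 p)"
    unfolding c_def
    by (rule eq_mat2I) (auto simp: mult_2_index pauli1_index simp del: index_mult_mat(1))
  then show ?thesis
    by (intro bexI[of _ c]) (auto simp: c_def)
qed

lemma pauli1_mult: "\<exists>c h. h < 4 \<and> pauli1 p * pauli1 q = \<i> ^ c \<cdot>\<^sub>m pauli1 h"
proof -
  \<comment> \<open>Labels above 3 denote the identity as well; representatives below 4 make the
    case analysis finite.\<close>
  have norm: "\<exists>p'\<in>{0, 1, 2, 3}. pauli1 p = pauli1 p'" for p
  proof (cases "p \<in> {0, 1, 2, 3}")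
    case False
    then show ?thesis by (intro bexI[of _ 0]) (auto simp: pauli1_def)
  qed blast
  obtain p' where p': "p' \<in> {0, 1, 2, 3}" "pauli1 p = pauli1 p'"
    using norm[of p] by (rule bexE)
  obtain q' where q': "q' \<in> {0, 1, 2, 3}" "pauli1 q = pauli1 q'"
    using norm[of q] by (rule bexE)
  \<comment> \<open>Two different labels among 1, 2, 3 multiply to the third one, and the three
    labels add up to 6. The phase exponent is 1 in cyclic order and 3 in the opposite order, as XY =
    iZ and YX = -iZ.\<close>
  define h where "h = (if p' = 0 then q' else if q' = 0 then p' else if p' = q' then 0 else 6 - p' - q')"
  define c where "c = (if p' = 0 \<or> q' = 0 \<or> p' = q' then 0
    else if (p', q') \<in> {(1, 2), (2, 3), (3, 1)} then 1 else (3::nat))"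
  have "pauli1 p' * pauli1 q' = \<i> ^ c \<cdot>\<^sub>m pauli1 h"
    using p'(1) q'(1) unfolding c_def h_def
    by (elim insertE emptyE; hypsubst; intro eq_mat2I)
      (simp_all add: mult_2_index pauli1_index power3_eq_cube del: index_mult_mat(1))
  moreover have "h < 4"
    using p'(1) q'(1) by (auto simp: h_def)
  ultimately show ?thesis
    unfolding p'(2) q'(2) by blast
qed

section \<open>Finite sums of square matrices\<close>

text \<open>The dimension is an argument because the matrix type does not carry one and the empty
  sum needs it.\<close>

definition msum :: "nat \<Rightarrow> ('a \<Rightarrow> complex mat) \<Rightarrow> 'a set \<Rightarrow> complex mat" where
  "msum d F S = mat d d (\<lambda>(i, j). \<Sum>x\<in>S. F x $$ (i, j))"

lemma msum_carrier [simp]: "msum d F S \<in> carrier_mat d d"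
  by (simp add: msum_def)

lemma msum_dim [simp]: "dim_row (msum d F S) = d" "dim_col (msum d F S) = d"
  by (simp_all add: msum_def)

lemma msum_index: "i < d \<Longrightarrow> j < d \<Longrightarrow> msum d F S $$ (i, j) = (\<Sum>x\<in>S. F x $$ (i, j))"
  by (simp add: msum_def)

lemma msum_cong: "(\<And>x. x \<in> S \<Longrightarrow> F x = G x) \<Longrightarrow> msum d F S = msum d G S"
  by (simp add: msum_def)

lemma mult_index:
  fixes A B :: "complex mat"
  assumes "A \<in> carrier_mat d d" "B \<in> carrier_mat d d" "i < d" "j < d"
  shows "(A * B) $$ (i, j) = (\<Sum>k<d. A $$ (i, k) * B $$ (k, j))"
  using assms by (auto simp: scalar_prod_def atLeast0LessThan)

lemma mult_msum:
  assumes "A \<in> carrier_mat d d" "\<And>x. x \<in> S \<Longrightarrow> F x \<in> carrier_mat d d"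
  shows "A * msum d F S = msum d (\<lambda>x. A * F x) S"
proof (rule eq_matI)
  fix i j assume "i < dim_row (msum d (\<lambda>x. A * F x) S)" "j < dim_col (msum d (\<lambda>x. A * F x) S)"
  then have ij: "i < d" "j < d" by simp_all
  have "(A * msum d F S) $$ (i, j) = (\<Sum>k<d. A $$ (i, k) * (\<Sum>x\<in>S. F x $$ (k, j)))"
    using ij by (simp add: mult_index[OF assms(1)] msum_index del: index_mult_mat(1))
  also have "\<dots> = (\<Sum>x\<in>S. \<Sum>k<d. A $$ (i, k) * F x $$ (k, j))"
    by (simp add: sum_distrib_left sum.swap[of _ _ S])
  also have "\<dots> = (\<Sum>x\<in>S. (A * F x) $$ (i, j))"
    using ij assms by (intro sum.cong refl) (simp add: mult_index[of _ d] del: index_mult_mat(1))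
  finally show "(A * msum d F S) $$ (i, j) = msum d (\<lambda>x. A * F x) S $$ (i, j)"
    using ij by (simp add: msum_index)
qed (use carrier_matD[OF assms(1)] in simp_all)

lemma msum_mult:
  assumes "A \<in> carrier_mat d d" "\<And>x. x \<in> S \<Longrightarrow> F x \<in> carrier_mat d d"
  shows "msum d F S * A = msum d (\<lambda>x. F x * A) S"
proof (rule eq_matI)
  fix i j assume "i < dim_row (msum d (\<lambda>x. F x * A) S)" "j < dim_col (msum d (\<lambda>x. F x * A) S)"
  then have ij: "i < d" "j < d" by simp_all
  have "(msum d F S * A) $$ (i, j) = (\<Sum>k<d. (\<Sum>x\<in>S. F x $$ (i, k)) * A $$ (k, j))"
    using ij by (simp add: mult_index[OF _ assms(1)] msum_index del: index_mult_mat(1))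
  also have "\<dots> = (\<Sum>x\<in>S. \<Sum>k<d. F x $$ (i, k) * A $$ (k, j))"
    by (simp add: sum_distrib_right sum.swap[of _ _ S])
  also have "\<dots> = (\<Sum>x\<in>S. (F x * A) $$ (i, j))"
    using ij assms by (intro sum.cong refl) (simp add: mult_index[of _ d] del: index_mult_mat(1))
  finally show "(msum d F S * A) $$ (i, j) = msum d (\<lambda>x. F x * A) S $$ (i, j)"
    using ij by (simp add: msum_index)
qed (use carrier_matD[OF assms(1)] in simp_all)

lemma smult_msum:
  assumes "\<And>x. x \<in> S \<Longrightarrow> F x \<in> carrier_mat d d"
  shows "c \<cdot>\<^sub>m msum d F S = msum d (\<lambda>x. c \<cdot>\<^sub>m F x) S"
proof (rule eq_matI)
  fix i j assume "i < dim_row (msum d (\<lambda>x. c \<cdot>\<^sub>m F x) S)" "j < dim_col (msum d (\<lambda>x. c \<cdot>\<^sub>m F x) S)"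
  then have ij: "i < d" "j < d" by simp_all
  have "(\<Sum>x\<in>S. (c \<cdot>\<^sub>m F x) $$ (i, j)) = (\<Sum>x\<in>S. c * F x $$ (i, j))"
    using ij carrier_matD[OF assms] by (intro sum.cong refl) simp
  then show "(c \<cdot>\<^sub>m msum d F S) $$ (i, j) = msum d (\<lambda>x. c \<cdot>\<^sub>m F x) S $$ (i, j)"
    using ij by (simp add: msum_index sum_distrib_left)
qed simp_all

lemma msum_swap:
  "msum d (\<lambda>x. msum d (F x) T) S = msum d (\<lambda>y. msum d (\<lambda>x. F x y) S) T"
  by (rule eq_matI) (simp_all add: msum_index sum.swap[of _ S T])

lemma msum_reindex: "inj_on h S \<Longrightarrow> msum d F (h ` S) = msum d (\<lambda>x. F (h x)) S"
  by (rule eq_matI) (simp_all add: msum_index sum.reindex)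

lemma msum_const:
  "A \<in> carrier_mat d d \<Longrightarrow> msum d (\<lambda>_. A) S = of_nat (card S) \<cdot>\<^sub>m A"
  by (rule eq_matI) (auto simp: msum_index)

lemma msum_Un:
  assumes "finite S" "finite T" "S \<inter> T = {}"
  shows "msum d F (S \<union> T) = msum d F S + msum d F T"
  by (rule eq_matI) (simp_all add: msum_index sum.union_disjoint[OF assms])

lemma msum_empty: "msum d F {} = 0\<^sub>m d d"
  by (rule eq_matI) (simp_all add: msum_index)

lemma msum_singleton: "F x \<in> carrier_mat d d \<Longrightarrow> msum d F {x} = F x"
  by (rule eq_matI) (auto simp: msum_index)

lemma msum_mono_neutral:
  assumes "finite S" "T \<subseteq> S" "\<And>x. x \<in> S - T \<Longrightarrow> F x = 0\<^sub>m d d"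
  shows "msum d F S = msum d F T"
proof (rule eq_matI)
  fix i j assume "i < dim_row (msum d F T)" "j < dim_col (msum d F T)"
  then have ij: "i < d" "j < d" by simp_all
  have "(\<Sum>x\<in>S. F x $$ (i, j)) = (\<Sum>x\<in>T. F x $$ (i, j))"
    using ij assms by (intro sum.mono_neutral_right) auto
  then show "msum d F S $$ (i, j) = msum d F T $$ (i, j)"
    using ij by (simp add: msum_index)
qed simp_all

lemma msum_sum_index:
  assumes "\<And>x. x \<in> S \<Longrightarrow> F x \<in> carrier_mat d d" "v \<in> carrier_vec d" "i < d"
  shows "(msum d F S *\<^sub>v v) $ i = (\<Sum>x\<in>S. (F x *\<^sub>v v) $ i)"
proof -
  have "(msum d F S *\<^sub>v v) $ i = (\<Sum>k<d. (\<Sum>x\<in>S. F x $$ (i, k)) * v $ k)"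
    using assms by (auto simp: scalar_prod_def atLeast0LessThan msum_index)
  also have "\<dots> = (\<Sum>x\<in>S. \<Sum>k<d. F x $$ (i, k) * v $ k)"
    by (simp add: sum_distrib_right sum.swap[of _ _ S])
  also have "\<dots> = (\<Sum>x\<in>S. (F x *\<^sub>v v) $ i)"
    using assms carrier_matD[OF assms(1)]
    by (intro sum.cong refl) (auto simp: scalar_prod_def atLeast0LessThan)
  finally show ?thesis .
qed

lemma one_smult_mat: "1 \<cdot>\<^sub>m A = (A :: complex mat)"
  by (rule eq_matI) auto

lemma smult_smult: "a \<cdot>\<^sub>m (b \<cdot>\<^sub>m A) = (a * b) \<cdot>\<^sub>m (A :: complex mat)"
  by (rule eq_matI) auto

lemma smult_mat_vec:
  fixes A :: "complex mat"
  assumes "A \<in> carrier_mat d d" "v \<in> carrier_vec d"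
  shows "(c \<cdot>\<^sub>m A) *\<^sub>v v = c \<cdot>\<^sub>v (A *\<^sub>v v)"
  using assms by (intro eq_vecI) (auto simp: scalar_prod_def sum_distrib_left mult_ac)

lemma smult_mult_smult:
  fixes A B :: "complex mat"
  assumes "A \<in> carrier_mat d d" "B \<in> carrier_mat d d"
  shows "(a \<cdot>\<^sub>m A) * (b \<cdot>\<^sub>m B) = (a * b) \<cdot>\<^sub>m (A * B)"
  using assms by (simp add: mult_smult_assoc_mat[of _ d d _ d] mult_smult_distrib[of _ d d _ d] smult_smult mult.commute)

section \<open>Rank-one operators and projectors\<close>

definition outer :: "nat \<Rightarrow> complex vec \<Rightarrow> complex mat" where
  "outer d v = mat d d (\<lambda>(i, j). v $ i * cnj (v $ j))"

lemma outer_carrier [simp]: "outer d v \<in> carrier_mat d d"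
  by (simp add: outer_def)

lemma outer_dim [simp]: "dim_row (outer d v) = d" "dim_col (outer d v) = d"
  by (simp_all add: outer_def)

lemma outer_index: "i < d \<Longrightarrow> j < d \<Longrightarrow> outer d v $$ (i, j) = v $ i * cnj (v $ j)"
  by (simp add: outer_def)

lemma cscalar_prod_sum:
  fixes v w :: "complex vec"
  assumes "w \<in> carrier_vec d"
  shows "v \<bullet>c w = (\<Sum>k<d. v $ k * cnj (w $ k))"
  using assms by (auto simp: scalar_prod_def atLeast0LessThan)

lemma outer_mult_vec:
  assumes "v \<in> carrier_vec d" "w \<in> carrier_vec d"
  shows "outer d v *\<^sub>v w = (w \<bullet>c v) \<cdot>\<^sub>v v"
  using assms
  by (intro eq_vecI) (auto simp: cscalar_prod_sum[of _ d] scalar_prod_def atLeast0LessThan outer_index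
      sum_distrib_left sum_distrib_right mult_ac intro!: sum.cong)

lemma outer_mult_outer:
  assumes "v \<in> carrier_vec d" "w \<in> carrier_vec d" "w \<bullet>c v = (if v = w then c else 0)"
  shows "outer d v * outer d w = (if v = w then c \<cdot>\<^sub>m outer d v else 0\<^sub>m d d)"
proof -
  have "(outer d v * outer d w) $$ (i, j) = (w \<bullet>c v) * (v $ i * cnj (w $ j))" if "i < d" "j < d" for i j
    using that assms(1)
    by (simp add: mult_index[of _ d] cscalar_prod_sum[of _ d] outer_index sum_distrib_left sum_distrib_right
        mult_ac del: index_mult_mat(1))
  then show ?thesis
    using assms(3) by (intro eq_matI) (auto simp: outer_index simp del: index_mult_mat(1))
qed

lemma mult_mat_vec_index:
  fixes A :: "complex mat"
  assumes "A \<in> carrier_mat d d" "v \<in> carrier_vec d" "i < d"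
  shows "(A *\<^sub>v v) $ i = (\<Sum>k<d. A $$ (i, k) * v $ k)"
  using assms by (auto simp: scalar_prod_def atLeast0LessThan)

lemma cscalar_prod_adjoint:
  fixes A :: "complex mat"
  assumes "A \<in> carrier_mat d d" "v \<in> carrier_vec d" "w \<in> carrier_vec d"
  shows "(A *\<^sub>v v) \<bullet>c w = v \<bullet>c (mat_adjoint A *\<^sub>v w)"
proof -
  have "(A *\<^sub>v v) \<bullet>c w = (\<Sum>i<d. (\<Sum>k<d. A $$ (i, k) * v $ k) * cnj (w $ i))"
    using assms by (simp add: cscalar_prod_sum[of _ d] mult_mat_vec_index[of _ d] del: index_mult_mat_vec)
  also have "\<dots> = (\<Sum>i<d. \<Sum>k<d. v $ k * (A $$ (i, k) * cnj (w $ i)))"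
    by (simp add: sum_distrib_left sum_distrib_right mult_ac)
  also have "\<dots> = (\<Sum>k<d. \<Sum>i<d. v $ k * (A $$ (i, k) * cnj (w $ i)))"
    by (rule sum.swap)
  also have "\<dots> = (\<Sum>k<d. v $ k * (\<Sum>i<d. A $$ (i, k) * cnj (w $ i)))"
    by (simp add: sum_distrib_left)
  also have "\<dots> = v \<bullet>c (mat_adjoint A *\<^sub>v w)"
    using assms mult_mat_vec_carrier[OF mat_adjoint_carrier[OF assms(1)] assms(3)]
    by (simp add: cscalar_prod_sum[of _ d] mult_mat_vec_index[of _ d] mat_adjoint_index[of _ d] mat_adjoint_carrier
        del: index_mult_mat_vec)
  finally show ?thesis .
qed

lemma outer_conj:
  assumes "A \<in> carrier_mat d d" "v \<in> carrier_vec d"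
  shows "outer d (A *\<^sub>v v) = A * outer d v * mat_adjoint A"
proof (rule eq_matI)
  fix i j assume "i < dim_row (A * outer d v * mat_adjoint A)" "j < dim_col (A * outer d v * mat_adjoint A)"
  then have ij: "i < d" "j < d"
    using carrier_matD[OF assms(1)] carrier_matD[OF mat_adjoint_carrier[OF assms(1)]] by simp_all
  have "(A * outer d v * mat_adjoint A) $$ (i, j) =
      (\<Sum>l<d. (\<Sum>k<d. A $$ (i, k) * (v $ k * cnj (v $ l))) * cnj (A $$ (j, l)))"
    using ij assms mult_carrier_mat[OF assms(1) outer_carrier[of d v]]
    by (simp add: mult_index[of _ d] outer_index mat_adjoint_index[of _ d] del: index_mult_mat(1))
  also have "\<dots> = (\<Sum>k<d. A $$ (i, k) * v $ k) * (\<Sum>l<d. cnj (A $$ (j, l) * v $ l))"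
    by (simp add: sum_distrib_left sum_distrib_right mult_ac)
  also have "\<dots> = outer d (A *\<^sub>v v) $$ (i, j)"
    using ij assms by (simp add: outer_index mult_mat_vec_index[of _ d] del: index_mult_mat_vec)
  finally show "outer d (A *\<^sub>v v) $$ (i, j) = (A * outer d v * mat_adjoint A) $$ (i, j)" by simp
qed (use carrier_matD[OF assms(1)] carrier_matD[OF mat_adjoint_carrier[OF assms(1)]] in simp_all)

text \<open>The orthogonal projector onto the span of a family of pairwise orthogonal vectors of common
squared norm \<open>c\<close>.\<close>
definition fam_proj :: "nat \<Rightarrow> complex \<Rightarrow> ('a \<Rightarrow> complex vec) \<Rightarrow> 'a set \<Rightarrow> complex mat" where
  "fam_proj d c v X = (1 / c) \<cdot>\<^sub>m msum d (\<lambda>x. outer d (v x)) X"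

lemma fam_proj_carrier [simp]: "fam_proj d c v X \<in> carrier_mat d d"
  by (simp add: fam_proj_def)

lemma fam_proj_dim [simp]: "dim_row (fam_proj d c v X) = d" "dim_col (fam_proj d c v X) = d"
  by (simp_all add: fam_proj_def)

lemma fam_proj_adjoint:
  assumes "cnj c = c"
  shows "mat_adjoint (fam_proj d c v X) = fam_proj d c v X"
  using assms by (intro mat_adjoint_eqI[of _ d]) (auto simp: fam_proj_def msum_index outer_index mult_ac)

locale orth_family =
  fixes d :: nat and c :: complex and v :: "'a \<Rightarrow> complex vec" and X :: "'a set"
  assumes carrier: "x \<in> X \<Longrightarrow> v x \<in> carrier_vec d"
    and orth: "x \<in> X \<Longrightarrow> y \<in> X \<Longrightarrow> v x \<bullet>c v y = (if x = y then c else 0)"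
    and c_nz: "c \<noteq> 0"
    and fin: "finite X"
begin

lemma outer_mult:
  assumes "x \<in> X" "y \<in> X"
  shows "outer d (v x) * outer d (v y) = (if x = y then c \<cdot>\<^sub>m outer d (v x) else 0\<^sub>m d d)"
proof -
  \<comment> \<open>If two different indices had the same vector, its squared norm \<open>c\<close>
    would be 0.\<close>
  have "v x = v y \<longleftrightarrow> x = y"
    using orth[OF assms] orth[OF assms(1) assms(1)] c_nz by metis
  then show ?thesis
    using outer_mult_outer[OF carrier[OF assms(1)] carrier[OF assms(2)]] orth[OF assms(2,1)] by auto
qed

text \<open>In the double sum only equal indices survive. The case \<open>Y = Z\<close> is
  idempotence, and disjoint \<open>Y\<close>, \<open>Z\<close> give the orthogonality of different
  translates.\<close>

lemma proj_mult:
  assumes "Y \<subseteq> X" "Z \<subseteq> X"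
  shows "fam_proj d c v Y * fam_proj d c v Z = fam_proj d c v (Y \<inter> Z)"
proof -
  have *: "outer d (v y) * msum d (\<lambda>x. outer d (v x)) Z =
      (if y \<in> Z then c \<cdot>\<^sub>m outer d (v y) else 0\<^sub>m d d)" if "y \<in> Y" for y
  proof -
    have "outer d (v y) * msum d (\<lambda>x. outer d (v x)) Z = msum d (\<lambda>x. outer d (v y) * outer d (v x)) Z"
      by (rule mult_msum) simp_all
    also have "\<dots> = msum d (\<lambda>x. outer d (v y) * outer d (v x)) (Z \<inter> {y})"
      using assms that by (intro msum_mono_neutral) (auto simp: outer_mult subset_iff finite_subset[OF _ fin])
    also have "\<dots> = (if y \<in> Z then c \<cdot>\<^sub>m outer d (v y) else 0\<^sub>m d d)"
      using assms that by (auto simp: msum_empty msum_singleton outer_mult subset_iff)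
    finally show ?thesis .
  qed
  have fY: "finite Y" using assms fin finite_subset by blast
  have "msum d (\<lambda>x. outer d (v x)) Y * msum d (\<lambda>x. outer d (v x)) Z =
      msum d (\<lambda>y. outer d (v y) * msum d (\<lambda>x. outer d (v x)) Z) Y"
    by (rule msum_mult) simp_all
  also have "\<dots> = msum d (\<lambda>y. if y \<in> Z then c \<cdot>\<^sub>m outer d (v y) else 0\<^sub>m d d) Y"
    by (rule msum_cong) (rule *)
  also have "\<dots> = msum d (\<lambda>y. if y \<in> Z then c \<cdot>\<^sub>m outer d (v y) else 0\<^sub>m d d) (Y \<inter> Z)"
    using fY by (intro msum_mono_neutral) auto
  also have "\<dots> = msum d (\<lambda>y. c \<cdot>\<^sub>m outer d (v y)) (Y \<inter> Z)"
    by (rule msum_cong) simp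
  also have "\<dots> = c \<cdot>\<^sub>m msum d (\<lambda>y. outer d (v y)) (Y \<inter> Z)"
    by (rule smult_msum[symmetric]) simp
  finally show ?thesis
    using c_nz by (simp add: fam_proj_def smult_mult_smult[of _ d] smult_smult)
qed

lemma proj_vec:
  assumes "Y \<subseteq> X" "x \<in> Y"
  shows "fam_proj d c v Y *\<^sub>v v x = v x"
proof (rule eq_vecI)
  have fY: "finite Y" using assms fin finite_subset by blast
  have x: "v x \<in> carrier_vec d" using carrier assms by auto
  fix i assume "i < dim_vec (v x)"
  then have i: "i < d" using carrier_vecD[OF x] by simp
  have dim: "dim_vec (v y) = d" if "y \<in> Y" for y
    using carrier[of y] that assms by auto
  have "(msum d (\<lambda>x. outer d (v x)) Y *\<^sub>v v x) $ i = (\<Sum>y\<in>Y. (outer d (v y) *\<^sub>v v x) $ i)"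
    using x i by (intro msum_sum_index) simp_all
  also have "\<dots> = (\<Sum>y\<in>Y. if y = x then c * v x $ i else 0)"
    using assms x i carrier
    by (intro sum.cong refl) (auto simp: outer_mult_vec[of _ d] orth dim subset_iff simp del: index_mult_mat_vec)
  also have "\<dots> = c * v x $ i"
    using fY assms by simp
  finally have "(msum d (\<lambda>x. outer d (v x)) Y *\<^sub>v v x) $ i = c * v x $ i" .
  then show "(fam_proj d c v Y *\<^sub>v v x) $ i = v x $ i"
    using c_nz i x by (simp add: fam_proj_def smult_mat_vec[of _ d] del: index_mult_mat_vec)
next
  show "dim_vec (fam_proj d c v Y *\<^sub>v v x) = dim_vec (v x)"
    using carrier[of x] assms by auto
qed

end

section \<open>The Pauli group\<close>

definition pauli_str :: "nat \<Rightarrow> (nat \<Rightarrow> nat) \<Rightarrow> complex mat" where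
  "pauli_str n f = tens n (\<lambda>j. pauli1 (f j))"

lemma pauli_str_carrier [simp]: "pauli_str n f \<in> carrier_mat (2 ^ n) (2 ^ n)"
  by (simp add: pauli_str_def)

lemma pauli_op_eq: "pauli_op n c f = \<i> ^ c \<cdot>\<^sub>m pauli_str n f"
  by (rule eq_matI) (auto simp: pauli_op_def pauli_str_def tens_def)

lemma pauli_str_cong: "(\<And>j. j < n \<Longrightarrow> f j = g j) \<Longrightarrow> pauli_str n f = pauli_str n g"
  unfolding pauli_str_def by (rule tens_cong) simp

lemma pauli_str_adjoint: "mat_adjoint (pauli_str n f) = pauli_str n f"
  by (simp add: pauli_str_def tens_adjoint pauli1_adjoint)

lemma pauli_str_square: "pauli_str n f * pauli_str n f = 1\<^sub>m (2 ^ n)"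
  by (simp add: pauli_str_def tens_mult pauli1_square tens_one)

lemma pauli_str_commute:
  "\<exists>c \<in> {1, -1}. pauli_str n f * pauli_str n g = c \<cdot>\<^sub>m (pauli_str n g * pauli_str n f)"
proof -
  have "\<forall>j. \<exists>c. c \<in> {1, -1} \<and> pauli1 (f j) * pauli1 (g j) = c \<cdot>\<^sub>m (pauli1 (g j) * pauli1 (f j))"
    using pauli1_commute by blast
  then obtain c where c: "\<And>j. c j \<in> {1, -1 :: complex}"
    "\<And>j. pauli1 (f j) * pauli1 (g j) = c j \<cdot>\<^sub>m (pauli1 (g j) * pauli1 (f j))"
    by (auto dest!: choice)
  have "(\<Prod>j<k. c j) \<in> {1, -1}" for k
  proof (induction k)
    case (Suc k)
    then show ?case using c(1)[of k] by auto
  qed simp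
  moreover have "pauli_str n f * pauli_str n g = (\<Prod>j<n. c j) \<cdot>\<^sub>m (pauli_str n g * pauli_str n f)"
    by (simp add: pauli_str_def tens_mult c(2) tens_smult)
  ultimately show ?thesis by blast
qed

lemma pauli_str_mult:
  "\<exists>c h. (\<forall>j. h j < 4) \<and> pauli_str n f * pauli_str n g = \<i> ^ c \<cdot>\<^sub>m pauli_str n h"
proof -
  have "\<forall>j. \<exists>c h. h < 4 \<and> pauli1 (f j) * pauli1 (g j) = \<i> ^ c \<cdot>\<^sub>m pauli1 h"
    using pauli1_mult by blast
  then obtain c h where ch: "\<And>j. h j < 4" "\<And>j. pauli1 (f j) * pauli1 (g j) = \<i> ^ c j \<cdot>\<^sub>m pauli1 (h j)"
    by metis
  have "pauli_str n f * pauli_str n g = \<i> ^ (\<Sum>j<n. c j) \<cdot>\<^sub>m pauli_str n h"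
    by (simp add: pauli_str_def tens_mult ch(2) tens_smult power_sum)
  then show ?thesis using ch(1) by blast
qed

lemma imag_power_mod_4: "\<i> ^ c = \<i> ^ (c mod 4)"
proof -
  have "\<i> ^ c = \<i> ^ (4 * (c div 4) + c mod 4)" by simp
  also have "\<dots> = (\<i> ^ 4) ^ (c div 4) * \<i> ^ (c mod 4)" by (simp only: power_add power_mult)
  also have "\<i> ^ 4 = 1" by (simp add: eval_nat_numeral)
  finally show ?thesis by simp
qed

lemma pauli_groupI: "(\<And>j. j < n \<Longrightarrow> f j < 4) \<Longrightarrow> \<i> ^ c \<cdot>\<^sub>m pauli_str n f \<in> pauli_group n"
  unfolding pauli_group_def pauli_op_eq by (subst imag_power_mod_4) (auto intro!: exI[of _ "c mod 4"])

text \<open>The label function is cut down to an extensional one, so that the strings are indexed by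
  a finite set and a string determines its labels.\<close>

lemma pauli_groupE:
  assumes "M \<in> pauli_group n"
  obtains c f where "f \<in> {..<n} \<rightarrow>\<^sub>E {..<4}" "c < 4" "M = \<i> ^ c \<cdot>\<^sub>m pauli_str n f"
proof -
  obtain c f where cf: "c < 4" "\<forall>j<n. f j < 4" "M = \<i> ^ c \<cdot>\<^sub>m pauli_str n f"
    using assms by (auto simp: pauli_group_def pauli_op_eq)
  have "pauli_str n f = pauli_str n (restrict f {..<n})"
    by (rule pauli_str_cong) simp
  then show ?thesis
    using cf by (intro that[of "restrict f {..<n}" c]) auto
qed

lemma pauli_group_carrier: "M \<in> pauli_group n \<Longrightarrow> M \<in> carrier_mat (2 ^ n) (2 ^ n)"
  by (auto simp: pauli_group_def pauli_op_def)

lemma finite_pauli_group: "finite (pauli_group n)"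
proof (rule finite_subset)
  show "pauli_group n \<subseteq> (\<lambda>(c, f). \<i> ^ c \<cdot>\<^sub>m pauli_str n f) ` ({..<4} \<times> ({..<n} \<rightarrow>\<^sub>E {..<4}))"
    by (auto elim!: pauli_groupE)
qed (auto intro!: finite_PiE)

lemma one_in_pauli_group: "1\<^sub>m (2 ^ n) \<in> pauli_group n"
proof -
  have "pauli_str n (\<lambda>_. 0) = 1\<^sub>m (2 ^ n)"
    by (simp add: pauli_str_def pauli1_def tens_one)
  then show ?thesis
    using pauli_groupI[of n "\<lambda>_. 0" 0] by (simp add: one_smult_mat)
qed

lemma pauli_group_mult:
  assumes "A \<in> pauli_group n" "B \<in> pauli_group n"
  shows "A * B \<in> pauli_group n"
proof -
  obtain a f where A: "A = \<i> ^ a \<cdot>\<^sub>m pauli_str n f" using assms(1) by (rule pauli_groupE)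
  obtain b g where B: "B = \<i> ^ b \<cdot>\<^sub>m pauli_str n g" using assms(2) by (rule pauli_groupE)
  obtain c h where h: "\<forall>j. h j < 4" "pauli_str n f * pauli_str n g = \<i> ^ c \<cdot>\<^sub>m pauli_str n h"
    using pauli_str_mult by blast
  have "A * B = \<i> ^ (a + b + c) \<cdot>\<^sub>m pauli_str n h"
    by (simp add: A B h(2) smult_mult_smult[of _ "2 ^ n"] smult_smult power_add)
  then show ?thesis using h(1) by (auto intro: pauli_groupI)
qed

lemma pauli_group_commute:
  assumes "A \<in> pauli_group n" "B \<in> pauli_group n"
  shows "\<exists>c \<in> {1, -1}. A * B = c \<cdot>\<^sub>m (B * A)"
proof -
  obtain a f where A: "A = \<i> ^ a \<cdot>\<^sub>m pauli_str n f" using assms(1) by (rule pauli_groupE)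
  obtain b g where B: "B = \<i> ^ b \<cdot>\<^sub>m pauli_str n g" using assms(2) by (rule pauli_groupE)
  obtain c where c: "c \<in> {1, -1}" "pauli_str n f * pauli_str n g = c \<cdot>\<^sub>m (pauli_str n g * pauli_str n f)"
    using pauli_str_commute by blast
  have "A * B = c \<cdot>\<^sub>m (B * A)"
    by (simp add: A B c(2) smult_mult_smult[of _ "2 ^ n"] smult_smult mult_ac)
  then show ?thesis using c(1) by blast
qed

lemma pauli_group_square:
  assumes "A \<in> pauli_group n"
  shows "\<exists>c \<in> {1, -1}. A * A = c \<cdot>\<^sub>m 1\<^sub>m (2 ^ n)"
proof -
  obtain a f where A: "A = \<i> ^ a \<cdot>\<^sub>m pauli_str n f" using assms(1) by (rule pauli_groupE)
  have "A * A = (\<i> ^ a * \<i> ^ a) \<cdot>\<^sub>m 1\<^sub>m (2 ^ n)"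
    by (simp add: A smult_mult_smult[of _ "2 ^ n"] pauli_str_square)
  moreover have "\<i> ^ a * \<i> ^ a = (- 1) ^ a"
    by (simp flip: power_mult_distrib)
  moreover have "(- 1 :: complex) ^ a \<in> {1, -1}"
    by (cases "even a") auto
  ultimately show ?thesis by metis
qed

lemma adjoint_smult:
  fixes A :: "complex mat"
  assumes "A \<in> carrier_mat d d"
  shows "mat_adjoint (c \<cdot>\<^sub>m A) = cnj c \<cdot>\<^sub>m mat_adjoint A"
  using assms carrier_matD[OF mat_adjoint_carrier[OF assms]]
  by (intro mat_adjoint_eqI[of _ d]) (auto simp: mat_adjoint_index[of _ d])

lemma pauli_group_unitary:
  assumes "A \<in> pauli_group n"
  shows "A * mat_adjoint A = 1\<^sub>m (2 ^ n)" "mat_adjoint A * A = 1\<^sub>m (2 ^ n)"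
proof -
  obtain a f where A: "A = \<i> ^ a \<cdot>\<^sub>m pauli_str n f" using assms by (rule pauli_groupE)
  have *: "\<i> ^ a * cnj (\<i> ^ a) = 1"
    by (simp flip: power_mult_distrib)
  have **: "cnj (\<i> ^ a) * \<i> ^ a = 1"
    using * by (simp only: mult.commute)
  show "A * mat_adjoint A = 1\<^sub>m (2 ^ n)" "mat_adjoint A * A = 1\<^sub>m (2 ^ n)"
    by (simp_all only: A adjoint_smult[OF pauli_str_carrier] pauli_str_adjoint
        smult_mult_smult[OF pauli_str_carrier pauli_str_carrier] pauli_str_square * ** one_smult_mat)
qed

section \<open>Completeness and trace orthogonality of Pauli strings\<close>

lemma sum_lessThan_2: "(\<Sum>p<2::nat. F p) = F 0 + (F 1 :: 'a :: comm_monoid_add)"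
  by (simp add: eval_nat_numeral)

lemma sum_lessThan_4: "(\<Sum>p<4::nat. F p) = F 0 + F 1 + F 2 + (F 3 :: 'a :: comm_monoid_add)"
  by (simp add: eval_nat_numeral)

lemma pauli1_completeness:
  assumes "a < 2" "b < 2" "c < 2" "d < 2"
  shows "(\<Sum>p<4. pauli1 p $$ (a, b) * pauli1 p $$ (c, d)) = (if a = d \<and> b = c then 2 else 0)"
  using assms by (auto simp: less_2_cases_iff pauli1_index sum_lessThan_4)

text \<open>On one qubit the sum of P tensor P over the four Pauli matrices is twice the swap
  operator; the sum over all strings is the tensor power of this identity.\<close>

lemma pauli_str_completeness:
  assumes "a < 2 ^ n" "b < 2 ^ n" "c < 2 ^ n" "d < 2 ^ n"
  shows "(\<Sum>f\<in>{..<n} \<rightarrow>\<^sub>E {..<4}. pauli_str n f $$ (a, b) * pauli_str n f $$ (c, d)) =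
    (if a = d \<and> b = c then 2 ^ n else 0)"
proof -
  have "(\<Sum>f\<in>{..<n} \<rightarrow>\<^sub>E {..<4}. pauli_str n f $$ (a, b) * pauli_str n f $$ (c, d)) =
     (\<Sum>f\<in>{..<n} \<rightarrow>\<^sub>E {..<4}. \<Prod>j<n. pauli1 (f j) $$ (qb a j, qb b j) * pauli1 (f j) $$ (qb c j, qb d j))"
    using assms by (simp add: pauli_str_def tens_index prod.distrib)
  also have "\<dots> = (\<Prod>j<n. \<Sum>p<4. pauli1 p $$ (qb a j, qb b j) * pauli1 p $$ (qb c j, qb d j))"
    by (rule prod_sum_PiE[symmetric]) auto
  also have "\<dots> = (\<Prod>j<n. if qb a j = qb d j \<and> qb b j = qb c j then 2 else 0)"
    by (simp add: pauli1_completeness)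
  also have "\<dots> = (if \<forall>j<n. qb a j = qb d j \<and> qb b j = qb c j then 2 ^ n else 0)"
    by auto
  also have "(\<forall>j<n. qb a j = qb d j \<and> qb b j = qb c j) \<longleftrightarrow> a = d \<and> b = c"
    using eq_iff_qb[of a n d] eq_iff_qb[of b n c] assms by auto
  finally show ?thesis .
qed

text \<open>Different strings are orthogonal for the trace form, whereas proportionality of
  \<open>f\<close> to \<open>g\<close> forces a nonzero trace of their product. Extensionality turns
  agreement on the \<open>n\<close> qubits into equality of functions.\<close>

lemma pauli_str_proportional:
  assumes "pauli_str n f = c \<cdot>\<^sub>m pauli_str n g" "f \<in> {..<n} \<rightarrow>\<^sub>E {..<4}" "g \<in> {..<n} \<rightarrow>\<^sub>E {..<4}"
  shows "f = g"
proof -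
  define tr where "tr f g = (\<Sum>a<2 ^ n. \<Sum>b<2 ^ n. pauli_str n f $$ (a, b) * pauli_str n g $$ (b, a))" for f g
  have tr_eq: "tr f g = (\<Prod>j<n. \<Sum>a<2. \<Sum>b<2. pauli1 (f j) $$ (a, b) * pauli1 (g j) $$ (b, a))" for f g
  proof -
    have "tr f g = (\<Sum>a<2 ^ n. \<Sum>b<2 ^ n. \<Prod>j<n. pauli1 (f j) $$ (qb a j, qb b j) * pauli1 (g j) $$ (qb b j, qb a j))"
      unfolding tr_def by (simp add: pauli_str_def tens_index prod.distrib)
    also have "\<dots> = (\<Sum>a<2 ^ n. \<Prod>j<n. \<Sum>b<2. pauli1 (f j) $$ (qb a j, b) * pauli1 (g j) $$ (b, qb a j))"
      unfolding sum_lessThan_2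
      by (rule sum.cong[OF refl], rule sum_prod_qb)
    also have "\<dots> = (\<Prod>j<n. \<Sum>a<2. \<Sum>b<2. pauli1 (f j) $$ (a, b) * pauli1 (g j) $$ (b, a))"
      unfolding sum_lessThan_2[of "\<lambda>a. \<Sum>b<2. F a b" for F]
      by (rule sum_prod_qb)
    finally show ?thesis .
  qed
  have one: "(\<Sum>a<2. \<Sum>b<2. pauli1 p $$ (a, b) * pauli1 q $$ (b, a)) = (if p = q then 2 else 0)"
    if "p < 4" "q < 4" for p q
    proof -
    have "p \<in> {0, 1, 2, 3}" "q \<in> {0, 1, 2, 3}" using that by auto
    then show ?thesis by (auto simp: sum_lessThan_2 pauli1_index)
  qed
  have tr_val: "tr f g = (if f = g then 2 ^ n else 0)"
    if "f \<in> {..<n} \<rightarrow>\<^sub>E {..<4}" "g \<in> {..<n} \<rightarrow>\<^sub>E {..<4}" for f g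
  proof -
    have "f j < 4" "g j < 4" if "j < n" for j
      using that \<open>f \<in> _\<close> \<open>g \<in> _\<close> by (auto simp: PiE_iff)
    then have "tr f g = (\<Prod>j<n. if f j = g j then 2 else 0)"
      by (simp add: tr_eq one)
    also have "\<dots> = (if \<forall>j<n. f j = g j then 2 ^ n else 0)"
      by auto
    also have "(\<forall>j<n. f j = g j) \<longleftrightarrow> f = g"
      using that PiE_ext[of f "{..<n}" "\<lambda>_. {..<4}" g] by blast
    finally show ?thesis .
  qed
  have "tr f f = c * tr g f"
    unfolding tr_def assms(1)[THEN arg_cong[where f = "\<lambda>M. M $$ x" for x]] 
    by (simp add: sum_distrib_left mult_ac assms(1) carrier_matD[OF pauli_str_carrier])
  then have "tr g f \<noteq> 0"
    using tr_val[OF assms(2,2)] by auto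
  then show ?thesis
    using tr_val[OF assms(3,2)] by (auto split: if_splits)
qed

text \<open>After writing each expectation as a double sum over entries, the completeness relation
  selects the single term \<open>s $ i * cnj (s $ j)\<close>.\<close>

lemma outer_pauli_expansion:
  assumes "s \<in> carrier_vec (2 ^ n)"
  shows "outer (2 ^ n) s = (1 / 2 ^ n) \<cdot>\<^sub>m
    msum (2 ^ n) (\<lambda>f. ((pauli_str n f *\<^sub>v s) \<bullet>c s) \<cdot>\<^sub>m pauli_str n f) ({..<n} \<rightarrow>\<^sub>E {..<4})"
  (is "_ = ?R")
proof (rule eq_matI)
  fix i j assume "i < dim_row ?R" "j < dim_col ?R"
  then have ij: "i < 2 ^ n" "j < 2 ^ n" by simp_all
  let ?F = "{..<n} \<rightarrow>\<^sub>E {..<4::nat}"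
  have e: "(pauli_str n f *\<^sub>v s) \<bullet>c s = (\<Sum>a<2 ^ n. \<Sum>b<2 ^ n. s $ b * cnj (s $ a) * pauli_str n f $$ (a, b))" for f
    using assms by (simp add: cscalar_prod_sum[of _ "2 ^ n"] mult_mat_vec_index[of _ "2 ^ n"] sum_distrib_right
        sum_distrib_left mult_ac del: index_mult_mat_vec)
  have "(\<Sum>f\<in>?F. (((pauli_str n f *\<^sub>v s) \<bullet>c s) \<cdot>\<^sub>m pauli_str n f) $$ (i, j)) =
     (\<Sum>f\<in>?F. \<Sum>a<2 ^ n. \<Sum>b<2 ^ n. s $ b * cnj (s $ a) * (pauli_str n f $$ (a, b) * pauli_str n f $$ (i, j)))"
    using ij by (intro sum.cong refl) (simp add: e sum_distrib_left sum_distrib_right mult_ac carrier_matD[OF pauli_str_carrier])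
  also have "\<dots> = (\<Sum>a<2 ^ n. \<Sum>f\<in>?F. \<Sum>b<2 ^ n. s $ b * cnj (s $ a) * (pauli_str n f $$ (a, b) * pauli_str n f $$ (i, j)))"
    by (rule sum.swap)
  also have "\<dots> = (\<Sum>a<2 ^ n. \<Sum>b<2 ^ n. \<Sum>f\<in>?F. s $ b * cnj (s $ a) * (pauli_str n f $$ (a, b) * pauli_str n f $$ (i, j)))"
    by (intro sum.cong refl sum.swap)
  also have "\<dots> = (\<Sum>a<2 ^ n. \<Sum>b<2 ^ n. s $ b * cnj (s $ a) * (if a = j \<and> b = i then 2 ^ n else 0))"
    using ij by (intro sum.cong refl) (simp add: pauli_str_completeness flip: sum_distrib_left)
  also have "\<dots> = (\<Sum>a<2 ^ n. if a = j then s $ i * cnj (s $ a) * 2 ^ n else 0)"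
    using ij by (intro sum.cong refl) (auto simp: if_distrib[of "\<lambda>x. _ * x"] cong: if_cong)
  also have "\<dots> = 2 ^ n * (s $ i * cnj (s $ j))"
    using ij by simp
  finally show "outer (2 ^ n) s $$ (i, j) = ?R $$ (i, j)"
    using ij by (simp add: outer_index msum_index)
qed simp_all

section \<open>Stabilizer states\<close>

lemma mult_mult_vec:
  fixes A B :: "complex mat"
  shows "A \<in> carrier_mat d d \<Longrightarrow> B \<in> carrier_mat d d \<Longrightarrow> v \<in> carrier_vec d \<Longrightarrow> (A * B) *\<^sub>v v = A *\<^sub>v (B *\<^sub>v v)"
  by (rule assoc_mult_mat_vec)

lemma mult_assoc_sq:
  fixes A B C :: "complex mat"
  shows "A \<in> carrier_mat d d \<Longrightarrow> B \<in> carrier_mat d d \<Longrightarrow> C \<in> carrier_mat d d \<Longrightarrow> A * B * C = A * (B * C)"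
  by (rule assoc_mult_mat)

lemma smult_cscalar:
  fixes v w :: "complex vec"
  assumes "v \<in> carrier_vec d" "w \<in> carrier_vec d"
  shows "(c \<cdot>\<^sub>v v) \<bullet>c w = c * (v \<bullet>c w)"
  using assms by (simp add: cscalar_prod_sum[of _ d] sum_distrib_left mult_ac)

text \<open>As \<open>M\<close> is unitary and fixes \<open>s\<close>, its adjoint fixes
  \<open>s\<close> too. Inserting \<open>M\<close> on the right of \<open>N\<close> and moving it to
  the other side of the inner product shows that the expectation equals its own negative.\<close>

lemma anticommuting_stabilizer_expectation:
  assumes N: "N \<in> pauli_group n" and M: "M \<in> pauli_group n" and s: "s \<in> carrier_vec (2 ^ n)"
    and stab: "M *\<^sub>v s = s" and anti: "N * M \<noteq> M * N"
  shows "(N *\<^sub>v s) \<bullet>c s = 0"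
proof -
  note [simp] = pauli_group_carrier[OF N] pauli_group_carrier[OF M] s
  have Mc: "mat_adjoint M \<in> carrier_mat (2 ^ n) (2 ^ n)" by simp
  have Ns: "N *\<^sub>v s \<in> carrier_vec (2 ^ n)" by (rule mult_mat_vec_carrier[of _ _ "2 ^ n"]) simp_all
  have MNs: "M *\<^sub>v (N *\<^sub>v s) \<in> carrier_vec (2 ^ n)" by (rule mult_mat_vec_carrier[of _ _ "2 ^ n"]) (simp_all add: Ns)
  obtain c where c: "c \<in> {1, - 1}" "N * M = c \<cdot>\<^sub>m (M * N)"
    using pauli_group_commute[OF N M] by blast
  then have anti': "N * M = - 1 \<cdot>\<^sub>m (M * N)"
    using anti by (auto simp: one_smult_mat)
  have MN: "M * N \<in> carrier_mat (2 ^ n) (2 ^ n)"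
    by (rule mult_carrier_mat[of _ _ "2 ^ n"]) simp_all
  have "N *\<^sub>v s = (N * M) *\<^sub>v s"
    by (simp add: mult_mult_vec[of _ "2 ^ n"] stab)
  also have "\<dots> = - 1 \<cdot>\<^sub>v (M *\<^sub>v (N *\<^sub>v s))"
    unfolding anti' smult_mat_vec[OF MN s] by (simp add: mult_mult_vec[of _ "2 ^ n"])
  finally have 1: "N *\<^sub>v s = - 1 \<cdot>\<^sub>v (M *\<^sub>v (N *\<^sub>v s))" .
  have 2: "mat_adjoint M *\<^sub>v s = s"
    using mult_mult_vec[OF Mc pauli_group_carrier[OF M] s] pauli_group_unitary(2)[OF M] stab by simp
  have "(N *\<^sub>v s) \<bullet>c s = - 1 * ((M *\<^sub>v (N *\<^sub>v s)) \<bullet>c s)"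
    by (subst 1, rule smult_cscalar[OF MNs s])
  also have "(M *\<^sub>v (N *\<^sub>v s)) \<bullet>c s = (N *\<^sub>v s) \<bullet>c s"
    by (subst cscalar_prod_adjoint[OF _ Ns s]) (simp_all add: 2)
  finally show ?thesis by simp
qed

text \<open>If \<open>N\<close> commutes with the whole stabilizer group \<open>S\<close> and \<open>N s \<noteq> - s\<close>, then \<open>S \<union> N S\<close> is again
a stabilizer group, so maximality puts \<open>N\<close> into \<open>S\<close>.\<close>
lemma stabilizer_state_expectation:
  assumes st: "stabilizer_state n s" and f: "\<And>j. j < n \<Longrightarrow> f j < 4"
  defines "N \<equiv> pauli_str n f"
  shows "(N *\<^sub>v s) \<bullet>c s = 0 \<or> N *\<^sub>v s = s \<or> N *\<^sub>v s = - 1 \<cdot>\<^sub>v s"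
proof -
  obtain S where S: "maximal_stab_subgroup n S" "\<And>M. M \<in> S \<Longrightarrow> M *\<^sub>v s = s"
    and s: "s \<in> carrier_vec (2 ^ n)"
    using st by (auto simp: stabilizer_state_def)
  have ab: "abelian_stab_subgroup n S" using S(1) by (simp add: maximal_stab_subgroup_def)
  have S1: "1\<^sub>m (2 ^ n) \<in> S" and Sm1: "- 1\<^sub>m (2 ^ n) \<notin> S"
    using ab unfolding abelian_stab_subgroup_def by blast+
  have SS: "A * B \<in> S" "A * B = B * A" if "A \<in> S" "B \<in> S" for A B
    using ab that unfolding abelian_stab_subgroup_def by blast+
  have N: "N \<in> pauli_group n"
    using pauli_groupI[of n f 0] f by (simp add: N_def one_smult_mat)
  have NN: "N * N = 1\<^sub>m (2 ^ n)" by (simp add: N_def pauli_str_square)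
  have Sp: "M \<in> pauli_group n" if "M \<in> S" for M
    using ab that unfolding abelian_stab_subgroup_def by blast
  have Sc: "M \<in> carrier_mat (2 ^ n) (2 ^ n)" if "M \<in> S" for M
    using Sp[OF that] by (rule pauli_group_carrier)
  have Nc [simp]: "N \<in> carrier_mat (2 ^ n) (2 ^ n)" by (simp add: N_def)
  consider M where "M \<in> S" "N * M \<noteq> M * N" | "\<forall>M\<in>S. N * M = M * N" by blast
  then show ?thesis
  proof cases
    case 1
    then show ?thesis
      using anticommuting_stabilizer_expectation[OF N Sp s S(2)] by blast
  next
    case 2
    \<comment> \<open>Closure of \<open>T\<close> uses that \<open>N\<close> squares to one and
      commutes with \<open>S\<close>. The only way in which \<open>T\<close> can fail is
      \<open>- 1\<^sub>m (2 ^ n) \<in> T\<close>; then \<open>N\<close> is minus the inverse of an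
      element of \<open>S\<close> and maps \<open>s\<close> to its negative.\<close>
    define T where "T = S \<union> (\<lambda>M. N * M) ` S"
    show ?thesis
    proof (cases "- 1\<^sub>m (2 ^ n) \<in> T")
      case True
      then obtain M where M: "M \<in> S" "N * M = - 1\<^sub>m (2 ^ n)"
        using Sm1 unfolding T_def by fastforce
      have "N *\<^sub>v s = (N * M) *\<^sub>v s"
        using M(1) Sc s by (simp add: mult_mult_vec[of _ "2 ^ n"] S(2))
      also have "\<dots> = - 1 \<cdot>\<^sub>v s"
        using s by (intro eq_vecI) (auto simp: M(2))
      finally show ?thesis by simp
    next
      case False
      have p2: "(N * A) * B = N * (A * B)" if "A \<in> S" "B \<in> S" for A B
        by (rule mult_assoc_sq[OF Nc Sc Sc]) (rule that)+
      have p1: "A * (N * B) = N * (A * B)" if "A \<in> S" "B \<in> S" for A B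
      proof -
        have "A * (N * B) = A * N * B"
          by (rule mult_assoc_sq[OF Sc Nc Sc, symmetric]) (rule that)+
        also have "A * N = N * A" using 2 that(1) by simp
        finally show ?thesis by (simp only: p2[OF that])
      qed
      have p3: "(N * A) * (N * B) = A * B" if "A \<in> S" "B \<in> S" for A B
      proof -
        have "(N * A) * (N * B) = N * (A * (N * B))"
          using Sc that by (intro mult_assoc_sq[of _ "2 ^ n"]) (auto intro!: mult_carrier_mat[of _ _ "2 ^ n"])
        also have "\<dots> = N * (N * (A * B))" by (simp add: p1 that)
        also have "\<dots> = N * N * (A * B)"
          using Sc that by (intro mult_assoc_sq[of _ "2 ^ n", symmetric]) (auto intro!: mult_carrier_mat[of _ _ "2 ^ n"])
        finally show ?thesis using left_mult_one_mat[OF Sc[OF SS(1)[OF that]]] by (simp add: NN)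
      qed
      have "abelian_stab_subgroup n T"
        unfolding abelian_stab_subgroup_def
      proof (intro conjI ballI)
        show "T \<subseteq> pauli_group n" using Sp N by (auto simp: T_def intro: pauli_group_mult)
        show "1\<^sub>m (2 ^ n) \<in> T" using S1 by (simp add: T_def)
        show "A * B \<in> T" if "A \<in> T" "B \<in> T" for A B
        proof -
          consider "A \<in> S" "B \<in> S" | B' where "A \<in> S" "B' \<in> S" "B = N * B'"
            | A' where "A' \<in> S" "B \<in> S" "A = N * A'"
            | A' B' where "A' \<in> S" "B' \<in> S" "A = N * A'" "B = N * B'"
            using \<open>A \<in> T\<close> \<open>B \<in> T\<close> unfolding T_def by blast
          then show ?thesis
            by cases (simp_all only: p1 p2 p3 T_def UnI1 UnI2 SS(1) imageI)
        qed
        show "A * B = B * A" if "A \<in> T" "B \<in> T" for A B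
        proof -
          consider "A \<in> S" "B \<in> S" | B' where "A \<in> S" "B' \<in> S" "B = N * B'"
            | A' where "A' \<in> S" "B \<in> S" "A = N * A'"
            | A' B' where "A' \<in> S" "B' \<in> S" "A = N * A'" "B = N * B'"
            using \<open>A \<in> T\<close> \<open>B \<in> T\<close> unfolding T_def by blast
          then show ?thesis
            by cases (simp_all only: p1 p2 p3 SS(2))
        qed
        show "- 1\<^sub>m (2 ^ n) \<notin> T" by (rule False)
      qed
      then have "T = S" using S(1) unfolding maximal_stab_subgroup_def T_def by blast
      moreover have "N * 1\<^sub>m (2 ^ n) \<in> T" using S1 by (simp add: T_def)
      ultimately have "N \<in> S" using right_mult_one_mat[OF Nc] by simp
      then show ?thesis using S(2) by blast
    qed
  qed
qed

section \<open>Generators of elementary abelian matrix groups\<close>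

text \<open>For an involution \<open>M\<close> the factor is the spectral projector for eigenvalue
  1, so for commuting involutions the product projects onto their common fixed space.\<close>

fun gen_proj :: "nat \<Rightarrow> complex mat list \<Rightarrow> complex mat" where
  "gen_proj d [] = 1\<^sub>m d"
| "gen_proj d (M # Ms) = gen_proj d Ms * ((1 / 2) \<cdot>\<^sub>m (1\<^sub>m d + M))"

lemma gen_proj_carrier: "set Ms \<subseteq> carrier_mat d d \<Longrightarrow> gen_proj d Ms \<in> carrier_mat d d"
  by (induction Ms) (auto intro!: mult_carrier_mat[of _ _ d])

text \<open>Every element is its own inverse, so closure under products makes \<open>G\<close> a
  group. It is kept as a set of matrices because both its products and the sum of its elements
  matter.\<close>

locale elementary_abelian_mats =
  fixes d :: nat and G :: "complex mat set"
  assumes fin: "finite G" and carrier: "A \<in> G \<Longrightarrow> A \<in> carrier_mat d d"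
    and one: "1\<^sub>m d \<in> G"
    and mult: "A \<in> G \<Longrightarrow> B \<in> G \<Longrightarrow> A * B \<in> G"
    and comm: "A \<in> G \<Longrightarrow> B \<in> G \<Longrightarrow> A * B = B * A"
    and square: "A \<in> G \<Longrightarrow> A * A = 1\<^sub>m d"
begin

lemma mult_cancel:
  assumes "A \<in> G" "B \<in> G"
  shows "A * (A * B) = B"
  using assms mult_assoc_sq[OF carrier carrier carrier, OF assms(1,1,2)] carrier[OF assms(2)] by (simp add: square)

text \<open>Multiplication by a group element only permutes the summands.\<close>

lemma mult_msum_group:
  assumes "A \<in> G"
  shows "A * msum d id G = msum d id G"
proof -
  have inj: "inj_on (\<lambda>B. A * B) G"
    using mult_cancel[OF assms] by (rule inj_on_inverseI)
  have img: "(\<lambda>B. A * B) ` G = G"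
  proof (rule equalityI)
    show "G \<subseteq> (\<lambda>B. A * B) ` G"
      using mult_cancel[OF assms] mult[OF assms] by (metis image_eqI subsetI)
  qed (use mult[OF assms] in auto)
  have "A * msum d id G = msum d (\<lambda>B. A * id B) G"
    using assms carrier by (intro mult_msum) auto
  also have "\<dots> = msum d id ((\<lambda>B. A * B) ` G)"
    by (simp add: msum_reindex[OF inj])
  finally show ?thesis by (simp add: img)
qed

lemma msum_group_square: "msum d id G * msum d id G = of_nat (card G) \<cdot>\<^sub>m msum d id G"
proof -
  have "msum d id G * msum d id G = msum d (\<lambda>A. id A * msum d id G) G"
    using carrier by (intro msum_mult) auto
  also have "\<dots> = msum d (\<lambda>A. msum d id G) G"
    by (rule msum_cong) (simp add: mult_msum_group)
  finally show ?thesis by (simp add: msum_const)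
qed

text \<open>Invariant of the greedy choice of generators. It records the order and the sum of
  \<open>H\<close> rather than the span of \<open>Ms\<close>, since these are what the projector and
  the gate count need.\<close>

definition generates :: "complex mat set \<Rightarrow> complex mat list \<Rightarrow> bool" where
  "generates H Ms \<longleftrightarrow> H \<subseteq> G \<and> set Ms \<subseteq> G \<and> 1\<^sub>m d \<in> H \<and> (\<forall>A\<in>H. \<forall>B\<in>H. A * B \<in> H) \<and>
     card H = 2 ^ length Ms \<and> msum d id H = (2 ^ length Ms) \<cdot>\<^sub>m gen_proj d Ms"

text \<open>The coset of \<open>M\<close> is disjoint from \<open>H\<close>, so the order doubles,
  and the sum over both is the old sum times \<open>1 + M\<close>: one more factor 2 and one more
  factor \<open>(1 + M) / 2\<close>.\<close>

lemma generates_extend: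
  assumes H: "generates H Ms" and M: "M \<in> G" "M \<notin> H"
  shows "generates (H \<union> (\<lambda>A. M * A) ` H) (M # Ms)"
proof -
  have HG: "H \<subseteq> G" "set Ms \<subseteq> G" "1\<^sub>m d \<in> H" "\<And>A B. A \<in> H \<Longrightarrow> B \<in> H \<Longrightarrow> A * B \<in> H"
    "card H = 2 ^ length Ms" "msum d id H = (2 ^ length Ms) \<cdot>\<^sub>m gen_proj d Ms"
    using H unfolding generates_def by blast+
  have HG': "A \<in> G" if "A \<in> H" for A using HG(1) that by auto
  have finH: "finite H" using HG(1) fin by (rule finite_subset)
  have inj: "inj_on (\<lambda>B. M * B) H"
    by (rule inj_on_inverseI[of _ "\<lambda>B. M * B"]) (rule mult_cancel[OF M(1) HG'])
  have disj: "H \<inter> (\<lambda>A. M * A) ` H = {}"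
  proof (rule ccontr)
    assume "H \<inter> (\<lambda>A. M * A) ` H \<noteq> {}"
    then obtain A where A: "A \<in> H" "M * A \<in> H" by auto
    have "A * (A * M) = M" using mult_cancel[OF HG'[OF A(1)] M(1)] .
    then have "M = A * (M * A)" using comm[OF M(1) HG'[OF A(1)]] by simp
    then show False using HG(4)[OF A] M(2) by simp
  qed
  have assoc: "A * B * C = A * (B * C)" if "A \<in> G" "B \<in> G" "C \<in> G" for A B C
    by (rule mult_assoc_sq[OF carrier carrier carrier]) (rule that)+
  have p2: "(M * A) * B = M * (A * B)" if "A \<in> H" "B \<in> H" for A B
    by (rule assoc[OF M(1) HG' HG']) (rule that)+
  have p1: "A * (M * B) = M * (A * B)" if "A \<in> H" "B \<in> H" for A B
  proof -
    have "A * (M * B) = A * M * B"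
      by (rule assoc[OF HG' M(1) HG', symmetric]) (rule that)+
    also have "A * M = M * A" by (rule comm[OF HG'[OF that(1)] M(1)])
    finally show ?thesis by (simp only: p2[OF that])
  qed
  have p3: "(M * A) * (M * B) = A * B" if "A \<in> H" "B \<in> H" for A B
  proof -
    have "(M * A) * (M * B) = M * (A * (M * B))"
      by (rule assoc[OF M(1) HG' mult[OF M(1) HG']]) (rule that)+
    also have "\<dots> = M * (M * (A * B))" by (simp only: p1[OF that])
    finally show ?thesis using mult_cancel[OF M(1) HG'[OF HG(4)[OF that]]] by simp
  qed
  have mM: "M \<in> carrier_mat d d" using carrier M(1) by auto
  have gp: "gen_proj d Ms \<in> carrier_mat d d"
    using HG(2) carrier by (intro gen_proj_carrier subsetI) blast
  have id: "id A \<in> carrier_mat d d" if "A \<in> H" for A using HG'[OF that] carrier by simp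
  have "msum d id (H \<union> (\<lambda>A. M * A) ` H) = msum d id H + msum d (\<lambda>A. id A * M) H"
  proof -
    have "msum d id ((\<lambda>A. M * A) ` H) = msum d (\<lambda>A. id (M * A)) H"
      by (rule msum_reindex[OF inj])
    also have "\<dots> = msum d (\<lambda>A. id A * M) H"
      by (rule msum_cong) (simp only: id_apply comm[OF M(1) HG'])
    finally show ?thesis
      by (simp only: msum_Un[OF finH finite_imageI[OF finH] disj])
  qed
  also have "\<dots> = msum d id H + msum d id H * M"
    by (simp only: msum_mult[OF mM id])
  also have "\<dots> = msum d id H * (1\<^sub>m d + M)"
    by (subst mult_add_distrib_mat[of _ d d _ d]) (simp_all add: mM)
  also have "\<dots> = (2 ^ length (M # Ms)) \<cdot>\<^sub>m gen_proj d (M # Ms)"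
  proof -
    have 1: "1\<^sub>m d + M \<in> carrier_mat d d" using mM by simp
    show ?thesis
      by (simp add: HG(6) mult_smult_assoc_mat[OF gp 1] mult_smult_distrib[OF gp 1] smult_smult)
  qed
  finally have "msum d id (H \<union> (\<lambda>A. M * A) ` H) = (2 ^ length (M # Ms)) \<cdot>\<^sub>m gen_proj d (M # Ms)" .
  moreover have "card (H \<union> (\<lambda>A. M * A) ` H) = 2 ^ length (M # Ms)"
    using finH disj by (simp add: card_Un_disjoint card_image[OF inj] HG(5))
  moreover have "A * B \<in> H \<union> (\<lambda>A. M * A) ` H"
    if "A \<in> H \<union> (\<lambda>A. M * A) ` H" "B \<in> H \<union> (\<lambda>A. M * A) ` H" for A B
    using that by (auto simp: p1 p2 p3 intro: HG(4))
  moreover have "H \<union> (\<lambda>A. M * A) ` H \<subseteq> G" using HG' mult[OF M(1)] by auto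
  ultimately show ?thesis
    using HG(2,3) M(1) unfolding generates_def by simp
qed

text \<open>Starting from the trivial subgroup, any missing element is added. Each addition doubles
  the subgroup, so the number of missing elements decreases.\<close>

lemma exists_generators:
  "\<exists>Ms. set Ms \<subseteq> G \<and> card G = 2 ^ length Ms \<and> msum d id G = of_nat (card G) \<cdot>\<^sub>m gen_proj d Ms"
proof -
  have ext: "\<exists>Ms. generates G Ms" if "generates H Ms" for H Ms
    using that
  proof (induction "card G - card H" arbitrary: H Ms rule: less_induct)
    case less
    have HG: "H \<subseteq> G" using less.prems by (auto simp: generates_def)
    show ?case
    proof (cases "H = G")
      case False
      then obtain M where M: "M \<in> G" "M \<notin> H" using HG by auto
      define H' where "H' = H \<union> (\<lambda>A. M * A) ` H"
      have g: "generates H' (M # Ms)"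
        unfolding H'_def using less.prems M by (rule generates_extend)
      have "card H' = 2 * card H" "card H > 0" "H' \<subseteq> G"
        using less.prems g by (auto simp: generates_def)
      moreover have "card H' \<le> card G" using fin \<open>H' \<subseteq> G\<close> by (rule card_mono)
      ultimately have "card G - card H' < card G - card H" by linarith
      then show ?thesis using g by (rule less.hyps)
    qed (use less.prems in auto)
  qed
  have "generates {1\<^sub>m d} []"
    using one by (simp add: generates_def msum_singleton one_smult_mat)
  then obtain Ms where "generates G Ms" using ext by blast
  then show ?thesis by (auto simp: generates_def)
qed

end

section \<open>Action of gates on ancilla basis states\<close>

lemma set_bit_less_pow: "q < N \<Longrightarrow> r < 2 ^ N \<Longrightarrow> set_bit q r < (2 ^ N :: nat)"
proof -
  assume "q < N" "r < 2 ^ N"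
  then have "take_bit N (set_bit q r) = set_bit q r"
    by (simp add: take_bit_set_bit_eq take_bit_nat_eq_self)
  then show ?thesis by (simp only: take_bit_nat_eq_self_iff)
qed

lemma unset_bit_less_pow: "r < 2 ^ N \<Longrightarrow> unset_bit q r < (2 ^ N :: nat)"
proof -
  assume r: "r < 2 ^ N"
  have "unset_bit q r \<le> r"
    using unset_bit_less_eq[of q "int r"] by (simp flip: of_nat_unset_bit_eq)
  then show ?thesis using r by (rule le_less_trans)
qed

lemma nat_eq_iff_bit_below:
  fixes r s :: nat
  assumes "r < 2 ^ N" "s < 2 ^ N"
  shows "r = s \<longleftrightarrow> (\<forall>j<N. bit r j = bit s j)"
  unfolding eq_iff_qb[OF assms] qb_eq_bit of_bool_eq_iff ..

definition put_bit :: "nat \<Rightarrow> nat \<Rightarrow> nat \<Rightarrow> nat" where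
  "put_bit q b r = (if b = 0 then unset_bit q r else set_bit q r)"

lemma bit_put_bit: "bit (put_bit q b r) j \<longleftrightarrow> (if j = q then b \<noteq> 0 else bit r j)"
  by (auto simp: put_bit_def bit_unset_bit_iff bit_set_bit_iff)

lemma put_bit_less_pow: "q < N \<Longrightarrow> r < 2 ^ N \<Longrightarrow> put_bit q b r < 2 ^ N"
  by (simp add: put_bit_def set_bit_less_pow unset_bit_less_pow)

lemma sum_two_points:
  fixes f :: "nat \<Rightarrow> complex"
  assumes "a < d" "b < d" "a \<noteq> b" "\<And>x. x < d \<Longrightarrow> x \<noteq> a \<Longrightarrow> x \<noteq> b \<Longrightarrow> f x = 0"
  shows "(\<Sum>x<d. f x) = f a + f b"
proof -
  have "(\<Sum>x<d. f x) = (\<Sum>x\<in>{a, b}. f x)"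
    using assms by (intro sum.mono_neutral_right) auto
  then show ?thesis using assms(3) by simp
qed

lemma gate_mat_carrier [simp]: "gate_mat N G \<in> carrier_mat (2 ^ N) (2 ^ N)"
  by (cases G) auto

lemma G1_index:
  "r < 2 ^ N \<Longrightarrow> x < 2 ^ N \<Longrightarrow> gate_mat N (G1 q U) $$ (r, x) =
    (if \<forall>j<N. j \<noteq> q \<longrightarrow> qb r j = qb x j then U $$ (qb r q, qb x q) else 0)"
  by simp

lemma G2_index:
  "r < 2 ^ N \<Longrightarrow> x < 2 ^ N \<Longrightarrow> gate_mat N (G2 p q U) $$ (r, x) =
    (if \<forall>j<N. j \<noteq> p \<and> j \<noteq> q \<longrightarrow> qb r j = qb x j
     then U $$ (qb r p + 2 * qb r q, qb x p + 2 * qb x q) else 0)"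
  by simp

declare gate_mat.simps [simp del]

text \<open>These are the only two columns in which row \<open>r\<close> of a one-qubit gate can be
  nonzero, which cuts the sum over \<open>2 ^ N\<close> columns down to two terms.\<close>

lemma eq_off_bit_iff:
  assumes "r < 2 ^ N" "x < 2 ^ N" "q < N"
  shows "(\<forall>j<N. j \<noteq> q \<longrightarrow> qb r j = qb x j) \<longleftrightarrow> x = put_bit q 0 r \<or> x = put_bit q 1 r"
proof -
  have "x = put_bit q b r \<longleftrightarrow> (\<forall>j<N. bit x j = (if j = q then b \<noteq> 0 else bit r j))" for b
    using assms by (simp add: nat_eq_iff_bit_below[OF _ put_bit_less_pow] bit_put_bit)
  then show ?thesis using assms(3) by (auto simp: qb_eq_bit split: if_splits)
qed

lemma G1_apply:
  assumes q: "q < N" and v: "v \<in> carrier_vec (2 ^ N)" and r: "r < 2 ^ N"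
  shows "(gate_mat N (G1 q U) *\<^sub>v v) $ r =
    U $$ (qb r q, 0) * v $ put_bit q 0 r + U $$ (qb r q, 1) * v $ put_bit q 1 r"
proof -
  let ?m = "\<lambda>x. if \<forall>j<N. j \<noteq> q \<longrightarrow> qb r j = qb x j then U $$ (qb r q, qb x q) else 0"
  have b: "bit (put_bit q 0 r) q = False" "bit (put_bit q 1 r) q = True"
    by (simp_all add: bit_put_bit)
  have "(gate_mat N (G1 q U) *\<^sub>v v) $ r = (\<Sum>x<2 ^ N. ?m x * v $ x)"
    unfolding mult_mat_vec_index[OF gate_mat_carrier v r]
    by (intro sum.cong refl, subst G1_index[OF r]) (simp_all only: lessThan_iff)
  also have "\<dots> = ?m (put_bit q 0 r) * v $ put_bit q 0 r + ?m (put_bit q 1 r) * v $ put_bit q 1 r"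
  proof (rule sum_two_points)
    show "put_bit q 0 r \<noteq> put_bit q 1 r" using b by metis
    show "?m x * v $ x = 0" if "x < 2 ^ N" "x \<noteq> put_bit q 0 r" "x \<noteq> put_bit q 1 r" for x
    proof -
      have c: "(\<forall>j<N. j \<noteq> q \<longrightarrow> qb r j = qb x j) = False"
        unfolding eq_off_bit_iff[OF r that(1) q] using that(2,3) by simp
      show ?thesis unfolding c by simp
    qed
  qed (use q r in \<open>auto intro: put_bit_less_pow\<close>)
  also have "\<dots> = U $$ (qb r q, 0) * v $ put_bit q 0 r + U $$ (qb r q, 1) * v $ put_bit q 1 r"
    using b by (simp add: qb_eq_bit bit_put_bit)
  finally show ?thesis .
qed

text \<open>The local index is (control bit) + 2 * (target bit).\<close>
definition ctrl :: "complex mat \<Rightarrow> complex mat" where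
  "ctrl U = mat 4 4 (\<lambda>(x, y). if x mod 2 \<noteq> y mod 2 then 0
     else if x mod 2 = 0 then (if x = y then 1 else 0) else U $$ (x div 2, y div 2))"

lemma ctrl_index:
  assumes "b < 2" "b' < 2" "e < 2" "e' < 2"
  shows "ctrl U $$ (b + 2 * e, b' + 2 * e') =
    (if b \<noteq> b' then 0 else if b = 0 then (if e = e' then 1 else 0) else U $$ (e, e'))"
  using assms by (auto simp: ctrl_def less_2_cases_iff)

lemma unitary_ctrl:
  assumes "unitary_mat 2 U"
  shows "unitary_mat 4 (ctrl U)"
proof -
  have U: "U \<in> carrier_mat 2 2" "U * mat_adjoint U = 1\<^sub>m 2" using assms by (auto simp: unitary_mat_def)
  have C: "ctrl U \<in> carrier_mat 4 4" by (simp add: ctrl_def)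
  have "(U * mat_adjoint U) $$ (i, j) = U $$ (i, 0) * cnj (U $$ (j, 0)) + U $$ (i, 1) * cnj (U $$ (j, 1))"
    if "i < 2" "j < 2" for i j
    using that U(1) by (simp add: mult_2_index mat_adjoint_index[of _ 2] del: index_mult_mat(1))
  then have eq: "U $$ (i, 0) * cnj (U $$ (j, 0)) + U $$ (i, 1) * cnj (U $$ (j, 1)) = (if i = j then 1 else 0)"
    if "i < 2" "j < 2" for i j
    using that U(2) by simp
  have "ctrl U * mat_adjoint (ctrl U) = 1\<^sub>m 4"
  proof (rule eq_matI)
    fix i j assume "i < dim_row (1\<^sub>m 4 :: complex mat)" "j < dim_col (1\<^sub>m 4 :: complex mat)"
    then have ij: "i < 4" "j < 4" by simp_all
    then have ij': "i \<in> {0, 1, 2, 3}" "j \<in> {0, 1, 2, 3}" by auto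
    have "(ctrl U * mat_adjoint (ctrl U)) $$ (i, j) = (\<Sum>k<4. ctrl U $$ (i, k) * cnj (ctrl U $$ (j, k)))"
      using ij C by (simp add: mult_index[of _ 4] mat_adjoint_index[of _ 4] del: index_mult_mat(1))
    also have "\<dots> = 1\<^sub>m 4 $$ (i, j)"
      using ij' eq[of 0 0] eq[of 0 1] eq[of 1 0] eq[of 1 1]
      by (elim insertE emptyE; hypsubst) (simp_all add: sum_lessThan_4 ctrl_def)
    finally show "(ctrl U * mat_adjoint (ctrl U)) $$ (i, j) = 1\<^sub>m 4 $$ (i, j)" .
  qed (use carrier_matD[OF C] carrier_matD[OF mat_adjoint_carrier[OF C]] in simp_all)
  then show ?thesis using C by (simp add: unitary_mat_def)
qed

lemma ctrl_apply:
  assumes q: "p < N" "q < N" "p \<noteq> q" and v: "v \<in> carrier_vec (2 ^ N)" and r: "r < 2 ^ N"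
  shows "(gate_mat N (G2 p q (ctrl U)) *\<^sub>v v) $ r =
    (if bit r p then U $$ (qb r q, 0) * v $ put_bit q 0 r + U $$ (qb r q, 1) * v $ put_bit q 1 r else v $ r)"
proof -
  let ?m = "\<lambda>x. if \<forall>j<N. j \<noteq> p \<and> j \<noteq> q \<longrightarrow> qb r j = qb x j
    then ctrl U $$ (qb r p + 2 * qb r q, qb x p + 2 * qb x q) else 0"
  let ?m' = "\<lambda>x. if \<forall>j<N. j \<noteq> q \<longrightarrow> qb r j = qb x j
    then (if bit r p then U $$ (qb r q, qb x q) else if qb r q = qb x q then 1 else 0) else 0"
  \<comment> \<open>An entry of the controlled gate vanishes unless both indices agree on the
    control bit. Hence its row is supported on the same two columns as that of the one-qubit gate on
    the target.\<close>
  have mm': "?m x = ?m' x" for x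
  proof (cases "qb r p = qb x p")
    case True
    then have "(\<forall>j<N. j \<noteq> p \<and> j \<noteq> q \<longrightarrow> qb r j = qb x j) \<longleftrightarrow> (\<forall>j<N. j \<noteq> q \<longrightarrow> qb r j = qb x j)"
      by auto
    moreover have "ctrl U $$ (qb r p + 2 * qb r q, qb x p + 2 * qb x q) =
        (if bit r p then U $$ (qb r q, qb x q) else if qb r q = qb x q then 1 else 0)"
    proof -
      have "qb r p = 0 \<longleftrightarrow> \<not> bit r p" by (simp add: qb_eq_bit)
      then show ?thesis
        unfolding ctrl_index[OF qb_less_2 qb_less_2 qb_less_2 qb_less_2] using True by simp
    qed
    ultimately show ?thesis by (simp only:)
  next
    case False
    then have "(\<forall>j<N. j \<noteq> q \<longrightarrow> qb r j = qb x j) = False" using q by auto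
    moreover have "ctrl U $$ (qb r p + 2 * qb r q, qb x p + 2 * qb x q) = 0"
      unfolding ctrl_index[OF qb_less_2 qb_less_2 qb_less_2 qb_less_2] using False by simp
    ultimately show ?thesis by (simp only: if_False if_cancel)
  qed
  have b: "bit (put_bit q 0 r) q = False" "bit (put_bit q 1 r) q = True"
    by (simp_all add: bit_put_bit)
  have same: "put_bit q (of_bool (bit r q)) r = r"
    by (rule bit_eqI) (simp add: bit_put_bit)
  have off: "(\<forall>j<N. j \<noteq> q \<longrightarrow> qb r j = qb (put_bit q e r) j) = True" for e
    by (simp add: qb_eq_bit bit_put_bit)
  have at: "qb (put_bit q 0 r) q = 0" "qb (put_bit q 1 r) q = 1"
    by (simp_all add: qb_eq_bit bit_put_bit)
  have "(gate_mat N (G2 p q (ctrl U)) *\<^sub>v v) $ r = (\<Sum>x<2 ^ N. ?m x * v $ x)"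
    unfolding mult_mat_vec_index[OF gate_mat_carrier v r]
    by (intro sum.cong refl, subst G2_index[OF r]) (simp_all only: lessThan_iff)
  also have "\<dots> = (\<Sum>x<2 ^ N. ?m' x * v $ x)"
    by (simp only: mm')
  also have "\<dots> = ?m' (put_bit q 0 r) * v $ put_bit q 0 r + ?m' (put_bit q 1 r) * v $ put_bit q 1 r"
  proof (rule sum_two_points)
    show "put_bit q 0 r \<noteq> put_bit q 1 r" using b by metis
    show "?m' x * v $ x = 0" if "x < 2 ^ N" "x \<noteq> put_bit q 0 r" "x \<noteq> put_bit q 1 r" for x
    proof -
      have c: "(\<forall>j<N. j \<noteq> q \<longrightarrow> qb r j = qb x j) = False"
        unfolding eq_off_bit_iff[OF r that(1) q(2)] using that(2,3) by simp
      show ?thesis unfolding c by simp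
    qed
  qed (use q r in \<open>auto intro: put_bit_less_pow\<close>)
  also have "\<dots> = (if bit r p then U $$ (qb r q, 0) * v $ put_bit q 0 r + U $$ (qb r q, 1) * v $ put_bit q 1 r
      else v $ r)"
    unfolding off if_True at using same by (cases "bit r q") (simp_all add: qb_eq_bit)
  finally show ?thesis .
qed

text \<open>The first tensor factor occupies the low qubits, so bit \<open>l\<close> of the number
  \<open>y\<close> is the value of qubit \<open>n + l\<close>. By linearity it suffices to follow
  circuits on such product states, on which each gate has a short description.\<close>

definition emb :: "nat \<Rightarrow> nat \<Rightarrow> complex vec \<Rightarrow> nat \<Rightarrow> complex vec" where
  "emb n a psi y = kron_vec psi (unit_vec (2 ^ a) y)"

lemma emb_carrier [simp]:
  assumes "psi \<in> carrier_vec (2 ^ n)"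
  shows "emb n a psi y \<in> carrier_vec (2 ^ (n + a))"
  using carrier_vecD[OF assms] by (intro carrier_vecI) (simp add: emb_def kron_vec_def power_add)

lemma emb_dim: "psi \<in> carrier_vec (2 ^ n) \<Longrightarrow> dim_vec (emb n a psi y) = 2 ^ (n + a)"
  by (rule carrier_vecD) (rule emb_carrier)

lemma emb_index:
  assumes "psi \<in> carrier_vec (2 ^ n)" "r < 2 ^ (n + a)" "y < 2 ^ a"
  shows "emb n a psi y $ r = (if drop_bit n r = y then psi $ take_bit n r else 0)"
proof -
  have r: "r < 2 ^ n * 2 ^ a" using assms(2) by (simp add: power_add)
  then have "r div 2 ^ n < 2 ^ a"
    by (simp add: less_mult_imp_div_less mult.commute)
  then have "emb n a psi y $ r = (if r div 2 ^ n = y then psi $ (r mod 2 ^ n) else 0)"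
    using carrier_vecD[OF assms(1)] r assms(3) by (simp add: emb_def kron_vec_def unit_vec_def)
  then show ?thesis
    by (simp only: take_bit_eq_mod drop_bit_eq_div)
qed

lemma emb_eqI:
  assumes "v \<in> carrier_vec (2 ^ (n + a))" "w \<in> carrier_vec (2 ^ (n + a))"
    "\<And>r. r < 2 ^ (n + a) \<Longrightarrow> v $ r = w $ r"
  shows "v = w"
  using assms by (intro eq_vecI) auto

lemma take_put_bit: "take_bit n (put_bit (n + l) b r) = take_bit n r"
  by (rule bit_eqI) (auto simp: bit_take_bit_iff bit_put_bit)

lemma drop_put_bit: "drop_bit n (put_bit (n + l) b r) = put_bit l b (drop_bit n r)"
  by (rule bit_eqI) (auto simp: bit_drop_bit_eq bit_put_bit)

lemma take_put_bit_low: "j < n \<Longrightarrow> take_bit n (put_bit j b r) = put_bit j b (take_bit n r)"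
  by (rule bit_eqI) (auto simp: bit_take_bit_iff bit_put_bit)

lemma drop_put_bit_low: "j < n \<Longrightarrow> drop_bit n (put_bit j b r) = drop_bit n r"
  by (rule bit_eqI) (auto simp: bit_drop_bit_eq bit_put_bit)

lemma qb_anc: "qb r (n + l) = of_bool (bit (drop_bit n r) l)"
  by (simp add: qb_eq_bit bit_drop_bit_eq)

lemma put_bit_eq_iff: "put_bit l b z = y \<longleftrightarrow> (bit y l = (b \<noteq> 0)) \<and> z = put_bit l (of_bool (bit z l)) y"
proof
  assume "put_bit l b z = y"
  then have y: "bit y j \<longleftrightarrow> (if j = l then b \<noteq> 0 else bit z j)" for j
    using bit_put_bit[of l b z j] by simp
  have "z = put_bit l (of_bool (bit z l)) y"
    by (rule bit_eqI) (simp add: bit_put_bit y)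
  then show "(bit y l = (b \<noteq> 0)) \<and> z = put_bit l (of_bool (bit z l)) y"
    using y[of l] by simp
next
  assume h: "(bit y l = (b \<noteq> 0)) \<and> z = put_bit l (of_bool (bit z l)) y"
  have bits: "bit z j \<longleftrightarrow> (if j = l then bit z l else bit y j)" for j
    using arg_cong[OF conjunct2[OF h], of "\<lambda>w. bit w j"] by (simp only: bit_put_bit of_bool_eq_0_iff not_not)
  have yl: "bit y l = (b \<noteq> 0)" using h by (rule conjunct1)
  show "put_bit l b z = y"
  proof (rule bit_eqI)
    fix j
    show "bit (put_bit l b z) j = bit y j"
      using bits[of j] yl by (cases "j = l") (simp_all only: bit_put_bit if_True if_False simp_thms)
  qed
qed

text \<open>The left side reads a gate along row \<open>z\<close>, the right side reads the image of
  basis state \<open>y\<close>. Both are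
  \<open>u (of_bool (bit z l)) (of_bool (bit y l)) * c\<close> if \<open>z\<close> and
  \<open>y\<close> agree off bit \<open>l\<close>, and 0 otherwise.\<close>

lemma anc_gate_aux:
  fixes u :: "nat \<Rightarrow> nat \<Rightarrow> complex"
  shows "u (of_bool (bit z l)) 0 * (if put_bit l 0 z = y then c else 0) +
     u (of_bool (bit z l)) 1 * (if put_bit l 1 z = y then c else 0) =
   u 0 (of_bool (bit y l)) * (if z = put_bit l 0 y then c else 0) +
     u 1 (of_bool (bit y l)) * (if z = put_bit l 1 y then c else 0)"
proof -
  define P0 P1 where "P0 \<longleftrightarrow> z = put_bit l 0 y" and "P1 \<longleftrightarrow> z = put_bit l 1 y"
  have n: "\<not> P1" if "\<not> bit z l" using that by (auto simp: bit_put_bit P1_def)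
  have n': "\<not> P0" if "bit z l" using that by (auto simp: bit_put_bit P0_def)
  have e: "put_bit l b z = y \<longleftrightarrow> (bit y l = (b \<noteq> 0)) \<and> (if bit z l then P1 else P0)" for b
    unfolding put_bit_eq_iff[of l b z y] P0_def P1_def by (cases "bit z l") simp_all
  show ?thesis
    unfolding e P0_def[symmetric] P1_def[symmetric] using n n'
    by (cases "bit z l"; cases "bit y l"; cases P0; cases P1) simp_all
qed

lemma emb_put_anc:
  assumes "l < a" "psi \<in> carrier_vec (2 ^ n)" "r < 2 ^ (n + a)" "y < 2 ^ a"
  shows "emb n a psi y $ put_bit (n + l) b r = (if put_bit l b (drop_bit n r) = y then psi $ take_bit n r else 0)"
proof -
  have "put_bit (n + l) b r < 2 ^ (n + a)"
    using assms(1,3) by (intro put_bit_less_pow) simp_all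
  from emb_index[OF assms(2) this assms(4)] show ?thesis
    by (simp only: take_put_bit drop_put_bit)
qed

lemma emb_comb_index:
  assumes "l < a" "psi \<in> carrier_vec (2 ^ n)" "r < 2 ^ (n + a)" "y < 2 ^ a"
  shows "(c \<cdot>\<^sub>v emb n a psi (put_bit l 0 y) + c' \<cdot>\<^sub>v emb n a psi (put_bit l 1 y)) $ r =
    c * (if drop_bit n r = put_bit l 0 y then psi $ take_bit n r else 0) +
    c' * (if drop_bit n r = put_bit l 1 y then psi $ take_bit n r else 0)"
  unfolding emb_index[OF assms(2,3) put_bit_less_pow[OF assms(1,4)], symmetric]
  using assms by (simp add: emb_dim)

lemma G1_emb:
  assumes l: "l < a" and psi: "psi \<in> carrier_vec (2 ^ n)" and y: "y < 2 ^ a"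
  shows "gate_mat (n + a) (G1 (n + l) U) *\<^sub>v emb n a psi y =
    U $$ (0, qb y l) \<cdot>\<^sub>v emb n a psi (put_bit l 0 y) + U $$ (1, qb y l) \<cdot>\<^sub>v emb n a psi (put_bit l 1 y)"
proof (rule emb_eqI)
  fix r :: nat assume r: "r < 2 ^ (n + a)"
  have nl: "n + l < n + a" using l by simp
  show "(gate_mat (n + a) (G1 (n + l) U) *\<^sub>v emb n a psi y) $ r =
     (U $$ (0, qb y l) \<cdot>\<^sub>v emb n a psi (put_bit l 0 y) + U $$ (1, qb y l) \<cdot>\<^sub>v emb n a psi (put_bit l 1 y)) $ r"
    unfolding G1_apply[OF nl emb_carrier[OF psi] r] emb_put_anc[OF l psi r y] emb_comb_index[OF l psi r y]
      qb_anc qb_eq_bit[of y]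
    by (rule anc_gate_aux)
qed (use mult_mat_vec_carrier[OF gate_mat_carrier emb_carrier[OF psi]] emb_carrier[OF psi] in auto)

lemma ctrl_emb_anc:
  assumes l: "k < a" "l < a" "k \<noteq> l" and psi: "psi \<in> carrier_vec (2 ^ n)" and y: "y < 2 ^ a"
  shows "gate_mat (n + a) (G2 (n + k) (n + l) (ctrl U)) *\<^sub>v emb n a psi y =
    (if bit y k then U $$ (0, qb y l) \<cdot>\<^sub>v emb n a psi (put_bit l 0 y) + U $$ (1, qb y l) \<cdot>\<^sub>v emb n a psi (put_bit l 1 y)
     else emb n a psi y)"
    (is "?L = (if _ then ?R else _)")
proof (rule emb_eqI)
  fix r :: nat assume r: "r < 2 ^ (n + a)"
  let ?z = "drop_bit n r"
  have nl: "n + k < n + a" "n + l < n + a" "n + k \<noteq> n + l" using l by simp_all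
  have b: "bit r (n + k) = bit ?z k" by (simp add: bit_drop_bit_eq)
  note lhs = ctrl_apply[OF nl emb_carrier[OF psi] r, of U y, unfolded emb_put_anc[OF l(2) psi r y] b qb_anc]
  show "?L $ r = (if bit y k then ?R else emb n a psi y) $ r"
  proof (cases "bit ?z k = bit y k")
    case True
    show ?thesis
    proof (cases "bit y k")
      case yk: True
      show ?thesis
        unfolding lhs True if_P[OF yk] emb_comb_index[OF l(2) psi r y] qb_eq_bit[of y]
        by (rule anc_gate_aux)
    qed (simp only: lhs True if_False)
  next
    case False
    then have "put_bit l b ?z \<noteq> y" "?z \<noteq> put_bit l b y" "?z \<noteq> y" for b
      using l(3) bit_put_bit[of l b _ k] by metis+
    then show ?thesis
      unfolding lhs if_distrib[of "\<lambda>v. v $ r"] emb_comb_index[OF l(2) psi r y] emb_index[OF psi r y]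
      by simp
  qed
qed (use mult_mat_vec_carrier[OF gate_mat_carrier emb_carrier[OF psi]] emb_carrier[OF psi] in auto)

lemma ctrl_emb_code:
  assumes l: "l < a" and j: "j < n" and psi: "psi \<in> carrier_vec (2 ^ n)" and y: "y < 2 ^ a"
  shows "gate_mat (n + a) (G2 (n + l) j (ctrl U)) *\<^sub>v emb n a psi y =
    emb n a (if bit y l then gate_mat n (G1 j U) *\<^sub>v psi else psi) y"
proof (rule emb_eqI)
  have psi': "gate_mat n (G1 j U) *\<^sub>v psi \<in> carrier_vec (2 ^ n)"
    using psi by (rule mult_mat_vec_carrier[OF gate_mat_carrier])
  fix r :: nat assume r: "r < 2 ^ (n + a)"
  let ?z = "drop_bit n r" and ?x = "take_bit n r"
  have x: "?x < 2 ^ n" by simp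
  have "(gate_mat (n + a) (G2 (n + l) j (ctrl U)) *\<^sub>v emb n a psi y) $ r =
     (if bit r (n + l) then U $$ (qb r j, 0) * emb n a psi y $ put_bit j 0 r
      + U $$ (qb r j, 1) * emb n a psi y $ put_bit j 1 r else emb n a psi y $ r)"
    by (rule ctrl_apply) (use l psi r j in auto)
  also have "bit r (n + l) = bit ?z l" by (simp add: bit_drop_bit_eq)
  also have "qb r j = qb ?x j" using j by (simp add: qb_eq_bit bit_take_bit_iff)
  also have "(if bit ?z l then U $$ (qb ?x j, 0) * emb n a psi y $ put_bit j 0 r
      + U $$ (qb ?x j, 1) * emb n a psi y $ put_bit j 1 r else emb n a psi y $ r) =
     (if ?z = y then (if bit y l then U $$ (qb ?x j, 0) * psi $ put_bit j 0 ?x + U $$ (qb ?x j, 1) * psi $ put_bit j 1 ?x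
       else psi $ ?x) else 0)"
  proof -
    have "put_bit j b r < 2 ^ (n + a)" for b using r j by (intro put_bit_less_pow) simp_all
    then have p: "emb n a psi y $ put_bit j b r = (if ?z = y then psi $ put_bit j b ?x else 0)" for b
      using emb_index[OF psi _ y] by (simp only: take_put_bit_low[OF j] drop_put_bit_low[OF j])
    show ?thesis
      unfolding p emb_index[OF psi r y] by simp
  qed
  also have "U $$ (qb ?x j, 0) * psi $ put_bit j 0 ?x + U $$ (qb ?x j, 1) * psi $ put_bit j 1 ?x =
      (gate_mat n (G1 j U) *\<^sub>v psi) $ ?x"
    by (rule G1_apply[symmetric]) (use j psi x in auto)
  finally show "(gate_mat (n + a) (G2 (n + l) j (ctrl U)) *\<^sub>v emb n a psi y) $ r =
      emb n a (if bit y l then gate_mat n (G1 j U) *\<^sub>v psi else psi) y $ r"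
    unfolding if_distrib[of "\<lambda>psi. emb n a psi y $ r"] emb_index[OF psi' r y] emb_index[OF psi r y]
    by simp
qed (use mult_mat_vec_carrier[OF gate_mat_carrier emb_carrier[OF psi]] emb_carrier[OF psi]
    emb_carrier[OF mult_mat_vec_carrier[OF gate_mat_carrier psi]] in auto)

section \<open>Circuits measuring a product of commuting Pauli projectors\<close>

lemma circuit_mat_carrier [simp]: "circuit_mat N gs \<in> carrier_mat (2 ^ N) (2 ^ N)"
  by (induction gs) (auto intro!: mult_carrier_mat[of _ _ "2 ^ N"])

definition run :: "nat \<Rightarrow> gate list \<Rightarrow> complex vec \<Rightarrow> complex vec" where
  "run N gs v = circuit_mat N gs *\<^sub>v v"

lemma run_carrier: "v \<in> carrier_vec (2 ^ N) \<Longrightarrow> run N gs v \<in> carrier_vec (2 ^ N)"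
  unfolding run_def by (rule mult_mat_vec_carrier[OF circuit_mat_carrier])

lemma run_Nil: "v \<in> carrier_vec (2 ^ N) \<Longrightarrow> run N [] v = v"
  by (simp add: run_def)

lemma run_Cons:
  assumes "v \<in> carrier_vec (2 ^ N)"
  shows "run N (G # gs) v = run N gs (gate_mat N G *\<^sub>v v)"
  unfolding run_def circuit_mat.simps by (rule mult_mult_vec[OF circuit_mat_carrier gate_mat_carrier assms])

lemma run_append:
  assumes "v \<in> carrier_vec (2 ^ N)"
  shows "run N (gs @ hs) v = run N hs (run N gs v)"
  using assms
proof (induction gs arbitrary: v)
  case (Cons G gs)
  then show ?case
    using mult_mat_vec_carrier[OF gate_mat_carrier[of N G] Cons.prems] by (simp add: run_Cons)
qed (simp add: run_Nil)

lemma run_add: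
  "v \<in> carrier_vec (2 ^ N) \<Longrightarrow> w \<in> carrier_vec (2 ^ N) \<Longrightarrow> run N gs (v + w) = run N gs v + run N gs w"
  unfolding run_def by (rule mult_add_distrib_mat_vec[OF circuit_mat_carrier])

lemma run_smult: "v \<in> carrier_vec (2 ^ N) \<Longrightarrow> run N gs (c \<cdot>\<^sub>v v) = c \<cdot>\<^sub>v run N gs v"
  unfolding run_def by (rule mult_mat_vec[OF circuit_mat_carrier])

lemma emb_add:
  assumes "v \<in> carrier_vec (2 ^ n)" "w \<in> carrier_vec (2 ^ n)" "y < 2 ^ a"
  shows "emb n a (v + w) y = emb n a v y + emb n a w y"
proof (rule emb_eqI)
  fix r :: nat assume r: "r < 2 ^ (n + a)"
  have "take_bit n r < 2 ^ n" by simp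
  moreover have "v + w \<in> carrier_vec (2 ^ n)" using assms by simp
  ultimately show "emb n a (v + w) y $ r = (emb n a v y + emb n a w y) $ r"
    using assms r carrier_vecD[OF assms(2)] by (simp add: emb_index emb_dim)
qed (use assms emb_carrier[of "v + w" n a y] in auto)

lemma emb_smult:
  assumes "v \<in> carrier_vec (2 ^ n)" "y < 2 ^ a"
  shows "emb n a (c \<cdot>\<^sub>v v) y = c \<cdot>\<^sub>v emb n a v y"
proof (rule emb_eqI)
  fix r :: nat assume r: "r < 2 ^ (n + a)"
  have "take_bit n r < 2 ^ n" by simp
  moreover have "c \<cdot>\<^sub>v v \<in> carrier_vec (2 ^ n)" using assms by simp
  ultimately show "emb n a (c \<cdot>\<^sub>v v) y $ r = (c \<cdot>\<^sub>v emb n a v y) $ r"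
    using assms r carrier_vecD[OF assms(1)] by (simp add: emb_index emb_dim)
qed (use assms emb_carrier[of "c \<cdot>\<^sub>v v" n a y] in auto)

lemma put_bit_same: "bit y l = (b \<noteq> 0) \<Longrightarrow> put_bit l b y = y"
  by (rule bit_eqI) (simp add: bit_put_bit)

lemma put_bit_put_bit: "put_bit l b (put_bit l b' y) = put_bit l b y"
  by (rule bit_eqI) (simp add: bit_put_bit)

text \<open>This brings single gates into the tensor calculus, where gates on different qubits
  multiply up to a Pauli string.\<close>

lemma G1_as_tens:
  assumes "j < n" "U \<in> carrier_mat 2 2"
  shows "gate_mat n (G1 j U) = tens n (\<lambda>i. if i = j then U else 1\<^sub>m 2)"
proof (rule eq_matI)
  fix r s assume "r < dim_row (tens n (\<lambda>i. if i = j then U else 1\<^sub>m 2))"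
    "s < dim_col (tens n (\<lambda>i. if i = j then U else 1\<^sub>m 2))"
  then have rs: "r < 2 ^ n" "s < 2 ^ n" by (simp_all add: tens_def)
  have "(\<Prod>i<n. (if i = j then U else 1\<^sub>m 2) $$ (qb r i, qb s i)) =
      U $$ (qb r j, qb s j) * (\<Prod>i\<in>{..<n} - {j}. (if i = j then U else 1\<^sub>m 2) $$ (qb r i, qb s i))"
    using assms(1) by (simp add: prod.remove[of "{..<n}" j])
  also have "(\<Prod>i\<in>{..<n} - {j}. (if i = j then U else 1\<^sub>m 2) $$ (qb r i, qb s i)) =
      (\<Prod>i\<in>{..<n} - {j}. if qb r i = qb s i then 1 else 0)"
    by (rule prod.cong) auto
  also have "\<dots> = (if \<forall>i<n. i \<noteq> j \<longrightarrow> qb r i = qb s i then 1 else 0)"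
    by auto
  finally show "gate_mat n (G1 j U) $$ (r, s) = tens n (\<lambda>i. if i = j then U else 1\<^sub>m 2) $$ (r, s)"
    unfolding G1_index[OF rs] tens_index[OF rs]
    by (simp only: if_distrib[of "\<lambda>x. _ * x"] mult_1_right mult_zero_right)
qed (use carrier_matD[OF gate_mat_carrier[of n "G1 j U"]] in \<open>simp_all add: tens_def\<close>)

lemma one_smult_vec: "1 \<cdot>\<^sub>v v = (v :: complex vec)"
  by (rule eq_vecI) auto

text \<open>A Hermitian Pauli operator is given by sign and labels instead of a matrix because the
  circuit is read off from them. \<open>e\<close> means a positive sign.\<close>

fun signed_pauli :: "nat \<Rightarrow> bool \<times> (nat \<Rightarrow> nat) \<Rightarrow> complex mat" where
  "signed_pauli n (e, f) = (if e then 1 else - 1) \<cdot>\<^sub>m pauli_str n f"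

lemma signed_pauli_carrier [simp]: "signed_pauli n p \<in> carrier_mat (2 ^ n) (2 ^ n)"
  by (cases p) simp

lemma signed_pauli_square: "signed_pauli n p * signed_pauli n p = 1\<^sub>m (2 ^ n)"
  by (cases p) (simp add: smult_mult_smult[of _ "2 ^ n"] pauli_str_square one_smult_mat)

declare signed_pauli.simps [simp del]

text \<open>The bound \<open>m\<close> on the treated qubits is there for the induction; circuits
  use \<open>m = n\<close>.\<close>

definition ctrl_pauli_str :: "nat \<Rightarrow> nat \<Rightarrow> (nat \<Rightarrow> nat) \<Rightarrow> nat \<Rightarrow> gate list" where
  "ctrl_pauli_str n l f m = map (\<lambda>j. G2 (n + l) j (ctrl (pauli1 (f j)))) [0..<m]"

lemma run_ctrl_pauli_str:
  assumes "m \<le> n" "l < a" "y < 2 ^ a" "psi \<in> carrier_vec (2 ^ n)"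
  shows "run (n + a) (ctrl_pauli_str n l f m) (emb n a psi y) =
    emb n a (if bit y l then tens n (\<lambda>j. if j < m then pauli1 (f j) else 1\<^sub>m 2) *\<^sub>v psi else psi) y"
  using assms(1)
proof (induction m)
  case 0
  have "tens n (\<lambda>j. if j < 0 then pauli1 (f j) else 1\<^sub>m 2) = 1\<^sub>m (2 ^ n)"
    by (simp add: tens_one)
  then show ?case
    using assms by (simp add: ctrl_pauli_str_def run_Nil del: not_less_zero)
next
  case (Suc m)
  let ?T = "\<lambda>m. tens n (\<lambda>j. if j < m then pauli1 (f j) else 1\<^sub>m 2)"
  have c: "?T m *\<^sub>v psi \<in> carrier_vec (2 ^ n)"
    by (rule mult_mat_vec_carrier[OF tens_carrier assms(4)])
  have "gate_mat n (G1 m (pauli1 (f m))) * ?T m = ?T (Suc m)"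
    using Suc.prems unfolding G1_as_tens[OF Suc_le_lessD[OF Suc.prems] pauli1_carrier]
    by (subst tens_mult) (auto intro!: tens_cong simp: less_Suc_eq left_mult_one_mat[of _ 2 2] right_mult_one_mat[of _ 2 2])
  then have T: "gate_mat n (G1 m (pauli1 (f m))) *\<^sub>v (?T m *\<^sub>v psi) = ?T (Suc m) *\<^sub>v psi"
    using mult_mult_vec[OF gate_mat_carrier tens_carrier assms(4), of "G1 m (pauli1 (f m))"] by metis
  have "run (n + a) (ctrl_pauli_str n l f (Suc m)) (emb n a psi y) =
    gate_mat (n + a) (G2 (n + l) m (ctrl (pauli1 (f m)))) *\<^sub>v
      emb n a (if bit y l then ?T m *\<^sub>v psi else psi) y"
    using Suc assms c emb_carrier[of psi n a y]
    by (simp add: ctrl_pauli_str_def run_append run_Cons run_Nil mult_mat_vec_carrier[OF gate_mat_carrier])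
  also have "\<dots> = emb n a (if bit y l then ?T (Suc m) *\<^sub>v psi else psi) y"
    using Suc.prems assms c by (cases "bit y l") (simp_all add: ctrl_emb_code T)
  finally show ?case .
qed

text \<open>This is the controlled version of the negated operator. For a positive sign the extra
  minus is a phase that depends on the control alone, so a one-qubit Z gate on the ancilla provides
  it without entering the gate count; for a negative sign the two minus signs cancel.\<close>

definition ctrl_neg :: "nat \<Rightarrow> nat \<Rightarrow> bool \<times> (nat \<Rightarrow> nat) \<Rightarrow> gate list" where
  "ctrl_neg n l p = ctrl_pauli_str n l (snd p) n @ (if fst p then [G1 (n + l) (pauli1 3)] else [])"

lemma run_ctrl_neg:
  assumes "l < a" "y < 2 ^ a" "psi \<in> carrier_vec (2 ^ n)"
  shows "run (n + a) (ctrl_neg n l p) (emb n a psi y) =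
    (if bit y l then - 1 \<cdot>\<^sub>v emb n a (signed_pauli n p *\<^sub>v psi) y else emb n a psi y)"
proof -
  obtain e f where p: "p = (e, f)" by (cases p)
  define phi where "phi = (if bit y l then pauli_str n f *\<^sub>v psi else psi)"
  have phi: "phi \<in> carrier_vec (2 ^ n)"
    using assms(3) mult_mat_vec_carrier[OF pauli_str_carrier assms(3)] by (simp add: phi_def)
  have "tens n (\<lambda>j. if j < n then pauli1 (f j) else 1\<^sub>m 2) = pauli_str n f"
    unfolding pauli_str_def by (rule tens_cong) simp
  then have 1: "run (n + a) (ctrl_pauli_str n l f n) (emb n a psi y) = emb n a phi y"
    using run_ctrl_pauli_str[OF order_refl assms] by (simp add: phi_def)
  have Z: "gate_mat (n + a) (G1 (n + l) (pauli1 3)) *\<^sub>v emb n a phi y =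
      (if bit y l then - 1 else 1) \<cdot>\<^sub>v emb n a phi y"
    unfolding G1_emb[OF assms(1) phi assms(2)]
    using emb_dim[OF phi]
    by (intro eq_vecI; cases "bit y l") (simp_all add: qb_eq_bit pauli1_index put_bit_same)
  have S: "signed_pauli n p *\<^sub>v psi = (if e then 1 else - 1) \<cdot>\<^sub>v (pauli_str n f *\<^sub>v psi)"
    by (simp add: p signed_pauli.simps smult_mat_vec[OF pauli_str_carrier assms(3)])
  have run: "run (n + a) (ctrl_neg n l p) (emb n a psi y) = (if e \<and> bit y l then - 1 else 1) \<cdot>\<^sub>v emb n a phi y"
    using emb_carrier[OF assms(3), of a y] emb_carrier[OF phi, of a y]
      mult_mat_vec_carrier[OF gate_mat_carrier emb_carrier[OF phi]]
    by (cases e) (simp_all add: ctrl_neg_def p run_append run_Cons run_Nil 1 Z one_smult_vec)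
  show ?thesis
  proof (cases "bit y l")
    case True
    then have "pauli_str n f *\<^sub>v psi = phi" by (simp add: phi_def)
    then have "emb n a (signed_pauli n p *\<^sub>v psi) y = (if e then 1 else - 1) \<cdot>\<^sub>v emb n a phi y"
      unfolding S by (simp only: emb_smult[OF phi assms(2)])
    then show ?thesis
      using True by (cases e) (simp_all add: run smult_smult_assoc one_smult_vec)
  next
    case False
    then have "phi = psi" by (simp add: phi_def)
    then show ?thesis using False by (simp add: run one_smult_vec)
  qed
qed

section \<open>Conditional flips along the ancilla chain\<close>

definition had :: "complex mat" where
  "had = mat_of_rows_list 2 [[1 / sqrt 2, 1 / sqrt 2], [1 / sqrt 2, - 1 / sqrt 2]]"

lemma had_index:
  "had $$ (0, 0) = 1 / sqrt 2" "had $$ (0, Suc 0) = 1 / sqrt 2"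
  "had $$ (Suc 0, 0) = 1 / sqrt 2" "had $$ (Suc 0, Suc 0) = - 1 / sqrt 2"
  by (simp_all add: had_def mat_of_rows_list_def)

lemma had_carrier [simp]: "had \<in> carrier_mat 2 2"
  by (rule carrier_matI) (simp_all add: had_def mat_of_rows_list_def)

lemma sqrt2_square: "complex_of_real (sqrt 2) * complex_of_real (sqrt 2) = 2"
  by (simp flip: of_real_mult)

lemma unitary_had: "unitary_mat 2 had"
proof -
  have "mat_adjoint had = had"
    by (rule mat_adjoint_eqI[of _ 2]) (auto simp: less_2_cases_iff had_index)
  moreover have "had * had = 1\<^sub>m 2"
    by (rule eq_mat2I) (auto simp: mult_2_index had_index sqrt2_square simp del: index_mult_mat(1)
      intro: mult_carrier_mat[of _ 2 2])
  ultimately show ?thesis by (simp add: unitary_mat_def)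
qed

lemma unitary_pauli1: "unitary_mat 2 (pauli1 p)"
  by (simp add: unitary_mat_def pauli1_adjoint pauli1_square)

text \<open>Controlled on ancilla \<open>l\<close>, ancilla \<open>l + 1\<close> is flipped on the \<open>+1\<close> eigenspace of the Pauli operator.
Since ancilla \<open>l + 1\<close> starts in a known state, the two Hadamard gates alone have to be controlled by \<open>l\<close>.\<close>
definition cond_flip :: "nat \<Rightarrow> nat \<Rightarrow> bool \<times> (nat \<Rightarrow> nat) \<Rightarrow> gate list" where
  "cond_flip n l p = G2 (n + l) (n + Suc l) (ctrl had) # ctrl_neg n (Suc l) p @ [G2 (n + l) (n + Suc l) (ctrl had)]"

lemma run_cond_flip_off:
  assumes "Suc l < a" "y < 2 ^ a" "psi \<in> carrier_vec (2 ^ n)" "\<not> bit y l" "\<not> bit y (Suc l)"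
  shows "run (n + a) (cond_flip n l p) (emb n a psi y) = emb n a psi y"
proof -
  have CH: "gate_mat (n + a) (G2 (n + l) (n + Suc l) (ctrl had)) *\<^sub>v emb n a psi y = emb n a psi y"
    using ctrl_emb_anc[of l a "Suc l" psi n y had] assms by simp
  show ?thesis
    using CH run_ctrl_neg[OF assms(1-3), of p] assms emb_carrier[OF assms(3), of a y]
    by (simp add: cond_flip_def run_append run_Cons run_Nil)
qed

text \<open>Hadamard gates around a controlled \<open>-M\<close> leave the flag alone with amplitude
  \<open>(1 - M) / 2\<close> and flip it with amplitude \<open>(1 + M) / 2\<close>, the two spectral
  projectors. The negation in \<open>ctrl_neg\<close> is what attaches the flip to eigenvalue
  1.\<close>

lemma run_cond_flip_on:
  fixes psi :: "complex vec" and p :: "bool \<times> (nat \<Rightarrow> nat)"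
  assumes l: "Suc l < a" and y: "y < 2 ^ a" and psi: "psi \<in> carrier_vec (2 ^ n)"
    and b: "bit y l" "\<not> bit y (Suc l)"
  defines "y' \<equiv> put_bit (Suc l) 1 y" and "phi \<equiv> signed_pauli n p *\<^sub>v psi"
  shows "run (n + a) (cond_flip n l p) (emb n a psi y) =
      emb n a ((1 / 2) \<cdot>\<^sub>v (psi - phi)) y + emb n a ((1 / 2) \<cdot>\<^sub>v (psi + phi)) y'"
    and "run (n + a) (cond_flip n l p) (emb n a psi y') =
      emb n a ((1 / 2) \<cdot>\<^sub>v (psi + phi)) y + emb n a ((1 / 2) \<cdot>\<^sub>v (psi - phi)) y'"
proof -
  let ?N = "n + a" and ?h = "1 / complex_of_real (sqrt 2)"
  let ?H = "G2 (n + l) (n + Suc l) (ctrl had)"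
  have phi: "phi \<in> carrier_vec (2 ^ n)"
    unfolding phi_def by (rule mult_mat_vec_carrier[OF signed_pauli_carrier psi])
  have y': "y' < 2 ^ a" unfolding y'_def using l y by (rule put_bit_less_pow)
  have b': "bit y' l" "bit y' (Suc l)" using b by (simp_all add: y'_def bit_put_bit)
  have p: "put_bit (Suc l) 0 y = y" "put_bit (Suc l) 1 y = y'"
    "put_bit (Suc l) 0 y' = y" "put_bit (Suc l) 1 y' = y'"
    using b by (simp_all add: y'_def put_bit_put_bit put_bit_same)
  have q: "qb y (Suc l) = 0" "qb y' (Suc l) = 1" using b b' by (simp_all add: qb_eq_bit)
  have H: "run ?N [?H] (emb n a v y) = ?h \<cdot>\<^sub>v emb n a v y + ?h \<cdot>\<^sub>v emb n a v y'"
    "run ?N [?H] (emb n a v y') = ?h \<cdot>\<^sub>v emb n a v y + (- ?h) \<cdot>\<^sub>v emb n a v y'"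
    if v: "v \<in> carrier_vec (2 ^ n)" for v
  proof -
    note e = emb_carrier[OF v, of a] mult_mat_vec_carrier[OF gate_mat_carrier emb_carrier[OF v]]
    show "run ?N [?H] (emb n a v y) = ?h \<cdot>\<^sub>v emb n a v y + ?h \<cdot>\<^sub>v emb n a v y'"
      unfolding run_Cons[OF e(1)] run_Nil[OF e(2)]
      using ctrl_emb_anc[OF Suc_lessD[OF l] l _ v y, of had] b unfolding p q by (simp add: had_index)
    show "run ?N [?H] (emb n a v y') = ?h \<cdot>\<^sub>v emb n a v y + (- ?h) \<cdot>\<^sub>v emb n a v y'"
      unfolding run_Cons[OF e(1)] run_Nil[OF e(2)]
      using ctrl_emb_anc[OF Suc_lessD[OF l] l _ v y', of had] b' unfolding p q by (simp add: had_index)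
  qed
  have C: "run ?N (ctrl_neg n (Suc l) p) (emb n a psi y) = emb n a psi y"
    "run ?N (ctrl_neg n (Suc l) p) (emb n a psi y') = - 1 \<cdot>\<^sub>v emb n a phi y'"
    using run_ctrl_neg[OF l y psi, of p] run_ctrl_neg[OF l y' psi, of p] b b' by (simp_all add: phi_def)
  have split: "run ?N (cond_flip n l p) v = run ?N [?H] (run ?N (ctrl_neg n (Suc l) p) (run ?N [?H] v))"
    if "v \<in> carrier_vec (2 ^ ?N)" for v
  proof -
    have "cond_flip n l p = [?H] @ ctrl_neg n (Suc l) p @ [?H]" by (simp add: cond_flip_def)
    then show ?thesis using that by (simp only: run_append run_carrier)
  qed
  \<comment> \<open>With these four states as atoms, linearity of \<open>run\<close> leaves only the
    arithmetic of \<open>?h * ?h = 1 / 2\<close>.\<close>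
  define A B C D where "A = emb n a psi y" and "B = emb n a psi y'" and "C = emb n a phi y" and "D = emb n a phi y'"
  have cc: "A \<in> carrier_vec (2 ^ ?N)" "B \<in> carrier_vec (2 ^ ?N)" "C \<in> carrier_vec (2 ^ ?N)" "D \<in> carrier_vec (2 ^ ?N)"
    unfolding A_def B_def C_def D_def by (rule emb_carrier, rule psi phi)+
  note HA = H(1)[OF psi, folded A_def B_def] H(2)[OF psi, folded A_def B_def] H(2)[OF phi, folded C_def D_def]
  note CA = C[folded A_def B_def D_def]
  have e: "emb n a ((1 / 2) \<cdot>\<^sub>v (psi + phi)) z = (1 / 2) \<cdot>\<^sub>v (emb n a psi z + emb n a phi z)"
    "emb n a ((1 / 2) \<cdot>\<^sub>v (psi - phi)) z = (1 / 2) \<cdot>\<^sub>v (emb n a psi z + - 1 \<cdot>\<^sub>v emb n a phi z)"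
    if z: "z < 2 ^ a" for z
  proof -
    have "psi - phi = psi + - 1 \<cdot>\<^sub>v phi" using psi phi by (intro eq_vecI) auto
    moreover have "psi + phi \<in> carrier_vec (2 ^ n)" "psi + - 1 \<cdot>\<^sub>v phi \<in> carrier_vec (2 ^ n)"
      "- 1 \<cdot>\<^sub>v phi \<in> carrier_vec (2 ^ n)" using psi phi by auto
    ultimately show "emb n a ((1 / 2) \<cdot>\<^sub>v (psi + phi)) z = (1 / 2) \<cdot>\<^sub>v (emb n a psi z + emb n a phi z)"
      "emb n a ((1 / 2) \<cdot>\<^sub>v (psi - phi)) z = (1 / 2) \<cdot>\<^sub>v (emb n a psi z + - 1 \<cdot>\<^sub>v emb n a phi z)"
      using psi phi z by (simp_all only: emb_smult emb_add)
  qed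
  have dim [simp]: "dim_vec A = 2 ^ ?N" "dim_vec B = 2 ^ ?N" "dim_vec C = 2 ^ ?N" "dim_vec D = 2 ^ ?N"
    using cc by simp_all
  have R: "run ?N gs (x \<cdot>\<^sub>v A + x' \<cdot>\<^sub>v B) = x \<cdot>\<^sub>v run ?N gs A + x' \<cdot>\<^sub>v run ?N gs B"
    "run ?N gs (x \<cdot>\<^sub>v A + x' \<cdot>\<^sub>v D) = x \<cdot>\<^sub>v run ?N gs A + x' \<cdot>\<^sub>v run ?N gs D" for gs x x'
    using cc by (simp_all add: run_add run_smult)
  have "run ?N (cond_flip n l p) A = ?h \<cdot>\<^sub>v (?h \<cdot>\<^sub>v A + ?h \<cdot>\<^sub>v B) + (?h * - 1) \<cdot>\<^sub>v (?h \<cdot>\<^sub>v C + (- ?h) \<cdot>\<^sub>v D)"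
    unfolding split[OF cc(1)] HA R CA smult_smult_assoc by (simp only: HA)
  also have "\<dots> = (1 / 2) \<cdot>\<^sub>v (A + - 1 \<cdot>\<^sub>v C) + (1 / 2) \<cdot>\<^sub>v (B + D)"
    by (intro eq_vecI) (simp_all only: dim index_add_vec index_smult_vec, simp_all add: sqrt2_square algebra_simps)
  finally show "run (n + a) (cond_flip n l p) (emb n a psi y) =
      emb n a ((1 / 2) \<cdot>\<^sub>v (psi - phi)) y + emb n a ((1 / 2) \<cdot>\<^sub>v (psi + phi)) y'"
    unfolding e[OF y] e[OF y'] by (simp only: A_def B_def C_def D_def)
  have "run ?N (cond_flip n l p) B = ?h \<cdot>\<^sub>v (?h \<cdot>\<^sub>v A + ?h \<cdot>\<^sub>v B) + (- ?h * - 1) \<cdot>\<^sub>v (?h \<cdot>\<^sub>v C + (- ?h) \<cdot>\<^sub>v D)"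
    unfolding split[OF cc(2)] HA R CA smult_smult_assoc by (simp only: HA)
  also have "\<dots> = (1 / 2) \<cdot>\<^sub>v (A + C) + (1 / 2) \<cdot>\<^sub>v (B + - 1 \<cdot>\<^sub>v D)"
    by (intro eq_vecI) (simp_all only: dim index_add_vec index_smult_vec, simp_all add: sqrt2_square algebra_simps)
  finally show "run (n + a) (cond_flip n l p) (emb n a psi y') =
      emb n a ((1 / 2) \<cdot>\<^sub>v (psi + phi)) y + emb n a ((1 / 2) \<cdot>\<^sub>v (psi - phi)) y'"
    unfolding e[OF y] e[OF y'] by (simp only: A_def B_def C_def D_def)
qed

text \<open>The nesting undoes the links in reverse order. The same gates serve for computing and
  for erasing a flag, because a link undoes itself on eigenvectors. In the base case ancilla
  \<open>l\<close> carries the whole conjunction, and qubit \<open>n\<close> is the outcome.\<close>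

fun block :: "nat \<Rightarrow> nat \<Rightarrow> (bool \<times> (nat \<Rightarrow> nat)) list \<Rightarrow> gate list" where
  "block n l [] = [G2 (n + l) n (ctrl (pauli1 1))]"
| "block n l (p # ps) = cond_flip n l p @ block n (Suc l) ps @ cond_flip n l p"

definition flip0 :: "nat \<Rightarrow> nat" where
  "flip0 y = put_bit 0 (1 - qb y 0) y"

lemma bit_flip0: "bit (flip0 y) j \<longleftrightarrow> (if j = 0 then \<not> bit y 0 else bit y j)"
  by (auto simp: flip0_def bit_put_bit qb_eq_bit)

lemma flip0_less_pow: "0 < a \<Longrightarrow> y < 2 ^ a \<Longrightarrow> flip0 y < 2 ^ a"
  unfolding flip0_def by (rule put_bit_less_pow)

lemma flip0_put_bit: "l \<noteq> 0 \<Longrightarrow> flip0 (put_bit l b y) = put_bit l b (flip0 y)"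
  by (rule bit_eqI) (auto simp: bit_put_bit bit_flip0)

lemma commute_gen_proj:
  assumes "M \<in> carrier_mat d d" "set Ms \<subseteq> carrier_mat d d" "\<And>A. A \<in> set Ms \<Longrightarrow> M * A = A * M"
  shows "M * gen_proj d Ms = gen_proj d Ms * M"
  using assms(2,3)
proof (induction Ms)
  case (Cons A Ms)
  have A: "A \<in> carrier_mat d d" "1\<^sub>m d + A \<in> carrier_mat d d" using Cons.prems(1) by auto
  have h: "(1 / 2) \<cdot>\<^sub>m (1\<^sub>m d + A) \<in> carrier_mat d d" using A by simp
  have g: "gen_proj d Ms \<in> carrier_mat d d" using Cons.prems(1) by (intro gen_proj_carrier) simp
  have "M * ((1 / 2) \<cdot>\<^sub>m (1\<^sub>m d + A)) = ((1 / 2) \<cdot>\<^sub>m (1\<^sub>m d + A)) * M"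
    using assms(1) A Cons.prems(2)[of A]
    by (simp add: mult_smult_distrib[of _ d d _ d] mult_smult_assoc_mat[of _ d d _ d]
        mult_add_distrib_mat[of _ d d _ d] add_mult_distrib_mat[of _ d d _ _ d])
  moreover have "M * gen_proj d Ms = gen_proj d Ms * M"
    using Cons by auto
  ultimately show ?case
    using mult_assoc_sq[OF assms(1) g h] mult_assoc_sq[OF g assms(1) h] mult_assoc_sq[OF g h assms(1)] by simp
qed (use assms(1) in simp)

lemma block_gates_ok:
  assumes "l + length ps < a" "l \<noteq> 0" "G \<in> set (block n l ps)"
  shows "gate_ok (n + a) G"
  using assms
proof (induction ps arbitrary: l)
  case (Cons p ps)
  have "gate_ok (n + a) G" if "G \<in> set (cond_flip n l p)"
    using that Cons.prems(1)
    by (auto simp: cond_flip_def ctrl_neg_def ctrl_pauli_str_def unitary_ctrl unitary_had unitary_pauli1 split: if_splits)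
  moreover have "gate_ok (n + a) G" if "G \<in> set (block n (Suc l) ps)"
    using Cons.IH[of "Suc l"] Cons.prems that by simp
  ultimately show ?case using Cons.prems(3) by auto
qed (simp add: unitary_ctrl unitary_pauli1)

lemma two_qubit_count_append: "two_qubit_count (gs @ hs) = two_qubit_count gs + two_qubit_count hs"
  by (simp add: two_qubit_count_def)

lemma two_qubit_count_cond_flip: "two_qubit_count (cond_flip n l p) = n + 2"
proof -
  have "filter is_two_qubit (ctrl_pauli_str n k f m) = ctrl_pauli_str n k f m" for k f m
    by (simp add: ctrl_pauli_str_def filter_map comp_def)
  then show ?thesis
    by (simp add: two_qubit_count_def cond_flip_def ctrl_neg_def ctrl_pauli_str_def)
qed

lemma two_qubit_count_block: "two_qubit_count (block n l ps) = 2 * length ps * (n + 2) + 1"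
  by (induction ps arbitrary: l)
    (simp_all add: two_qubit_count_append two_qubit_count_cond_flip, simp add: two_qubit_count_def)

definition list_proj :: "nat \<Rightarrow> (bool \<times> (nat \<Rightarrow> nat)) list \<Rightarrow> complex mat" where
  "list_proj n ps = gen_proj (2 ^ n) (map (signed_pauli n) ps)"

lemma list_proj_carrier [simp]: "list_proj n ps \<in> carrier_mat (2 ^ n) (2 ^ n)"
  unfolding list_proj_def by (rule gen_proj_carrier) auto

definition pairwise_commuting :: "nat \<Rightarrow> (bool \<times> (nat \<Rightarrow> nat)) list \<Rightarrow> bool" where
  "pairwise_commuting n ps \<longleftrightarrow>
    (\<forall>p\<in>set ps. \<forall>q\<in>set ps. signed_pauli n p * signed_pauli n q = signed_pauli n q * signed_pauli n p)"

text \<open>These are the two situations met when a link is undone: the part with eigenvalue 1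
  arrives with the flag set and has it cleared, the part with eigenvalue -1 never had it
  set.\<close>

lemma run_cond_flip_eigen:
  assumes l: "Suc l < a" and y: "y < 2 ^ a" and psi: "psi \<in> carrier_vec (2 ^ n)"
    and b: "bit y l" "\<not> bit y (Suc l)"
  shows "signed_pauli n p *\<^sub>v psi = psi \<Longrightarrow>
      run (n + a) (cond_flip n l p) (emb n a psi (put_bit (Suc l) 1 y)) = emb n a psi y"
    and "signed_pauli n p *\<^sub>v psi = - 1 \<cdot>\<^sub>v psi \<Longrightarrow>
      run (n + a) (cond_flip n l p) (emb n a psi y) = emb n a psi y"
proof -
  let ?y' = "put_bit (Suc l) 1 y"
  have y': "?y' < 2 ^ a" using l y by (rule put_bit_less_pow)
  have 1: "(1 / 2) \<cdot>\<^sub>v (psi + psi) = psi" "(1 / 2) \<cdot>\<^sub>v (psi - - 1 \<cdot>\<^sub>v psi) = psi"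
    by (rule eq_vecI; simp)+
  \<comment> \<open>Zero vectors are written as multiples of \<open>psi\<close> so that
    \<open>emb_smult\<close> can move the scalar out of \<open>emb\<close>.\<close>
  have 2: "(1 / 2) \<cdot>\<^sub>v (psi - psi) = 0 \<cdot>\<^sub>v psi" "(1 / 2) \<cdot>\<^sub>v (psi + - 1 \<cdot>\<^sub>v psi) = 0 \<cdot>\<^sub>v psi"
    by (rule eq_vecI; simp)+
  have 3: "emb n a psi y + 0 \<cdot>\<^sub>v emb n a psi ?y' = emb n a psi y"
    using emb_dim[OF psi] by (intro eq_vecI) simp_all
  show "run (n + a) (cond_flip n l p) (emb n a psi ?y') = emb n a psi y"
    if "signed_pauli n p *\<^sub>v psi = psi"
    unfolding run_cond_flip_on(2)[OF l y psi b] that 1 2 emb_smult[OF psi y'] by (rule 3)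
  show "run (n + a) (cond_flip n l p) (emb n a psi y) = emb n a psi y"
    if "signed_pauli n p *\<^sub>v psi = - 1 \<cdot>\<^sub>v psi"
    unfolding run_cond_flip_on(1)[OF l y psi b] that 1 2 emb_smult[OF psi y'] by (rule 3)
qed

text \<open>The bits above \<open>l\<close> are the flags still to be used and have to be clean. The
  case of an unset bit \<open>l\<close> belongs to the statement because the inner block also meets
  the component with eigenvalue -1, whose flag is off.\<close>

lemma run_block:
  assumes "l \<noteq> 0" "l + length ps < a" "y < 2 ^ a" "\<And>j. l < j \<Longrightarrow> \<not> bit y j"
    "psi \<in> carrier_vec (2 ^ n)" "pairwise_commuting n ps"
  shows "run (n + a) (block n l ps) (emb n a psi y) =
    (if bit y l then emb n a (list_proj n ps *\<^sub>v psi) (flip0 y) + emb n a (psi - list_proj n ps *\<^sub>v psi) y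
     else emb n a psi y)"
  using assms
proof (induction ps arbitrary: l y psi)
  case Nil
  have l: "l < a" "0 < a" using Nil.prems(2) by simp_all
  have e: "emb n a psi z \<in> carrier_vec (2 ^ (n + a))" for z using Nil.prems(5) by (rule emb_carrier)
  have ge: "gate_mat (n + a) G *\<^sub>v emb n a psi z \<in> carrier_vec (2 ^ (n + a))" for G z
    using e by (rule mult_mat_vec_carrier[OF gate_mat_carrier])
  have P: "list_proj n [] *\<^sub>v psi = psi" using Nil.prems(5) by (simp add: list_proj_def)
  have 0: "psi - psi = 0 \<cdot>\<^sub>v psi" by (rule eq_vecI) simp_all
  have X: "gate_mat (n + a) (G2 (n + l) n (ctrl (pauli1 1))) *\<^sub>v emb n a psi y =
      (if bit y l then emb n a psi (flip0 y) + 0 \<cdot>\<^sub>v emb n a psi y else emb n a psi y)"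
  proof (cases "bit y l")
    case True
    show ?thesis
      using ctrl_emb_anc[OF l Nil.prems(1,5,3), of "pauli1 1"] True carrier_vecD[OF e]
      by (cases "bit y 0"; intro eq_vecI) (simp_all add: flip0_def qb_eq_bit pauli1_index put_bit_same)
  qed (use ctrl_emb_anc[OF l Nil.prems(1,5,3), of "pauli1 1"] in simp)
  show ?case
    unfolding block.simps run_Cons[OF e] run_Nil[OF ge]
    unfolding X P 0 emb_smult[OF Nil.prems(5,3)] ..
next
  case (Cons p ps)
  let ?N = "n + a" and ?M = "signed_pauli n p"
  have l: "Suc l < a" "Suc l + length ps < a" "0 < a" using Cons.prems(2) by simp_all
  note y = Cons.prems(3) and psi = Cons.prems(5)
  have by_: "\<not> bit y (Suc l)" using Cons.prems(4) by simp
  have com: "pairwise_commuting n ps" using Cons.prems(6) by (auto simp: pairwise_commuting_def)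
  have step: "run ?N (block n l (p # ps)) v = run ?N (cond_flip n l p) (run ?N (block n (Suc l) ps) (run ?N (cond_flip n l p) v))"
    if "v \<in> carrier_vec (2 ^ ?N)" for v
    using that by (simp add: run_append run_carrier)
  have offIH: "run ?N (block n (Suc l) ps) (emb n a v y) = emb n a v y" if "v \<in> carrier_vec (2 ^ n)" for v
    using Cons.IH[of "Suc l" y v] that l y Cons.prems(4) com by simp
  show ?case
  proof (cases "bit y l")
    case False
    have "run ?N (cond_flip n l p) (emb n a psi y) = emb n a psi y"
      using l(1) y psi False by_ by (rule run_cond_flip_off)
    then show ?thesis
      using False emb_carrier[OF psi] offIH[OF psi] by (simp only: step if_False)
  next
    case True
    define y' yf where "y' = put_bit (Suc l) 1 y" and "yf = flip0 y"
    define Mpsi where "Mpsi = ?M *\<^sub>v psi"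
    \<comment> \<open>\<open>u\<close> and \<open>v\<close> are the components of \<open>psi\<close>
      for eigenvalues -1 and 1. In the next line \<open>chi\<close> is the part of \<open>v\<close>
      that the remaining factors accept.\<close>
    define u v where "u = (1 / 2) \<cdot>\<^sub>v (psi - Mpsi)" and "v = (1 / 2) \<cdot>\<^sub>v (psi + Mpsi)"
    define chi where "chi = list_proj n ps *\<^sub>v v"
    have Mpsi: "Mpsi \<in> carrier_vec (2 ^ n)" unfolding Mpsi_def by (rule mult_mat_vec_carrier[OF signed_pauli_carrier psi])
    have uv: "u \<in> carrier_vec (2 ^ n)" "v \<in> carrier_vec (2 ^ n)" using psi Mpsi by (simp_all add: u_def v_def)
    have chi: "chi \<in> carrier_vec (2 ^ n)" unfolding chi_def by (rule mult_mat_vec_carrier[OF list_proj_carrier uv(2)])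
    have vchi: "v - chi \<in> carrier_vec (2 ^ n)" using uv chi by simp
    have y': "y' < 2 ^ a" unfolding y'_def using l(1) y by (rule put_bit_less_pow)
    have yf: "yf < 2 ^ a" unfolding yf_def using l(3) y by (rule flip0_less_pow)
    have MM: "?M *\<^sub>v Mpsi = psi"
      using mult_mult_vec[OF signed_pauli_carrier signed_pauli_carrier psi, of p p] psi
      by (simp add: Mpsi_def signed_pauli_square)
    have Mv: "?M *\<^sub>v v = v"
    proof -
      have "?M *\<^sub>v v = (1 / 2) \<cdot>\<^sub>v (Mpsi + psi)"
        using psi Mpsi by (simp add: v_def mult_mat_vec[OF signed_pauli_carrier]
            mult_add_distrib_mat_vec[OF signed_pauli_carrier] MM Mpsi_def[symmetric])
      also have "\<dots> = v" unfolding v_def using psi Mpsi by (simp add: comm_add_vec)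
      finally show ?thesis .
    qed
    have Mu: "?M *\<^sub>v u = - 1 \<cdot>\<^sub>v u"
    proof -
      have "?M *\<^sub>v u = (1 / 2) \<cdot>\<^sub>v (Mpsi - psi)"
        using psi Mpsi by (simp add: u_def mult_mat_vec[OF signed_pauli_carrier]
            mult_minus_distrib_mat_vec[OF signed_pauli_carrier] MM Mpsi_def[symmetric])
      also have "\<dots> = - 1 \<cdot>\<^sub>v u" unfolding u_def using psi Mpsi by (intro eq_vecI) auto
      finally show ?thesis .
    qed
    \<comment> \<open>Commutation keeps both \<open>chi\<close> and \<open>v - chi\<close> in the
      eigenspace of \<open>?M\<close> for eigenvalue 1, so the second pass of the link clears the
      flag on each of them.\<close>
    have comP: "?M * list_proj n ps = list_proj n ps * ?M"
      unfolding list_proj_def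
      by (rule commute_gen_proj) (use Cons.prems(6) in \<open>auto simp: pairwise_commuting_def\<close>)
    have Mchi: "?M *\<^sub>v chi = chi"
      using mult_mult_vec[OF signed_pauli_carrier list_proj_carrier uv(2), of p ps]
        mult_mult_vec[OF list_proj_carrier signed_pauli_carrier uv(2), of ps p]
      by (simp add: comP chi_def Mv)
    have Meta: "?M *\<^sub>v (v - chi) = v - chi"
      using uv chi by (simp add: mult_minus_distrib_mat_vec[OF signed_pauli_carrier] Mv Mchi)
    have P: "list_proj n (p # ps) *\<^sub>v psi = chi"
    proof -
      have M1: "1\<^sub>m (2 ^ n) + ?M \<in> carrier_mat (2 ^ n) (2 ^ n)" by simp
      have "((1 / 2) \<cdot>\<^sub>m (1\<^sub>m (2 ^ n) + ?M)) *\<^sub>v psi = v"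
        unfolding smult_mat_vec[OF M1 psi] v_def Mpsi_def
        using psi by (simp add: add_mult_distrib_mat_vec[of _ "2 ^ n" "2 ^ n"])
      then show ?thesis
        using mult_mult_vec[OF list_proj_carrier _ psi, of "(1 / 2) \<cdot>\<^sub>m (1\<^sub>m (2 ^ n) + ?M)" ps]
        by (simp add: list_proj_def chi_def)
    qed
    have b': "bit y' (Suc l)" "\<And>j. Suc l < j \<Longrightarrow> \<not> bit y' j"
      using Cons.prems(4) by (auto simp: y'_def bit_put_bit)
    have IH: "run ?N (block n (Suc l) ps) (emb n a v y') = emb n a chi (put_bit (Suc l) 1 yf) + emb n a (v - chi) y'"
      using Cons.IH[of "Suc l" y' v] l y' b' uv com
      by (simp add: chi_def y'_def yf_def flip0_put_bit)
    note E = emb_carrier[OF uv(1), of a] emb_carrier[OF uv(2), of a] emb_carrier[OF chi, of a]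
      emb_carrier[OF vchi, of a] emb_carrier[OF psi, of a]
    have bf: "bit yf l" "\<not> bit yf (Suc l)"
      using True by_ Cons.prems(1) by (simp_all add: yf_def bit_flip0)
    have F: "run ?N (cond_flip n l p) (emb n a u y) = emb n a u y"
      "run ?N (cond_flip n l p) (emb n a chi (put_bit (Suc l) 1 yf)) = emb n a chi yf"
      "run ?N (cond_flip n l p) (emb n a (v - chi) y') = emb n a (v - chi) y"
      unfolding y'_def
      by (rule run_cond_flip_eigen[OF l(1)], (rule y yf uv chi vchi True by_ bf Mu Mchi Meta)+)+
    have "run ?N (block n l (p # ps)) (emb n a psi y) =
        emb n a u y + (emb n a chi yf + emb n a (v - chi) y)"
      unfolding step[OF E(5)] run_cond_flip_on(1)[OF l(1) y psi True by_] Mpsi_def[symmetric] u_def[symmetric]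
        v_def[symmetric] y'_def[symmetric]
      by (simp only: run_add add_carrier_vec E offIH[OF uv(1)] IH F)
    also have "\<dots> = emb n a chi yf + (emb n a u y + emb n a (v - chi) y)"
      using E by (intro eq_vecI) (auto simp: emb_dim uv chi vchi)
    \<comment> \<open>The part rejected by the first factor and the part rejected later now share
      one ancilla state and recombine to a single vector.\<close>
    also have "emb n a u y + emb n a (v - chi) y = emb n a (psi - chi) y"
    proof -
      have "u + (v - chi) = psi - chi"
        using psi Mpsi chi by (intro eq_vecI) (auto simp: u_def v_def field_simps)
      then show ?thesis using emb_add[OF uv(1) vchi y] by simp
    qed
    finally show ?thesis using True by (simp only: P yf_def if_True)
  qed
qed

section \<open>The blocks of all translates in sequence\<close>

definition proj_sum :: "nat \<Rightarrow> (bool \<times> (nat \<Rightarrow> nat)) list list \<Rightarrow> complex mat" where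
  "proj_sum n Ls = foldr (\<lambda>ps Q. list_proj n ps + Q) Ls (0\<^sub>m (2 ^ n) (2 ^ n))"

lemma proj_sum_simps:
  "proj_sum n [] = 0\<^sub>m (2 ^ n) (2 ^ n)"
  "proj_sum n (ps # Ls) = list_proj n ps + proj_sum n Ls"
  by (simp_all add: proj_sum_def)

lemma proj_sum_carrier [simp]: "proj_sum n Ls \<in> carrier_mat (2 ^ n) (2 ^ n)"
  by (induction Ls) (simp_all add: proj_sum_simps)

lemma proj_sum_mult_zero:
  assumes "\<And>qs. qs \<in> set Ls \<Longrightarrow> list_proj n qs * A = 0\<^sub>m (2 ^ n) (2 ^ n)" "A \<in> carrier_mat (2 ^ n) (2 ^ n)"
  shows "proj_sum n Ls * A = 0\<^sub>m (2 ^ n) (2 ^ n)"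
  using assms(1)
proof (induction Ls)
  case (Cons ps Ls)
  then show ?case
    using assms(2) by (simp add: proj_sum_simps add_mult_distrib_mat[of _ "2 ^ n" "2 ^ n" _ _ "2 ^ n"])
qed (use assms(2) in \<open>simp add: proj_sum_simps\<close>)

lemma zero_mat_mult_vec: "v \<in> carrier_vec d \<Longrightarrow> 0\<^sub>m d d *\<^sub>v v = (0\<^sub>v d :: complex vec)"
  by (rule eq_vecI) (auto simp: scalar_prod_def)

lemma bit_gt_1: "1 < j \<Longrightarrow> y < 4 \<Longrightarrow> \<not> bit (y :: nat) j"
proof -
  assume "1 < j" "y < 4"
  then have "(2::nat) ^ 2 \<le> 2 ^ j" by (intro power_increasing) auto
  then have "y < 2 ^ j" using \<open>y < 4\<close> by simp
  then show ?thesis by (simp add: bit_iff_odd)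
qed

text \<open>Bit 0 is the outcome and bit 1 the head of the chain, which stays 1 throughout. So
  ancilla states 2 and 3 are the clean states for outcomes 0 and 1.\<close>

lemma bits_2_3: "bit (2 :: nat) 1" "bit (3 :: nat) 1" "\<not> bit (2 :: nat) 0" "bit (3 :: nat) 0"
  by (simp_all add: bit_iff_odd)

lemma flip0_2_3: "flip0 2 = 3" "flip0 3 = 2"
proof -
  have 23: "(2 :: nat) < 2 ^ 2" "(3 :: nat) < 2 ^ 2" by simp_all
  have f: "flip0 2 < 2 ^ 2" "flip0 3 < 2 ^ 2" by (rule flip0_less_pow; simp)+
  show "flip0 2 = 3" "flip0 3 = 2"
    unfolding nat_eq_iff_bit_below[OF f(1) 23(2)] nat_eq_iff_bit_below[OF f(2) 23(1)]
    using bits_2_3 by (auto simp: bit_flip0 less_2_cases_iff)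
qed

text \<open>\<open>u\<close> collects what earlier blocks have moved to outcome 0. A block flips the
  outcome in either direction, so the remaining projectors must annihilate \<open>u\<close>;
  orthogonality preserves this when the next accepted component is added.\<close>

lemma run_blocks:
  assumes "\<And>ps. ps \<in> set Ls \<Longrightarrow> 1 + length ps < a \<and> pairwise_commuting n ps" "2 \<le> a"
    "sorted_wrt (\<lambda>ps qs. list_proj n qs * list_proj n ps = 0\<^sub>m (2 ^ n) (2 ^ n)) Ls"
    "u \<in> carrier_vec (2 ^ n)" "v \<in> carrier_vec (2 ^ n)"
    "\<And>ps. ps \<in> set Ls \<Longrightarrow> list_proj n ps *\<^sub>v u = 0\<^sub>v (2 ^ n)"
  shows "run (n + a) (concat (map (block n 1) Ls)) (emb n a u 2 + emb n a v 3) =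
    emb n a (u + proj_sum n Ls *\<^sub>v v) 2 + emb n a (v - proj_sum n Ls *\<^sub>v v) 3"
  using assms(1,3-)
proof (induction Ls arbitrary: u v)
  case Nil
  have "emb n a u 2 + emb n a v 3 \<in> carrier_vec (2 ^ (n + a))"
    using emb_carrier[OF Nil.prems(3), of a 2] emb_carrier[OF Nil.prems(4), of a 3] by (rule add_carrier_vec)
  then show ?case
    using Nil.prems(3,4) by (simp add: run_Nil proj_sum_simps zero_mat_mult_vec)
next
  case (Cons ps Ls)
  let ?P = "list_proj n ps" and ?N = "n + a"
  have "(2::nat) ^ 2 \<le> 2 ^ a" using assms(2) by (intro power_increasing) auto
  then have y: "(2::nat) < 2 ^ a" "(3::nat) < 2 ^ a" by simp_all
  note u = Cons.prems(3) and v = Cons.prems(4)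
  have ps: "1 + length ps < a" "pairwise_commuting n ps" using Cons.prems(1) by auto
  have Pv: "?P *\<^sub>v v \<in> carrier_vec (2 ^ n)" by (rule mult_mat_vec_carrier[OF list_proj_carrier v])
  have Pu: "?P *\<^sub>v u = 0\<^sub>v (2 ^ n)" using Cons.prems(5) by simp
  have c: "u + ?P *\<^sub>v v \<in> carrier_vec (2 ^ n)" "v - ?P *\<^sub>v v \<in> carrier_vec (2 ^ n)" using u v Pv by simp_all
  note E = emb_carrier[OF u, of a] emb_carrier[OF v, of a] emb_carrier[OF Pv, of a] emb_carrier[OF c(1), of a]
    emb_carrier[OF c(2), of a]
  have z: "0\<^sub>v (2 ^ n) = (0 :: complex) \<cdot>\<^sub>v u" "u - 0 \<cdot>\<^sub>v u = u" using u by (auto intro!: eq_vecI)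
  have b1: "run ?N (block n 1 ps) (emb n a u 2) = 0 \<cdot>\<^sub>v emb n a u 3 + emb n a u 2"
    using run_block[of 1 ps a 2 u n] ps y u bit_gt_1[of _ 2] bits_2_3
    by (simp add: Pu z flip0_2_3 emb_smult[OF u y(2)])
  have b2: "run ?N (block n 1 ps) (emb n a v 3) = emb n a (?P *\<^sub>v v) 2 + emb n a (v - ?P *\<^sub>v v) 3"
    using run_block[of 1 ps a 3 v n] ps y v bit_gt_1[of _ 3] bits_2_3 by (simp add: flip0_2_3)
  have b: "run ?N (block n 1 ps) (emb n a u 2 + emb n a v 3) = emb n a (u + ?P *\<^sub>v v) 2 + emb n a (v - ?P *\<^sub>v v) 3"
    unfolding run_add[OF E(1,2)] b1 b2 emb_add[OF u Pv y(1)]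
    using carrier_vecD[OF E(1)] carrier_vecD[OF E(3)] carrier_vecD[OF E(5)]
    by (intro eq_vecI) simp_all
  have orth: "list_proj n qs * ?P = 0\<^sub>m (2 ^ n) (2 ^ n)" if "qs \<in> set Ls" for qs
    using Cons.prems(2) that by simp
  have kill: "list_proj n qs *\<^sub>v (u + ?P *\<^sub>v v) = 0\<^sub>v (2 ^ n)" if "qs \<in> set Ls" for qs
  proof -
    have "list_proj n qs *\<^sub>v (?P *\<^sub>v v) = 0\<^sub>v (2 ^ n)"
      using mult_mult_vec[OF list_proj_carrier list_proj_carrier v, of qs ps] orth[OF that] v
      by (simp add: zero_mat_mult_vec)
    then show ?thesis
      using mult_add_distrib_mat_vec[OF list_proj_carrier u Pv, of qs] Cons.prems(5)[of qs] that by simp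
  qed
  have Sv: "proj_sum n Ls *\<^sub>v v \<in> carrier_vec (2 ^ n)" by (rule mult_mat_vec_carrier[OF proj_sum_carrier v])
  have "proj_sum n Ls *\<^sub>v (?P *\<^sub>v v) = 0\<^sub>v (2 ^ n)"
    using mult_mult_vec[OF proj_sum_carrier list_proj_carrier v, of Ls ps]
      proj_sum_mult_zero[OF orth list_proj_carrier] v by (simp add: zero_mat_mult_vec)
  then have S: "proj_sum n Ls *\<^sub>v (v - ?P *\<^sub>v v) = proj_sum n Ls *\<^sub>v v"
    using mult_minus_distrib_mat_vec[OF proj_sum_carrier v Pv, of Ls] Sv by simp
  have T: "proj_sum n (ps # Ls) *\<^sub>v v = ?P *\<^sub>v v + proj_sum n Ls *\<^sub>v v"
    unfolding proj_sum_simps by (rule add_mult_distrib_mat_vec[OF list_proj_carrier proj_sum_carrier v])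
  have "run ?N (concat (map (block n 1) (ps # Ls))) (emb n a u 2 + emb n a v 3) =
      run ?N (concat (map (block n 1) Ls)) (emb n a (u + ?P *\<^sub>v v) 2 + emb n a (v - ?P *\<^sub>v v) 3)"
    using add_carrier_vec[OF E(1,2)] by (simp add: run_append b[simplified])
  also have "\<dots> = emb n a (u + ?P *\<^sub>v v + proj_sum n Ls *\<^sub>v v) 2 + emb n a (v - ?P *\<^sub>v v - proj_sum n Ls *\<^sub>v v) 3"
    using Cons.IH[OF Cons.prems(1) _ c kill] Cons.prems(2) by (simp add: S)
  also have "u + ?P *\<^sub>v v + proj_sum n Ls *\<^sub>v v = u + proj_sum n (ps # Ls) *\<^sub>v v"
    unfolding T using u Pv Sv by (intro eq_vecI) auto
  also have "v - ?P *\<^sub>v v - proj_sum n Ls *\<^sub>v v = v - proj_sum n (ps # Ls) *\<^sub>v v"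
    unfolding T using carrier_vecD[OF v] carrier_vecD[OF Pv] carrier_vecD[OF Sv]
    by (intro eq_vecI) (simp_all del: dim_mult_mat_vec)
  finally show ?case .
qed

lemma unit_vec_kron:
  assumes "b < 2" "z < 2 ^ (a - 1)" "0 < a"
  shows "unit_vec (2 ^ a) (b + 2 * z) = (kron_vec (unit_vec 2 b) (unit_vec (2 ^ (a - 1)) z) :: complex vec)"
proof (rule eq_vecI)
  have a: "(2::nat) ^ a = 2 * 2 ^ (a - 1)" using assms(3) by (cases a) simp_all
  fix i assume "i < dim_vec (kron_vec (unit_vec 2 b) (unit_vec (2 ^ (a - 1)) z) :: complex vec)"
  then have i: "i < 2 * 2 ^ (a - 1)" by (simp add: kron_vec_def)
  then have "i div 2 < 2 ^ (a - 1)" "i mod 2 < 2" by auto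
  moreover have "i = b + 2 * z \<longleftrightarrow> i mod 2 = b \<and> i div 2 = z" using assms(1) by auto
  ultimately show "unit_vec (2 ^ a) (b + 2 * z) $ i = (kron_vec (unit_vec 2 b) (unit_vec (2 ^ (a - 1)) z) :: complex vec) $ i"
    unfolding a using i by (simp add: kron_vec_def unit_vec_def)
qed (use assms(3) in \<open>cases a; simp add: kron_vec_def\<close>)

text \<open>The first gate sets the outcome to 1, so that everything counts as rejected until a
  block flips it. The second switches on the head of the chain, which makes the first link like all
  others. Both are one-qubit gates.\<close>

definition meas_circuit :: "nat \<Rightarrow> (bool \<times> (nat \<Rightarrow> nat)) list list \<Rightarrow> gate list" where
  "meas_circuit n Ls = [G1 (n + 0) (pauli1 1), G1 (n + 1) (pauli1 1)] @ concat (map (block n 1) Ls)"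

lemma two_qubit_count_meas_circuit:
  assumes "\<And>ps. ps \<in> set Ls \<Longrightarrow> length ps = r"
  shows "two_qubit_count (meas_circuit n Ls) = length Ls * (2 * r * (n + 2) + 1)"
proof -
  have "two_qubit_count (concat (map (block n 1) Ls)) = length Ls * (2 * r * (n + 2) + 1)"
    using assms by (induction Ls) (simp_all add: two_qubit_count_append two_qubit_count_block, simp add: two_qubit_count_def)
  then show ?thesis
    unfolding meas_circuit_def two_qubit_count_append by (simp add: two_qubit_count_def)
qed

text \<open>The \<open>r + 2\<close> ancillas are the outcome, the head of the chain and one flag
  per factor.\<close>

lemma implements_meas_circuit:
  assumes a: "a = r + 2" and Ls: "\<And>ps. ps \<in> set Ls \<Longrightarrow> length ps = r \<and> pairwise_commuting n ps"
    and orth: "sorted_wrt (\<lambda>ps qs. list_proj n qs * list_proj n ps = 0\<^sub>m (2 ^ n) (2 ^ n)) Ls"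
  shows "implements_measurement n a (proj_sum n Ls) (meas_circuit n Ls)"
  unfolding implements_measurement_def
proof (intro conjI ballI exI)
  \<comment> \<open>With the outcome qubit split off, the head is the lowest remaining bit and the
    only one set. All flags are clean again, so one state serves for both outcomes.\<close>
  let ?chi = "unit_vec (2 ^ (a - 1)) 1 :: complex vec"
  show "1 \<le> a" using a by simp
  show "gate_ok (n + a) G" if "G \<in> set (meas_circuit n Ls)" for G
  proof -
    have "gate_ok (n + a) G" if "ps \<in> set Ls" "G \<in> set (block n 1 ps)" for ps
      using block_gates_ok[of 1 ps a G n] that Ls[OF that(1)] a by simp
    then show ?thesis using that a by (auto simp: meas_circuit_def unitary_pauli1)
  qed
  show "?chi \<in> carrier_vec (2 ^ (a - 1))" "?chi \<in> carrier_vec (2 ^ (a - 1))" by simp_all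
  fix psi :: "complex vec" assume psi: "psi \<in> carrier_vec (2 ^ n)"
  let ?P = "proj_sum n Ls"
  have Ppsi: "?P *\<^sub>v psi \<in> carrier_vec (2 ^ n)" by (rule mult_mat_vec_carrier[OF proj_sum_carrier psi])
  have "(2::nat) ^ 2 \<le> 2 ^ a" using a by (intro power_increasing) auto
  then have y: "(0::nat) < 2 ^ a" "(1::nat) < 2 ^ a" "(2::nat) < 2 ^ a" "(3::nat) < 2 ^ a" by simp_all
  note E = emb_carrier[OF psi, of a]
  have put: "put_bit 0 1 0 = 1" "put_bit 1 1 1 = 3"
    by (simp_all add: put_bit_def set_bit_eq)
  have pauli: "pauli1 1 $$ (0, qb 0 0) = 0" "pauli1 1 $$ (1, qb 0 0) = 1"
    "pauli1 1 $$ (0, qb 1 1) = 0" "pauli1 1 $$ (1, qb 1 1) = 1"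
    by (simp_all add: qb_def pauli1_index)
  have comb: "0 \<cdot>\<^sub>v emb n a psi x + 1 \<cdot>\<^sub>v emb n a psi x' = emb n a psi x'" for x x'
    using carrier_vecD[OF E] by (intro eq_vecI) simp_all
  have one_less: "(1::nat) < 2 ^ (a - 1)" using a by (intro one_less_power) simp_all
  have unit_kron: "unit_vec (2 ^ a) 2 = kron_vec (unit_vec 2 0) ?chi" "unit_vec (2 ^ a) 3 = kron_vec (unit_vec 2 1) ?chi"
    using unit_vec_kron[OF _ one_less, of 0] unit_vec_kron[OF _ one_less, of 1] a
    by (simp_all add: numeral_2_eq_2 numeral_3_eq_3)
  have a01: "0 < a" "1 < a" using a by simp_all
  have X1: "gate_mat (n + a) (G1 (n + 0) (pauli1 1)) *\<^sub>v emb n a psi 0 = emb n a psi 1"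
    unfolding G1_emb[OF a01(1) psi y(1)] pauli put by (rule comb)
  have X2: "gate_mat (n + a) (G1 (n + 1) (pauli1 1)) *\<^sub>v emb n a psi 1 = emb n a psi 3"
    unfolding G1_emb[OF a01(2) psi y(2)] pauli put by (rule comb)
  have z: "0\<^sub>v (2 ^ n) = (0 :: complex) \<cdot>\<^sub>v psi" using psi by (intro eq_vecI) auto
  have e0: "emb n a (0\<^sub>v (2 ^ n)) 2 + emb n a psi 3 = emb n a psi 3"
    unfolding z emb_smult[OF psi y(3)] using carrier_vecD[OF E] by (intro eq_vecI) simp_all
  have kill: "list_proj n ps *\<^sub>v 0\<^sub>v (2 ^ n) = 0\<^sub>v (2 ^ n)" for ps
    using carrier_matD[OF list_proj_carrier[of n ps]] by (intro eq_vecI) (auto simp: scalar_prod_def)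
  have ok: "1 + length ps < a \<and> pairwise_commuting n ps" if "ps \<in> set Ls" for ps
    using Ls[OF that] a by simp
  have "run (n + a) (meas_circuit n Ls) (emb n a psi 0) =
      run (n + a) (concat (map (block n 1) Ls)) (emb n a psi 3)"
    unfolding meas_circuit_def append_Cons append_Nil run_Cons[OF E] X1 X2 ..
  also have "\<dots> = run (n + a) (concat (map (block n 1) Ls)) (emb n a (0\<^sub>v (2 ^ n)) 2 + emb n a psi 3)"
    by (simp only: e0)
  also have "\<dots> = emb n a (0\<^sub>v (2 ^ n) + ?P *\<^sub>v psi) 2 + emb n a (psi - ?P *\<^sub>v psi) 3"
    by (rule run_blocks[OF ok _ orth zero_carrier_vec psi kill]) (simp_all add: a)
  also have "0\<^sub>v (2 ^ n) + ?P *\<^sub>v psi = ?P *\<^sub>v psi" using Ppsi by simp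
  also have "psi - ?P *\<^sub>v psi = (1\<^sub>m (2 ^ n) - ?P) *\<^sub>v psi"
    using psi by (simp add: minus_mult_distrib_mat_vec[of _ "2 ^ n" "2 ^ n"])
  finally show "circuit_mat (n + a) (meas_circuit n Ls) *\<^sub>v kron_vec psi (unit_vec (2 ^ a) 0) =
      kron_vec (?P *\<^sub>v psi) (kron_vec (unit_vec 2 0) ?chi) +
      kron_vec ((1\<^sub>m (2 ^ n) - ?P) *\<^sub>v psi) (kron_vec (unit_vec 2 1) ?chi)"
    unfolding unit_kron[symmetric] run_def emb_def .
qed

section \<open>The projector of an additive code\<close>

lemma gprod_carrier:
  assumes "\<And>i. i < k \<Longrightarrow> g i \<in> carrier_mat (2 ^ n) (2 ^ n)"
  shows "gprod n g k a \<in> carrier_mat (2 ^ n) (2 ^ n)"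
  using assms by (induction k) (auto intro!: mult_carrier_mat[of _ _ "2 ^ n"])

lemma gprod_add_pow: "k \<le> l \<Longrightarrow> gprod n g k (2 ^ l + a) = gprod n g k a"
  by (induction k) (simp_all add: qb_add_pow_low)

lemma gprod_pauli:
  assumes "\<And>i. i < k \<Longrightarrow> g i \<in> pauli_group n"
  shows "gprod n g k a \<in> pauli_group n"
  using assms by (induction k) (auto intro!: pauli_group_mult one_in_pauli_group)

text \<open>An unnormalized twirl. On \<open>outer (2 ^ n) s\<close> it gives the sum of the
  rank-one operators of all word states, while on a Pauli operator it is easy to evaluate; comparing
  the two yields the projector.\<close>

definition conj_sum :: "nat \<Rightarrow> (nat \<Rightarrow> complex mat) \<Rightarrow> nat \<Rightarrow> complex mat \<Rightarrow> complex mat" where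
  "conj_sum n g k A = msum (2 ^ n) (\<lambda>a. gprod n g k a * A * mat_adjoint (gprod n g k a)) {..<2 ^ k}"

lemma mult_conj_carrier [intro]:
  fixes A B :: "complex mat"
  assumes "A \<in> carrier_mat d d" "B \<in> carrier_mat d d"
  shows "B * A * mat_adjoint B \<in> carrier_mat d d"
  using assms by (intro mult_carrier_mat[of _ d d] mat_adjoint_carrier)

lemma conj_sum_carrier [simp]: "conj_sum n g k A \<in> carrier_mat (2 ^ n) (2 ^ n)"
  by (simp add: conj_sum_def)

lemma conj_sum_msum:
  assumes "\<And>i. i < k \<Longrightarrow> g i \<in> carrier_mat (2 ^ n) (2 ^ n)" "\<And>x. x \<in> S \<Longrightarrow> F x \<in> carrier_mat (2 ^ n) (2 ^ n)"
  shows "conj_sum n g k (msum (2 ^ n) F S) = msum (2 ^ n) (\<lambda>x. conj_sum n g k (F x)) S"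
proof -
  have G: "gprod n g k a \<in> carrier_mat (2 ^ n) (2 ^ n)" for a by (rule gprod_carrier) (rule assms(1))
  have "gprod n g k a * msum (2 ^ n) F S * mat_adjoint (gprod n g k a) =
      msum (2 ^ n) (\<lambda>x. gprod n g k a * F x * mat_adjoint (gprod n g k a)) S" for a
  proof -
    have "gprod n g k a * msum (2 ^ n) F S = msum (2 ^ n) (\<lambda>x. gprod n g k a * F x) S"
      by (rule mult_msum[OF G assms(2)])
    moreover have "msum (2 ^ n) (\<lambda>x. gprod n g k a * F x) S * mat_adjoint (gprod n g k a) =
        msum (2 ^ n) (\<lambda>x. gprod n g k a * F x * mat_adjoint (gprod n g k a)) S"
      by (rule msum_mult[OF mat_adjoint_carrier[OF G] mult_carrier_mat[OF G assms(2)]])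
    ultimately show ?thesis by simp
  qed
  then show ?thesis
    unfolding conj_sum_def by (simp only: msum_swap[of _ _ S])
qed

lemma smult_conj:
  fixes A B :: "complex mat"
  assumes "A \<in> carrier_mat d d" "B \<in> carrier_mat d d"
  shows "B * (c \<cdot>\<^sub>m A) * mat_adjoint B = c \<cdot>\<^sub>m (B * A * mat_adjoint B)"
  unfolding mult_smult_distrib[OF assms(2,1)]
  by (rule mult_smult_assoc_mat[OF mult_carrier_mat[OF assms(2,1)] mat_adjoint_carrier[OF assms(2)]])

lemma conj_sum_smult:
  assumes "\<And>i. i < k \<Longrightarrow> g i \<in> carrier_mat (2 ^ n) (2 ^ n)" "A \<in> carrier_mat (2 ^ n) (2 ^ n)"
  shows "conj_sum n g k (c \<cdot>\<^sub>m A) = c \<cdot>\<^sub>m conj_sum n g k A"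
proof -
  have G: "gprod n g k a \<in> carrier_mat (2 ^ n) (2 ^ n)" for a by (rule gprod_carrier) (rule assms(1))
  show ?thesis
    unfolding conj_sum_def smult_conj[OF assms(2) G]
    by (rule smult_msum[symmetric]) (rule mult_conj_carrier[OF assms(2) G])
qed

text \<open>Splitting the exponents at the top bit peels off \<open>g k\<close>, the last factor of
  the product and hence the innermost conjugation.\<close>

lemma conj_sum_Suc:
  assumes g: "\<And>i. i < Suc k \<Longrightarrow> g i \<in> carrier_mat (2 ^ n) (2 ^ n)" and A: "A \<in> carrier_mat (2 ^ n) (2 ^ n)"
  shows "conj_sum n g (Suc k) A = conj_sum n g k (A + g k * A * mat_adjoint (g k))"
proof (rule eq_matI)
  let ?d = "2 ^ n :: nat"
  let ?G = "gprod n g k"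
  have G: "?G a \<in> carrier_mat ?d ?d" for a by (rule gprod_carrier) (rule g, simp)
  have gk: "g k \<in> carrier_mat ?d ?d" by (rule g) simp
  have B: "g k * A * mat_adjoint (g k) \<in> carrier_mat ?d ?d" by (rule mult_conj_carrier[OF A gk])
  fix i j assume "i < dim_row (conj_sum n g k (A + g k * A * mat_adjoint (g k)))"
    "j < dim_col (conj_sum n g k (A + g k * A * mat_adjoint (g k)))"
  then have ij: "i < ?d" "j < ?d" by (simp_all add: conj_sum_def)
  let ?T = "\<lambda>a. gprod n g (Suc k) a * A * mat_adjoint (gprod n g (Suc k) a)"
  have T1: "?T a = ?G a * A * mat_adjoint (?G a)" if "a < 2 ^ k" for a
    using that by (simp add: qb_top)
  have T2: "?T (2 ^ k + a) = ?G a * (g k * A * mat_adjoint (g k)) * mat_adjoint (?G a)" if "a < 2 ^ k" for a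
  proof -
    have "gprod n g (Suc k) (2 ^ k + a) = ?G a * g k"
      using that by (simp add: qb_add_pow_top gprod_add_pow)
    moreover have "mat_adjoint (?G a * g k) = mat_adjoint (g k) * mat_adjoint (?G a)"
      by (rule mat_adjoint_mult[OF G gk])
    moreover have "?G a * g k * A * (mat_adjoint (g k) * mat_adjoint (?G a)) =
        ?G a * (g k * A * mat_adjoint (g k)) * mat_adjoint (?G a)"
      using G[of a] gk A mat_adjoint_carrier[OF G[of a]] mat_adjoint_carrier[OF gk]
      by (simp add: mult_assoc_sq[of _ ?d] mult_carrier_mat[of _ ?d ?d])
    ultimately show ?thesis by simp
  qed
  have add: "?G a * (A + g k * A * mat_adjoint (g k)) * mat_adjoint (?G a) =
      ?G a * A * mat_adjoint (?G a) + ?G a * (g k * A * mat_adjoint (g k)) * mat_adjoint (?G a)" for a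
    unfolding mult_add_distrib_mat[OF G A B]
    by (rule add_mult_distrib_mat[OF mult_carrier_mat[OF G A] mult_carrier_mat[OF G B] mat_adjoint_carrier[OF G]])
  have "(\<Sum>a<2 ^ Suc k. ?T a $$ (i, j)) = (\<Sum>a<2 ^ k. ?T a $$ (i, j)) + (\<Sum>a<2 ^ k. ?T (2 ^ k + a) $$ (i, j))"
    using sum_lessThan_add[of "\<lambda>a. ?T a $$ (i, j)" "2 ^ k" "2 ^ k"] by (simp only: power_Suc mult_2)
  also have "\<dots> = (\<Sum>a<2 ^ k. (?G a * A * mat_adjoint (?G a)) $$ (i, j) +
      (?G a * (g k * A * mat_adjoint (g k)) * mat_adjoint (?G a)) $$ (i, j))"
    unfolding sum.distrib by (intro arg_cong2[of _ _ _ _ "(+)"] sum.cong refl; simp only: lessThan_iff T1 T2)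
  also have "\<dots> = (\<Sum>a<2 ^ k. (?G a * (A + g k * A * mat_adjoint (g k)) * mat_adjoint (?G a)) $$ (i, j))"
    unfolding add using ij carrier_matD[OF mult_conj_carrier[OF B G]]
    by (intro sum.cong refl) (simp del: index_mult_mat)
  finally show "conj_sum n g (Suc k) A $$ (i, j) = conj_sum n g k (A + g k * A * mat_adjoint (g k)) $$ (i, j)"
    unfolding conj_sum_def msum_index[OF ij] .
qed (simp_all add: conj_sum_def)

text \<open>Conjugation by \<open>g k\<close> multiplies \<open>N\<close> by a sign
  \<open>c\<close>, so each generator contributes the factor \<open>1 + c\<close>, which is 2 or
  0.\<close>

lemma conj_sum_pauli:
  assumes "\<And>i. i < k \<Longrightarrow> g i \<in> pauli_group n" "N \<in> pauli_group n"
  shows "conj_sum n g k N = (if \<forall>i<k. N * g i = g i * N then 2 ^ k else 0) \<cdot>\<^sub>m N"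
  using assms(1)
proof (induction k)
  case 0
  have N: "N \<in> carrier_mat (2 ^ n) (2 ^ n)" by (rule pauli_group_carrier[OF assms(2)])
  have "mat_adjoint (1\<^sub>m (2 ^ n)) = (1\<^sub>m (2 ^ n) :: complex mat)"
    by (rule mat_adjoint_eqI[of _ "2 ^ n"]) auto
  then have "1\<^sub>m (2 ^ n) * N * mat_adjoint (1\<^sub>m (2 ^ n)) = N"
    by (simp add: left_mult_one_mat[OF N] right_mult_one_mat[OF N])
  then show ?case
    using N by (simp add: conj_sum_def lessThan_Suc msum_singleton one_smult_mat)
next
  case (Suc k)
  have N: "N \<in> carrier_mat (2 ^ n) (2 ^ n)" by (rule pauli_group_carrier[OF assms(2)])
  have gp: "g k \<in> pauli_group n" using Suc.prems by simp
  have g: "g i \<in> carrier_mat (2 ^ n) (2 ^ n)" if "i < Suc k" for i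
    by (rule pauli_group_carrier[OF Suc.prems[OF that]])
  have gk: "g k \<in> carrier_mat (2 ^ n) (2 ^ n)" by (rule g) simp
  define c :: complex where "c = (if N * g k = g k * N then 1 else - 1)"
  have cc: "N * g k = g k * N \<longleftrightarrow> c = 1" by (simp add: c_def)
  have c: "c \<in> {1, - 1}" "g k * N = c \<cdot>\<^sub>m (N * g k)"
  proof -
    obtain e where "e \<in> {1, - 1}" "g k * N = e \<cdot>\<^sub>m (N * g k)"
      using pauli_group_commute[OF gp assms(2)] by blast
    then show "g k * N = c \<cdot>\<^sub>m (N * g k)"
      by (auto simp: c_def one_smult_mat)
  qed (simp add: c_def)
  have NG: "N * g k \<in> carrier_mat (2 ^ n) (2 ^ n)" by (rule mult_carrier_mat[OF N gk])
  have "g k * N * mat_adjoint (g k) = c \<cdot>\<^sub>m (N * g k * mat_adjoint (g k))"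
    unfolding c(2) by (rule mult_smult_assoc_mat[OF NG mat_adjoint_carrier[OF gk]])
  also have "N * g k * mat_adjoint (g k) = N"
    unfolding mult_assoc_sq[OF N gk mat_adjoint_carrier[OF gk]] pauli_group_unitary(1)[OF gp]
    by (rule right_mult_one_mat[OF N])
  finally have "N + g k * N * mat_adjoint (g k) = (1 + c) \<cdot>\<^sub>m N"
    using N by (intro eq_matI) (auto simp: algebra_simps)
  then have *: "conj_sum n g (Suc k) N = (1 + c) \<cdot>\<^sub>m conj_sum n g k N"
    using conj_sum_Suc[OF g N] conj_sum_smult[OF g N] by simp
  have IH: "conj_sum n g k N = (if \<forall>i<k. N * g i = g i * N then 2 ^ k else 0) \<cdot>\<^sub>m N"
    using Suc.IH Suc.prems by simp
  have all: "(\<forall>i<Suc k. N * g i = g i * N) \<longleftrightarrow> (\<forall>i<k. N * g i = g i * N) \<and> c = 1"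
    unfolding cc[symmetric] by (auto simp only: less_Suc_eq)
  show ?case
    unfolding * IH all smult_smult using c(1) by auto
qed

text \<open>An element fixes \<open>s\<close> and can be moved past all \<open>g i\<close>, so it
  fixes every state \<open>gprod n g k a *\<^sub>v s\<close>. These two conditions are the ones that
  decide which Pauli operators survive in the twirl of \<open>outer (2 ^ n) s\<close>.\<close>

definition code_stabilizer :: "nat \<Rightarrow> nat \<Rightarrow> (nat \<Rightarrow> complex mat) \<Rightarrow> complex vec \<Rightarrow> complex mat set" where
  "code_stabilizer n k g s = {M \<in> pauli_group n. M *\<^sub>v s = s \<and> (\<forall>i<k. M * g i = g i * M)}"

lemma cscalar_self_real: "v \<in> carrier_vec d \<Longrightarrow> cnj (v \<bullet>c v) = v \<bullet>c (v :: complex vec)"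
  by (simp add: cscalar_prod_sum[of _ d] mult.commute)

lemma cscalar_self_nonzero: "v \<in> carrier_vec d \<Longrightarrow> v \<noteq> 0\<^sub>v d \<Longrightarrow> v \<bullet>c v \<noteq> (0 :: complex)"
  by (simp add: conjugate_square_eq_0_vec)

lemma stabilizer_stateD:
  assumes "stabilizer_state n s"
  shows "s \<in> carrier_vec (2 ^ n)" "s \<bullet>c s \<noteq> 0" "cnj (s \<bullet>c s) = s \<bullet>c s"
proof -
  show s: "s \<in> carrier_vec (2 ^ n)" using assms by (simp add: stabilizer_state_def)
  show "s \<bullet>c s \<noteq> 0" using assms by (intro cscalar_self_nonzero[OF s]) (simp add: stabilizer_state_def)
  show "cnj (s \<bullet>c s) = s \<bullet>c s" by (rule cscalar_self_real[OF s])
qed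

lemma smult_mat_cancel:
  fixes A B :: "complex mat"
  assumes "z \<cdot>\<^sub>m A = z \<cdot>\<^sub>m B" "z \<noteq> 0"
  shows "A = B"
proof -
  have "(1 / z) \<cdot>\<^sub>m (z \<cdot>\<^sub>m A) = (1 / z) \<cdot>\<^sub>m (z \<cdot>\<^sub>m B)" using assms(1) by simp
  then show ?thesis using assms(2) by (simp add: smult_smult one_smult_mat)
qed

text \<open>All elements fix the nonzero vector \<open>s\<close>. This excludes anticommuting pairs,
  for which the expectation in \<open>s\<close> would vanish, and elements of square -1, which would
  send \<open>s\<close> to its negative.\<close>

lemma elementary_abelian_code_stabilizer:
  assumes st: "stabilizer_state n s" and g: "\<And>i. i < k \<Longrightarrow> g i \<in> pauli_group n"
  shows "elementary_abelian_mats (2 ^ n) (code_stabilizer n k g s)"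
proof
  let ?d = "2 ^ n :: nat" and ?G = "code_stabilizer n k g s"
  note s = stabilizer_stateD[OF st]
  have P: "M \<in> pauli_group n" "M *\<^sub>v s = s" "\<And>i. i < k \<Longrightarrow> M * g i = g i * M" if "M \<in> ?G" for M
    using that unfolding code_stabilizer_def by blast+
  have C: "M \<in> carrier_mat ?d ?d" if "M \<in> ?G" for M using P(1)[OF that] by (rule pauli_group_carrier)
  have gc: "g i \<in> carrier_mat ?d ?d" if "i < k" for i using g[OF that] by (rule pauli_group_carrier)
  show "finite ?G" by (rule finite_subset[OF _ finite_pauli_group[of n]]) (auto simp: code_stabilizer_def)
  show "M \<in> carrier_mat ?d ?d" if "M \<in> ?G" for M using that by (rule C)
  show "1\<^sub>m ?d \<in> ?G"
    using s(1) left_mult_one_mat[OF gc] right_mult_one_mat[OF gc]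
    by (auto simp: code_stabilizer_def one_in_pauli_group)
  show "A * B \<in> ?G" if "A \<in> ?G" "B \<in> ?G" for A B
  proof -
    have "(A * B) * g i = g i * (A * B)" if i: "i < k" for i
    proof -
      have "(A * B) * g i = A * (g i * B)"
        by (simp only: mult_assoc_sq[OF C[OF \<open>A \<in> ?G\<close>] C[OF \<open>B \<in> ?G\<close>] gc[OF i]] P(3)[OF \<open>B \<in> ?G\<close> i])
      also have "\<dots> = (g i * A) * B"
        by (simp only: mult_assoc_sq[OF C[OF \<open>A \<in> ?G\<close>] gc[OF i] C[OF \<open>B \<in> ?G\<close>], symmetric] P(3)[OF \<open>A \<in> ?G\<close> i])
      also have "\<dots> = g i * (A * B)"
        by (rule mult_assoc_sq[OF gc[OF i] C[OF \<open>A \<in> ?G\<close>] C[OF \<open>B \<in> ?G\<close>]])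
      finally show ?thesis .
    qed
    moreover have "(A * B) *\<^sub>v s = s"
      by (simp only: mult_mult_vec[OF C[OF that(1)] C[OF that(2)] s(1)] P(2)[OF that(1)] P(2)[OF that(2)])
    ultimately show ?thesis
      using pauli_group_mult[OF P(1)[OF that(1)] P(1)[OF that(2)]] unfolding code_stabilizer_def by blast
  qed
  show "A * B = B * A" if "A \<in> ?G" "B \<in> ?G" for A B
  proof (rule ccontr)
    assume "A * B \<noteq> B * A"
    then have "(A *\<^sub>v s) \<bullet>c s = 0"
      by (rule anticommuting_stabilizer_expectation[OF P(1)[OF that(1)] P(1)[OF that(2)] s(1) P(2)[OF that(2)]])
    then show False using s(2) by (simp add: P(2)[OF that(1)])
  qed
  show "A * A = 1\<^sub>m ?d" if "A \<in> ?G" for A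
  proof -
    obtain c where c: "A * A = c \<cdot>\<^sub>m 1\<^sub>m ?d" using pauli_group_square[OF P(1)[OF \<open>A \<in> ?G\<close>]] by blast
    have "s = (A * A) *\<^sub>v s"
      by (simp only: mult_mult_vec[OF C[OF that] C[OF that] s(1)] P(2)[OF that])
    also have "\<dots> = c \<cdot>\<^sub>v s"
      unfolding c smult_mat_vec[OF one_carrier_mat s(1)] using s(1) by simp
    finally have "s \<bullet>c s = c * (s \<bullet>c s)"
      using smult_cscalar[OF s(1) s(1), of c] by simp
    then have "c = 1" using s(2) by simp
    then show ?thesis using c by (simp add: one_smult_mat)
  qed
qed

text \<open>Expanding \<open>|s\<rangle>\<langle>s|\<close> in Pauli operators leaves the stabilizer of \<open>s\<close>; conjugating by the group generated by
the \<open>g i\<close> and summing kills exactly the terms that anticommute with some \<open>g i\<close>.\<close>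
lemma conj_sum_outer:
  assumes st: "stabilizer_state n s" and g: "\<And>i. i < k \<Longrightarrow> g i \<in> pauli_group n"
  shows "conj_sum n g k (outer (2 ^ n) s) =
    (2 ^ k * (s \<bullet>c s) / 2 ^ n) \<cdot>\<^sub>m msum (2 ^ n) id (code_stabilizer n k g s)"
proof -
  let ?d = "2 ^ n :: nat" and ?F = "{..<n} \<rightarrow>\<^sub>E {..<4::nat}" and ?G = "code_stabilizer n k g s"
  define c where "c = s \<bullet>c s"
  define e where "e f = (pauli_str n f *\<^sub>v s) \<bullet>c s" for f
  define com where "com f = (\<forall>i<k. pauli_str n f * g i = g i * pauli_str n f)" for f
  define F0 where "F0 = {f \<in> ?F. e f \<noteq> 0 \<and> com f}"
  \<comment> \<open>On \<open>F0\<close> the quotient \<open>e f / c\<close> is the sign with which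
    the string fixes \<open>s\<close>. So \<open>h\<close> parametrizes the stabilizer by its
    strings, and the coefficients all become equal.\<close>
  define h where "h f = (e f / c) \<cdot>\<^sub>m pauli_str n f" for f
  note s = stabilizer_stateD[OF st]
  have c0: "c \<noteq> 0" using s(2) by (simp add: c_def)
  have gc: "g i \<in> carrier_mat ?d ?d" if "i < k" for i using g[OF that] by (rule pauli_group_carrier)
  have f4: "f j < 4" if "f \<in> ?F" "j < n" for f j using that by (auto simp: PiE_iff)
  \<comment> \<open>The exponent 2 supplies the phase -1.\<close>
  have Np: "z \<cdot>\<^sub>m pauli_str n f \<in> pauli_group n" if "f \<in> ?F" "z = 1 \<or> z = - 1" for f z
    using pauli_groupI[of n f 0] pauli_groupI[of n f 2] f4[OF that(1)] that(2) by auto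
  have Np1: "pauli_str n f \<in> pauli_group n" if "f \<in> ?F" for f
    using Np[OF that, of 1] by (simp add: one_smult_mat)
  have ev: "e f = 0 \<or> (pauli_str n f *\<^sub>v s = s \<and> e f = c) \<or> (pauli_str n f *\<^sub>v s = - 1 \<cdot>\<^sub>v s \<and> e f = - c)" if "f \<in> ?F" for f
  proof -
    have "(pauli_str n f *\<^sub>v s) \<bullet>c s = 0 \<or> pauli_str n f *\<^sub>v s = s \<or> pauli_str n f *\<^sub>v s = - 1 \<cdot>\<^sub>v s"
      by (rule stabilizer_state_expectation[OF st]) (rule f4[OF that])
    then show ?thesis
      using smult_cscalar[OF s(1) s(1), of "- 1"] unfolding e_def c_def by fastforce
  qed
  have fin: "finite ?F" by (intro finite_PiE) auto
  have "conj_sum n g k (outer ?d s) =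
      (1 / 2 ^ n) \<cdot>\<^sub>m conj_sum n g k (msum ?d (\<lambda>f. e f \<cdot>\<^sub>m pauli_str n f) ?F)"
    unfolding outer_pauli_expansion[OF s(1)] e_def by (rule conj_sum_smult[OF gc msum_carrier])
  also have "conj_sum n g k (msum ?d (\<lambda>f. e f \<cdot>\<^sub>m pauli_str n f) ?F) =
      msum ?d (\<lambda>f. conj_sum n g k (e f \<cdot>\<^sub>m pauli_str n f)) ?F"
    by (rule conj_sum_msum[OF gc]) simp_all
  also have "\<dots> = msum ?d (\<lambda>f. (if com f then 2 ^ k * e f else 0) \<cdot>\<^sub>m pauli_str n f) ?F"
  proof (rule msum_cong)
    fix f assume f: "f \<in> ?F"
    have "conj_sum n g k (e f \<cdot>\<^sub>m pauli_str n f) = e f \<cdot>\<^sub>m conj_sum n g k (pauli_str n f)"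
      by (rule conj_sum_smult[OF gc pauli_str_carrier])
    moreover have "conj_sum n g k (pauli_str n f) = (if com f then 2 ^ k else 0) \<cdot>\<^sub>m pauli_str n f"
      unfolding com_def by (rule conj_sum_pauli[OF g Np1[OF f]])
    ultimately show "conj_sum n g k (e f \<cdot>\<^sub>m pauli_str n f) = (if com f then 2 ^ k * e f else 0) \<cdot>\<^sub>m pauli_str n f"
      by (simp add: smult_smult mult.commute)
  qed
  also have "\<dots> = msum ?d (\<lambda>f. (if com f then 2 ^ k * e f else 0) \<cdot>\<^sub>m pauli_str n f) F0"
  proof (rule msum_mono_neutral[OF fin])
    show "F0 \<subseteq> ?F" by (auto simp: F0_def)
    fix f assume "f \<in> ?F - F0"
    then have z: "(if com f then 2 ^ k * e f else 0) = 0" by (auto simp: F0_def)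
    show "(if com f then 2 ^ k * e f else 0) \<cdot>\<^sub>m pauli_str n f = 0\<^sub>m ?d ?d"
      unfolding z using carrier_matD[OF pauli_str_carrier[of n f]] by (intro eq_matI) auto
  qed
  also have "\<dots> = msum ?d (\<lambda>f. (2 ^ k * c) \<cdot>\<^sub>m h f) F0"
    by (rule msum_cong) (simp add: F0_def h_def smult_smult c0)
  also have "\<dots> = (2 ^ k * c) \<cdot>\<^sub>m msum ?d h F0"
    by (rule smult_msum[symmetric]) (simp add: h_def)
  also have "msum ?d h F0 = msum ?d id ?G"
  proof -
    have inj: "inj_on h F0"
    proof (rule inj_onI)
      fix f f' assume f: "f \<in> F0" "f' \<in> F0" and eq: "h f = h f'"
      have ef: "e f \<noteq> 0" using f(1) by (simp add: F0_def)
      have "pauli_str n f = (c / e f) \<cdot>\<^sub>m h f"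
        using ef c0 by (simp add: h_def smult_smult one_smult_mat)
      also have "\<dots> = (e f' / e f) \<cdot>\<^sub>m pauli_str n f'"
        unfolding eq using c0 by (simp add: h_def smult_smult)
      finally show "f = f'"
        by (rule pauli_str_proportional) (use f in \<open>simp_all only: F0_def mem_Collect_eq\<close>)
    qed
    have "h ` F0 = ?G"
    proof (intro equalityI subsetI)
      fix M assume "M \<in> h ` F0"
      then obtain f where f: "f \<in> ?F" "e f \<noteq> 0" "com f" "M = h f" by (auto simp: F0_def)
      have cM: "M * g i = g i * M" if "i < k" for i
        unfolding f(4) h_def mult_smult_assoc_mat[OF pauli_str_carrier gc[OF that]]
          mult_smult_distrib[OF gc[OF that] pauli_str_carrier]
        using f(3) that by (simp add: com_def)
      have sM: "M *\<^sub>v s = (e f / c) \<cdot>\<^sub>v (pauli_str n f *\<^sub>v s)"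
        unfolding f(4) h_def by (rule smult_mat_vec[OF pauli_str_carrier s(1)])
      consider "pauli_str n f *\<^sub>v s = s" "e f = c" | "pauli_str n f *\<^sub>v s = - 1 \<cdot>\<^sub>v s" "e f = - c"
        using ev[OF f(1)] f(2) by blast
      then have "M \<in> pauli_group n \<and> M *\<^sub>v s = s"
      proof cases
        case 1
        then show ?thesis using sM Np[OF f(1), of 1] c0 by (simp add: f(4) h_def one_smult_vec)
      next
        case 2
        then show ?thesis
          using sM Np[OF f(1), of "- 1"] c0 by (simp add: f(4) h_def smult_smult_assoc one_smult_vec)
      qed
      then show "M \<in> ?G" using cM unfolding code_stabilizer_def by blast
    next
      fix M assume "M \<in> ?G"
      then have M: "M \<in> pauli_group n" "M *\<^sub>v s = s" "\<And>i. i < k \<Longrightarrow> M * g i = g i * M"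
        unfolding code_stabilizer_def by blast+
      obtain x f where f: "f \<in> ?F" "M = \<i> ^ x \<cdot>\<^sub>m pauli_str n f"
        using M(1) by (rule pauli_groupE)
      have x0: "\<i> ^ x \<noteq> 0" by simp
      have Ns: "pauli_str n f *\<^sub>v s \<in> carrier_vec ?d" by (rule mult_mat_vec_carrier[OF pauli_str_carrier s(1)])
      have "s = \<i> ^ x \<cdot>\<^sub>v (pauli_str n f *\<^sub>v s)"
        using M(2) unfolding f(2) smult_mat_vec[OF pauli_str_carrier s(1)] by simp
      then have xe: "\<i> ^ x * e f = c"
        unfolding e_def c_def smult_cscalar[OF Ns s(1), symmetric] by simp
      then have e0: "e f \<noteq> 0" using c0 by auto
      then have "e f = c \<or> e f = - c" using ev[OF f(1)] by blast
      \<comment> \<open>The phase of \<open>M\<close> has to be \<open>c / e f\<close>. It is a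
        sign, hence its own inverse, and so agrees with the factor used in \<open>h\<close>.\<close>
      then have "c / e f = e f / c" using c0 by auto
      moreover have "\<i> ^ x = c / e f" using xe e0 by (simp add: field_simps)
      ultimately have "\<i> ^ x = e f / c" by simp
      then have "M = h f" by (simp add: f(2) h_def)
      moreover have "com f"
        unfolding com_def
      proof (intro allI impI)
        fix i assume i: "i < k"
        show "pauli_str n f * g i = g i * pauli_str n f"
          by (rule smult_mat_cancel[OF _ x0])
            (use M(3)[OF i] in \<open>simp only: f(2) mult_smult_assoc_mat[OF pauli_str_carrier gc[OF i]]
              mult_smult_distrib[OF gc[OF i] pauli_str_carrier]\<close>)
      qed
      ultimately show "M \<in> h ` F0" using f(1) e0 by (auto simp: F0_def)
    qed
    then show ?thesis using msum_reindex[OF inj, of ?d id] by simp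
  qed
  finally show ?thesis by (simp add: smult_smult c_def)
qed

lemma conj_sum_eq_outer:
  assumes "\<And>i. i < k \<Longrightarrow> g i \<in> carrier_mat (2 ^ n) (2 ^ n)" "s \<in> carrier_vec (2 ^ n)"
  shows "conj_sum n g k (outer (2 ^ n) s) = msum (2 ^ n) (\<lambda>a. outer (2 ^ n) (gprod n g k a *\<^sub>v s)) {..<2 ^ k}"
  unfolding conj_sum_def by (rule msum_cong) (simp only: outer_conj[OF gprod_carrier[OF assms(1)] assms(2)])

text \<open>The order of the stabilizer is forced rather than counted. The projector is
  \<open>2 ^ k / 2 ^ n\<close> times the sum over the group, and that sum squares to the group order
  times itself; a nonzero idempotent leaves only \<open>2 ^ (n - k)\<close> as the order.\<close>

lemma code_projector_generators:
  assumes st: "stabilizer_state n s" and g: "\<And>i. i < k \<Longrightarrow> g i \<in> pauli_group n"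
    and orth: "\<And>a b. a < 2 ^ k \<Longrightarrow> b < 2 ^ k \<Longrightarrow> a \<noteq> b \<Longrightarrow> (gprod n g k a *\<^sub>v s) \<bullet>c (gprod n g k b *\<^sub>v s) = 0"
  shows "\<exists>Ms. set Ms \<subseteq> code_stabilizer n k g s \<and> k + length Ms = n \<and>
    fam_proj (2 ^ n) (s \<bullet>c s) (\<lambda>a. gprod n g k a *\<^sub>v s) {..<2 ^ k} = gen_proj (2 ^ n) Ms"
proof -
  let ?d = "2 ^ n :: nat" and ?G = "code_stabilizer n k g s"
  let ?w = "\<lambda>a. gprod n g k a *\<^sub>v s" and ?X = "msum (2 ^ n) id (code_stabilizer n k g s)"
  define c where "c = s \<bullet>c s"
  define al :: complex where "al = 2 ^ k / 2 ^ n"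
  note s = stabilizer_stateD[OF st]
  interpret G: elementary_abelian_mats ?d ?G by (rule elementary_abelian_code_stabilizer[OF st g])
  have gc: "g i \<in> carrier_mat ?d ?d" if "i < k" for i using g[OF that] by (rule pauli_group_carrier)
  have Gp: "gprod n g k a \<in> pauli_group n" for a by (rule gprod_pauli) (rule g)
  have Gc: "gprod n g k a \<in> carrier_mat ?d ?d" for a by (rule pauli_group_carrier[OF Gp])
  have w: "?w a \<in> carrier_vec ?d" for a by (rule mult_mat_vec_carrier[OF Gc s(1)])
  have c0: "c \<noteq> 0" using s(2) by (simp add: c_def)
  have wn: "?w a \<bullet>c ?w a = c" for a
    unfolding cscalar_prod_adjoint[OF Gc s(1) w] mult_mult_vec[OF mat_adjoint_carrier[OF Gc] Gc s(1), symmetric]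
      pauli_group_unitary(2)[OF Gp] c_def using s(1) by simp
  interpret O: orth_family ?d c ?w "{..<2 ^ k}"
    by standard (use w wn orth c0 in auto)
  define P where "P = fam_proj ?d c ?w {..<2 ^ k}"
  have "msum ?d (\<lambda>a. outer ?d (?w a)) {..<2 ^ k} = (2 ^ k * c / 2 ^ n) \<cdot>\<^sub>m ?X"
    using conj_sum_eq_outer[of k g n s, OF gc s(1)] conj_sum_outer[of n s k g, OF st g] by (simp only: c_def)
  then have PX: "P = al \<cdot>\<^sub>m ?X"
    unfolding P_def fam_proj_def
    using c0 by (simp add: al_def smult_smult)
  have X: "?X \<in> carrier_mat ?d ?d" by simp
  have PP: "P * P = P" unfolding P_def using O.proj_mult[of "{..<2 ^ k}" "{..<2 ^ k}"] by simp
  have "P * P = (al * of_nat (card ?G)) \<cdot>\<^sub>m P"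
    unfolding PX smult_mult_smult[OF X X] G.msum_group_square smult_smult by (simp add: mult_ac)
  then have 1: "(al * of_nat (card ?G)) \<cdot>\<^sub>m P = P" using PP by simp
  have Pc: "P \<in> carrier_mat ?d ?d" by (simp add: P_def)
  \<comment> \<open>\<open>P\<close> fixes a vector of nonzero norm, so it is not zero and its
    scalar factor can be compared with 1. Index 0 exists for every \<open>k\<close>.\<close>
  have Pw: "P *\<^sub>v ?w 0 = ?w 0" unfolding P_def by (rule O.proj_vec) simp_all
  have "(al * of_nat (card ?G)) \<cdot>\<^sub>v ?w 0 = ?w 0"
    using smult_mat_vec[OF Pc w, of "al * of_nat (card ?G)" 0] unfolding 1 Pw by simp
  then have "(al * of_nat (card ?G)) * c = c"
    using smult_cscalar[OF w w, of "al * of_nat (card ?G)" 0 0] unfolding wn by (simp add: wn)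
  then have alG: "al * of_nat (card ?G) = 1" using c0 by simp
  obtain Ms where Ms: "set Ms \<subseteq> ?G" "card ?G = 2 ^ length Ms" "?X = of_nat (card ?G) \<cdot>\<^sub>m gen_proj ?d Ms"
    using G.exists_generators by blast
  have "of_nat (2 ^ k * card ?G) = (of_nat (2 ^ n) :: complex)"
    using alG by (simp add: al_def field_simps)
  then have "(2::nat) ^ k * card ?G = 2 ^ n" by (simp only: of_nat_eq_iff)
  then have "(2::nat) ^ (k + length Ms) = 2 ^ n" by (simp add: Ms(2) power_add)
  then have "k + length Ms = n" by (simp only: power_inject_exp one_less_numeral_iff semiring_norm)
  moreover have "P = gen_proj ?d Ms"
    unfolding PX Ms(3) smult_smult alG by (rule one_smult_mat)
  ultimately show ?thesis using Ms(1) by (auto simp: P_def c_def)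
qed

section \<open>Union stabilizer codes\<close>

text \<open>Between neighbouring factors \<open>mat_adjoint T * T\<close> cancels, and the identity
  in each factor is unchanged by the conjugation.\<close>

lemma gen_proj_conj:
  assumes "set Ms \<subseteq> carrier_mat d d" "T \<in> carrier_mat d d" "T * mat_adjoint T = 1\<^sub>m d" "mat_adjoint T * T = 1\<^sub>m d"
  shows "gen_proj d (map (\<lambda>M. T * M * mat_adjoint T) Ms) = T * gen_proj d Ms * mat_adjoint T"
  using assms(1)
proof (induction Ms)
  case Nil
  then show ?case using assms(3) right_mult_one_mat[OF assms(2)] by simp
next
  case (Cons M Ms)
  note T = assms(2) and T' = mat_adjoint_carrier[OF assms(2)]
  have M: "M \<in> carrier_mat d d" using Cons.prems by simp
  define H where "H = (1 / 2) \<cdot>\<^sub>m (1\<^sub>m d + M)"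
  have H: "H \<in> carrier_mat d d" using M by (simp add: H_def)
  have G: "gen_proj d Ms \<in> carrier_mat d d" using Cons.prems by (intro gen_proj_carrier) simp
  have IH: "gen_proj d (map (\<lambda>M. T * M * mat_adjoint T) Ms) = T * gen_proj d Ms * mat_adjoint T"
    using Cons by simp
  have "T * (1\<^sub>m d + M) * mat_adjoint T = 1\<^sub>m d + T * M * mat_adjoint T"
    unfolding mult_add_distrib_mat[OF T one_carrier_mat M] right_mult_one_mat[OF T]
    unfolding add_mult_distrib_mat[OF T mult_carrier_mat[OF T M] T'] assms(3) ..
  then have TH: "T * H * mat_adjoint T = (1 / 2) \<cdot>\<^sub>m (1\<^sub>m d + T * M * mat_adjoint T)"
    unfolding H_def using smult_conj[of "1\<^sub>m d + M" d T "1 / 2"] M T by simp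
  have "(T * gen_proj d Ms * mat_adjoint T) * (T * H * mat_adjoint T) = T * (gen_proj d Ms * H) * mat_adjoint T"
  proof -
    have "(T * gen_proj d Ms * mat_adjoint T) * (T * H * mat_adjoint T) =
        T * (gen_proj d Ms * ((mat_adjoint T * T) * (H * mat_adjoint T)))"
      using T T' H G by (simp add: mult_assoc_sq[of _ d] mult_carrier_mat[of _ d d])
    also have "\<dots> = T * (gen_proj d Ms * (H * mat_adjoint T))"
      unfolding assms(4) left_mult_one_mat[OF mult_carrier_mat[OF H T']] ..
    also have "\<dots> = T * (gen_proj d Ms * H) * mat_adjoint T"
      using T T' H G by (simp add: mult_assoc_sq[of _ d] mult_carrier_mat[of _ d d])
    finally show ?thesis .
  qed
  then show ?case
    by (simp add: IH TH H_def[symmetric])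
qed

lemma signed_pauli_of_square:
  assumes "M \<in> pauli_group n" "M * M = 1\<^sub>m (2 ^ n)"
  shows "\<exists>p. signed_pauli n p = M"
proof -
  obtain x f where f: "M = \<i> ^ x \<cdot>\<^sub>m pauli_str n f" using assms(1) by (rule pauli_groupE)
  have "M * M = (\<i> ^ x * \<i> ^ x) \<cdot>\<^sub>m 1\<^sub>m (2 ^ n)"
    by (simp add: f smult_mult_smult[of _ "2 ^ n"] pauli_str_square)
  then have "((\<i> ^ x * \<i> ^ x) \<cdot>\<^sub>m 1\<^sub>m (2 ^ n)) $$ (0, 0) = (1\<^sub>m (2 ^ n) :: complex mat) $$ (0, 0)"
    using assms(2) by simp
  then have "\<i> ^ x * \<i> ^ x = 1" by simp
  then have "\<i> ^ x = 1 \<or> \<i> ^ x = - 1" by (simp add: square_eq_1_iff)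
  then have "signed_pauli n (\<i> ^ x = 1, f) = M" by (auto simp: signed_pauli.simps f)
  then show ?thesis ..
qed

text \<open>\<open>T\<close> commutes or anticommutes with \<open>M\<close>, so conjugation changes
  at most the sign. The factors for a translate are therefore again signed strings, and translating
  costs no gates.\<close>

lemma signed_pauli_conj:
  assumes "M \<in> pauli_group n" "M * M = 1\<^sub>m (2 ^ n)" "T \<in> pauli_group n"
  shows "\<exists>p. signed_pauli n p = T * M * mat_adjoint T"
proof -
  note Mc = pauli_group_carrier[OF assms(1)] and Tc = pauli_group_carrier[OF assms(3)]
  note T' = mat_adjoint_carrier[OF Tc]
  obtain c where c: "c \<in> {1, - 1}" "T * M = c \<cdot>\<^sub>m (M * T)"
    using pauli_group_commute[OF assms(3,1)] by blast
  have "T * M * mat_adjoint T = c \<cdot>\<^sub>m M"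
    unfolding c(2) mult_smult_assoc_mat[OF mult_carrier_mat[OF Mc Tc] T'] mult_assoc_sq[OF Mc Tc T']
      pauli_group_unitary(1)[OF assms(3)] right_mult_one_mat[OF Mc] ..
  moreover obtain e f where p: "signed_pauli n (e, f) = M"
    using signed_pauli_of_square[OF assms(1,2)] by auto
  have "c \<cdot>\<^sub>m M = signed_pauli n (if c = 1 then e else \<not> e, f)"
    using c(1) unfolding p[symmetric] by (auto simp: signed_pauli.simps smult_smult)
  ultimately show ?thesis by metis
qed

section \<open>Spans of vector lists and uniqueness of the orthogonal projector\<close>

lemma mat_of_cols_mult_unit_vec:
  assumes "i < length vs" "vs ! i \<in> carrier_vec d"
  shows "mat_of_cols d vs *\<^sub>v unit_vec (length vs) i = (vs ! i :: complex vec)"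
  using assms by (intro eq_vecI) (auto simp: mat_of_cols_index row_def)

lemma in_span_list:
  assumes "v \<in> set vs" "v \<in> carrier_vec d"
  shows "v \<in> span_list d vs"
proof -
  obtain i where i: "i < length vs" "vs ! i = v" using assms(1) by (auto simp: in_set_conv_nth)
  then have "mat_of_cols d vs *\<^sub>v unit_vec (length vs) i = v"
    using mat_of_cols_mult_unit_vec[of i vs d] assms(2) by simp
  then show ?thesis unfolding span_list_def by (metis (mono_tags, lifting) mem_Collect_eq unit_vec_carrier)
qed

lemma fix_span_list:
  fixes E :: "complex mat"
  assumes E: "E \<in> carrier_mat d d" and fix_vs: "\<And>v. v \<in> set vs \<Longrightarrow> v \<in> carrier_vec d \<and> E *\<^sub>v v = v"
    and q: "q \<in> span_list d vs"
  shows "E *\<^sub>v q = q"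
proof -
  obtain c where c: "c \<in> carrier_vec (length vs)" "q = mat_of_cols d vs *\<^sub>v c"
    using q by (auto simp: span_list_def)
  have V: "mat_of_cols d vs \<in> carrier_mat d (length vs)" by simp
  have "E * mat_of_cols d vs = mat_of_cols d vs"
  proof (rule eq_matI)
    fix i j assume "i < dim_row (mat_of_cols d vs)" "j < dim_col (mat_of_cols d vs)"
    then have ij: "i < d" "j < length vs" by simp_all
    have v: "vs ! j \<in> carrier_vec d" "E *\<^sub>v (vs ! j) = vs ! j" using fix_vs[of "vs ! j"] ij by simp_all
    have "(E * mat_of_cols d vs) $$ (i, j) = (E *\<^sub>v (vs ! j)) $ i"
      using E ij v(1) by simp
    then show "(E * mat_of_cols d vs) $$ (i, j) = mat_of_cols d vs $$ (i, j)"
      using ij v by (simp add: mat_of_cols_index)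
  qed (use E in auto)
  then show ?thesis
    unfolding c(2) using assoc_mult_mat_vec[OF E V c(1)] by simp
qed

text \<open>Write E for the family projector. \<open>P\<close> fixes the spanning vectors, so PE =
  E; E fixes the span, which contains the range of \<open>P\<close>, so EP = P. Taking adjoints in
  the second equation gives P = PE = E.\<close>

lemma (in orth_family) orth_projector_eq:
  assumes c_real: "cnj c = c" and P: "orth_projector d (span_list d vs) P" and vs: "set vs = v ` X"
  shows "P = fam_proj d c v X"
proof -
  let ?E = "fam_proj d c v X"
  have Pc: "P \<in> carrier_mat d d" and Pa: "mat_adjoint P = P"
    and Pr: "\<And>w. w \<in> carrier_vec d \<Longrightarrow> P *\<^sub>v w \<in> span_list d vs" and Pf: "\<And>w. w \<in> span_list d vs \<Longrightarrow> P *\<^sub>v w = w"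
    using P by (auto simp: orth_projector_def)
  have E: "?E \<in> carrier_mat d d" by simp
  have fixE: "w \<in> carrier_vec d \<and> ?E *\<^sub>v w = w" if "w \<in> set vs" for w
    using that vs carrier proj_vec[OF order_refl] by auto
  have "P * outer d (v x) = outer d (v x)" if x: "x \<in> X" for x
  proof (rule eq_matI)
    have vx: "v x \<in> carrier_vec d" by (rule carrier[OF x])
    have Pv: "P *\<^sub>v v x = v x" by (rule Pf, rule in_span_list[OF _ vx]) (use x vs in auto)
    fix i j assume "i < dim_row (outer d (v x))" "j < dim_col (outer d (v x))"
    then have ij: "i < d" "j < d" by simp_all
    have "(P * outer d (v x)) $$ (i, j) = (P *\<^sub>v v x) $ i * cnj (v x $ j)"
      using ij by (simp add: mult_index[OF Pc outer_carrier] mult_mat_vec_index[OF Pc vx] outer_index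
          sum_distrib_right mult.assoc del: index_mult_mat index_mult_mat_vec)
    then show "(P * outer d (v x)) $$ (i, j) = outer d (v x) $$ (i, j)"
      unfolding Pv using ij by (simp add: outer_index del: index_mult_mat)
  qed (use carrier_matD[OF Pc] in simp_all)
  then have "P * msum d (\<lambda>x. outer d (v x)) X = msum d (\<lambda>x. outer d (v x)) X"
    by (subst mult_msum[OF Pc]) (auto intro: msum_cong)
  then have PE: "P * ?E = ?E"
    unfolding fam_proj_def by (simp add: mult_smult_distrib[OF Pc msum_carrier])
  have EP: "?E * P = P"
  proof (rule eq_matI)
    fix i j assume "i < dim_row P" "j < dim_col P"
    then have ij: "i < d" "j < d" using Pc by auto
    have col: "P *\<^sub>v unit_vec d j = col P j"
      using Pc ij by (intro eq_vecI) auto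
    have "?E *\<^sub>v col P j = col P j"
      unfolding col[symmetric] by (rule fix_span_list[OF E fixE Pr[OF unit_vec_carrier]])
    moreover have "(?E * P) $$ (i, j) = (?E *\<^sub>v col P j) $ i"
      using E Pc ij by simp
    ultimately show "(?E * P) $$ (i, j) = P $$ (i, j)"
      using ij Pc by simp
  qed (use Pc in auto)
  have "P = mat_adjoint (?E * P)" using EP Pa by simp
  also have "\<dots> = P * ?E"
    unfolding mat_adjoint_mult[OF E Pc] Pa fam_proj_adjoint[OF c_real] ..
  finally show ?thesis using PE by simp
qed

lemma fam_proj_empty: "fam_proj d c v {} = 0\<^sub>m d d"
  unfolding fam_proj_def msum_empty by (rule eq_matI) auto

lemma fam_proj_Un:
  assumes "finite A" "finite B" "A \<inter> B = {}"
  shows "fam_proj d c v (A \<union> B) = fam_proj d c v A + fam_proj d c v B"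
  unfolding fam_proj_def msum_Un[OF assms]
  by (rule eq_matI) (simp_all add: distrib_left add_divide_distrib)

lemma proj_sum_fam_proj:
  assumes "\<And>j. j \<in> set js \<Longrightarrow> list_proj n (L j) = fam_proj (2 ^ n) c v ({j} \<times> A)" "distinct js" "finite A"
  shows "proj_sum n (map L js) = fam_proj (2 ^ n) c v (set js \<times> A)"
  using assms(1,2)
proof (induction js)
  case (Cons j js)
  have "set (j # js) \<times> A = {j} \<times> A \<union> set js \<times> A" by auto
  moreover have "fam_proj (2 ^ n) c v ({j} \<times> A \<union> set js \<times> A) =
      fam_proj (2 ^ n) c v ({j} \<times> A) + fam_proj (2 ^ n) c v (set js \<times> A)"
    using Cons.prems(2) assms(3) by (intro fam_proj_Un) auto
  ultimately show ?case using Cons by (simp add: proj_sum_simps)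
qed (simp add: proj_sum_simps fam_proj_empty)

lemma fam_proj_translate:
  assumes T: "T \<in> carrier_mat d d" and w: "\<And>a. a \<in> A \<Longrightarrow> w a \<in> carrier_vec d"
    and v: "\<And>a. a \<in> A \<Longrightarrow> v (j, a) = T *\<^sub>v w a"
  shows "fam_proj d c v ({j} \<times> A) = T * fam_proj d c w A * mat_adjoint T"
proof -
  have "{j} \<times> A = Pair j ` A" by auto
  then have "msum d (\<lambda>x. outer d (v x)) ({j} \<times> A) = msum d (\<lambda>a. outer d (v (j, a))) A"
    by (simp add: msum_reindex inj_on_def)
  also have "\<dots> = msum d (\<lambda>a. T * outer d (w a) * mat_adjoint T) A"
    by (rule msum_cong) (simp only: v outer_conj[OF T w])
  also have "\<dots> = msum d (\<lambda>a. T * outer d (w a)) A * mat_adjoint T"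
    by (rule msum_mult[symmetric, OF mat_adjoint_carrier[OF T] mult_carrier_mat[OF T outer_carrier]])
  also have "msum d (\<lambda>a. T * outer d (w a)) A = T * msum d (\<lambda>a. outer d (w a)) A"
    by (rule mult_msum[symmetric, OF T outer_carrier])
  finally show ?thesis
    unfolding fam_proj_def smult_conj[OF msum_carrier T] by simp
qed

text \<open>The outcome qubit starts in 0, which is already the right answer for the identity
  projector. This settles the case where the bound allows no two-qubit gate.\<close>

lemma implements_trivial_measurement: "implements_measurement n 1 (1\<^sub>m (2 ^ n)) []"
proof -
  have eq: "circuit_mat (n + 1) [] *\<^sub>v kron_vec psi (unit_vec (2 ^ 1) 0) =
      kron_vec (1\<^sub>m (2 ^ n) *\<^sub>v psi) (kron_vec (unit_vec 2 0) (unit_vec 1 0)) +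
      kron_vec ((1\<^sub>m (2 ^ n) - 1\<^sub>m (2 ^ n)) *\<^sub>v psi) (kron_vec (unit_vec 2 1) (unit_vec 1 0))"
    if psi: "psi \<in> carrier_vec (2 ^ n)" for psi :: "complex vec"
  proof -
    have "1\<^sub>m (2 ^ n) - 1\<^sub>m (2 ^ n) = (0\<^sub>m (2 ^ n) (2 ^ n) :: complex mat)" by (rule eq_matI) auto
    then have z: "(1\<^sub>m (2 ^ n) - 1\<^sub>m (2 ^ n)) *\<^sub>v psi = 0\<^sub>v (2 ^ n)" by (simp only: zero_mat_mult_vec[OF psi])
    have u: "unit_vec (2 ^ 1) 0 = (kron_vec (unit_vec 2 0) (unit_vec 1 0) :: complex vec)"
      using unit_vec_kron[of 0 0 1] by simp
    have "kron_vec psi (kron_vec (unit_vec 2 0) (unit_vec 1 0)) \<in> carrier_vec (2 ^ (n + 1))"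
      using emb_carrier[OF psi, of 1 0] unfolding emb_def u .
    moreover have "kron_vec (0\<^sub>v (2 ^ n)) (kron_vec (unit_vec 2 1) (unit_vec 1 0)) = (0\<^sub>v (2 ^ (n + 1)) :: complex vec)"
      by (rule eq_vecI) (simp_all add: kron_vec_def)
    ultimately show ?thesis
      unfolding u z using psi by simp
  qed
  show ?thesis
    unfolding implements_measurement_def
    by (intro conjI exI[of _ "unit_vec 1 0"]) (use eq in auto)
qed

theorem theorem1:
  fixes n k m :: nat
    and s :: "complex vec"
    and g :: "nat \<Rightarrow> complex mat"
    and t :: "nat \<Rightarrow> complex mat"
    and P :: "complex mat"
  defines "W0 \<equiv> (\<lambda>a. gprod n g k a) ` {..<2 ^ k}"
    and "Q0 \<equiv> span_list (2 ^ n) (map (\<lambda>a. gprod n g k a *\<^sub>v s) [0..<2 ^ k])"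
    and "W \<equiv> (\<lambda>j a. t j * gprod n g k a)"
    and "Q \<equiv> span_list (2 ^ n) (concat (map (\<lambda>j. map (\<lambda>a. (t j * gprod n g k a) *\<^sub>v s) [0..<2 ^ k]) [0..<m]))"
  assumes s_stab: "stabilizer_state n s"
    and g_pauli: "\<forall>i<k. g i \<in> pauli_group n"
    and g_comm: "\<forall>i<k. \<forall>i'<k. g i * g i' = g i' * g i"
    and W0_group: "\<forall>A\<in>W0. \<forall>B\<in>W0. A * B \<in> W0"
    and W0_card: "card W0 = 2 ^ k"
    and Q0_dim: "lin_indep_list (2 ^ n) (map (\<lambda>a. gprod n g k a *\<^sub>v s) [0..<2 ^ k])"
    and t_pauli: "\<forall>j<m. t j \<in> pauli_group n"
    and t_orth: "\<forall>j<m. \<forall>j'<m. j \<noteq> j' \<longrightarrow>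
                   (\<forall>u\<in>Q0. \<forall>v\<in>Q0. (t j *\<^sub>v u) \<bullet>c (t j' *\<^sub>v v) = 0)"
    and W_comm: "\<forall>j<m. \<forall>j'<m. \<forall>a<2 ^ k. \<forall>a'<2 ^ k. W j a * W j' a' = W j' a' * W j a"
    and W_orth: "\<forall>j<m. \<forall>j'<m. \<forall>a<2 ^ k. \<forall>a'<2 ^ k. (j, a) \<noteq> (j', a') \<longrightarrow>
                   (W j a *\<^sub>v s) \<bullet>c (W j' a' *\<^sub>v s) = 0"
    and P_proj: "orth_projector (2 ^ n) Q P"
  shows "\<exists>a gs. implements_measurement n a P gs \<and>
                two_qubit_count gs \<le> 2 * m * (n - k) * (n + 3)"
proof -
  let ?d = "2 ^ n :: nat" and ?A = "{..<2 ^ k :: nat}" and ?G = "code_stabilizer n k g s"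
  define c where "c = s \<bullet>c s"
  define v where "v = (\<lambda>(j, a). W j a *\<^sub>v s)"
  define w where "w a = gprod n g k a *\<^sub>v s" for a
  define vs where "vs = concat (map (\<lambda>j. map (\<lambda>a. (t j * gprod n g k a) *\<^sub>v s) [0..<2 ^ k]) [0..<m])"
  note s = stabilizer_stateD[OF s_stab]
  have c0: "c \<noteq> 0" using s(2) by (simp add: c_def)
  have gp: "g i \<in> pauli_group n" if "i < k" for i using g_pauli that by blast
  have Gp: "gprod n g k a \<in> pauli_group n" for a by (rule gprod_pauli) (rule gp)
  have tp: "t j \<in> pauli_group n" if "j < m" for j using t_pauli that by blast
  note Gc = pauli_group_carrier[OF Gp] and tc = pauli_group_carrier[OF tp]
  have w: "w a \<in> carrier_vec ?d" for a unfolding w_def by (rule mult_mat_vec_carrier[OF Gc s(1)])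
  have Wp: "W j a \<in> pauli_group n" if "j < m" for j a
    unfolding W_def by (rule pauli_group_mult[OF tp[OF that] Gp])
  have v_eq: "v (j, a) = t j *\<^sub>v w a" if "j < m" for j a
    unfolding v_def W_def w_def using mult_mult_vec[OF tc[OF that] Gc s(1)] by simp
  have isometry: "(M *\<^sub>v x) \<bullet>c (M *\<^sub>v y) = x \<bullet>c y"
    if "M \<in> pauli_group n" "x \<in> carrier_vec ?d" "y \<in> carrier_vec ?d" for M x y
  proof -
    note M = pauli_group_carrier[OF that(1)]
    have "(M *\<^sub>v x) \<bullet>c (M *\<^sub>v y) = x \<bullet>c (mat_adjoint M *\<^sub>v (M *\<^sub>v y))"
      by (rule cscalar_prod_adjoint[OF M that(2) mult_mat_vec_carrier[OF M that(3)]])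
    also have "mat_adjoint M *\<^sub>v (M *\<^sub>v y) = y"
      unfolding mult_mult_vec[OF mat_adjoint_carrier[OF M] M that(3), symmetric] pauli_group_unitary(2)[OF that(1)]
      using that(3) by simp
    finally show ?thesis .
  qed
  \<comment> \<open>Pairs of translation and exponent index one orthogonal family. The code and each
    translate correspond to subsets of the index set, so sums and products of their projectors
    become unions and intersections.\<close>
  interpret O: orth_family ?d c v "{..<m} \<times> ?A"
  proof
    fix x y assume x: "x \<in> {..<m} \<times> ?A" and y: "y \<in> {..<m} \<times> ?A"
    obtain j a j' a' where xy: "x = (j, a)" "y = (j', a')" "j < m" "j' < m" "a < 2 ^ k" "a' < 2 ^ k"
      using x y by auto
    show "v x \<bullet>c v y = (if x = y then c else 0)"
      using W_orth xy isometry[OF Wp[OF xy(3)] s(1) s(1)] by (auto simp: v_def c_def)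
  next
    fix x assume "x \<in> {..<m} \<times> ?A"
    then show "v x \<in> carrier_vec ?d"
      using mult_mat_vec_carrier[OF pauli_group_carrier[OF Wp] s(1)] by (auto simp: v_def)
  qed (use c0 in auto)
  have set_vs: "set vs = v ` ({..<m} \<times> ?A)"
    unfolding vs_def v_def W_def by force
  have P: "P = fam_proj ?d c v ({..<m} \<times> ?A)"
    by (rule O.orth_projector_eq[OF _ _ set_vs]) (use s(3) P_proj in \<open>simp_all only: c_def vs_def Q_def\<close>)
  show ?thesis
  proof (cases "m = 0")
    \<comment> \<open>Without translates the projector is 0. The circuit consists of the two initial
      X gates and always reports outcome 1.\<close>
    case True
    have "implements_measurement n 2 (proj_sum n []) (meas_circuit n [])"
      by (rule implements_meas_circuit[of _ 0]) simp_all
    moreover have "P = proj_sum n []"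
      unfolding P True by (simp add: proj_sum_simps fam_proj_empty)
    moreover have "two_qubit_count (meas_circuit n []) = 0"
      by (subst two_qubit_count_meas_circuit[of _ 0]) simp_all
    ultimately show ?thesis by (metis le0)
  next
    case False
    then have m0: "0 < m" by simp
    \<comment> \<open>Translation 0 is unitary, so the orthogonality of its word states carries over
      to the untranslated ones.\<close>
    have w_orth: "w a \<bullet>c w b = 0" if "a < 2 ^ k" "b < 2 ^ k" "a \<noteq> b" for a b
      using O.orth[of "(0, a)" "(0, b)"] that m0 isometry[OF tp[OF m0] w w] by (simp add: v_eq[OF m0])
    obtain Ms where Ms: "set Ms \<subseteq> ?G" "k + length Ms = n" "fam_proj ?d c w ?A = gen_proj ?d Ms"
      using code_projector_generators[OF s_stab gp w_orth[unfolded w_def]] unfolding c_def w_def[abs_def] by metis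
    interpret G: elementary_abelian_mats ?d ?G by (rule elementary_abelian_code_stabilizer[OF s_stab gp])
    have MG: "M \<in> pauli_group n" if "M \<in> set Ms" for M
      using that Ms(1) unfolding code_stabilizer_def by blast
    \<comment> \<open>The generators found for the untranslated code are conjugated by
      \<open>t j\<close> and converted to signs and labels; thus every translate has a list of the
      same length.\<close>
    define L where "L j = map (\<lambda>M. SOME p. signed_pauli n p = t j * M * mat_adjoint (t j)) Ms" for j
    have sp: "signed_pauli n (SOME p. signed_pauli n p = t j * M * mat_adjoint (t j)) = t j * M * mat_adjoint (t j)"
      if "j < m" "M \<in> set Ms" for j M
      by (rule someI_ex, rule signed_pauli_conj[OF MG[OF that(2)] G.square tp[OF that(1)]]) (use that Ms(1) in auto)
    have L_map: "map (signed_pauli n) (L j) = map (\<lambda>M. t j * M * mat_adjoint (t j)) Ms" if "j < m" for j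
      unfolding L_def by (simp add: sp[OF that])
    have MsC: "set Ms \<subseteq> carrier_mat ?d ?d" using MG pauli_group_carrier by blast
    have proj_L: "list_proj n (L j) = fam_proj ?d c v ({j} \<times> ?A)" if j: "j < m" for j
    proof -
      have "list_proj n (L j) = t j * gen_proj ?d Ms * mat_adjoint (t j)"
        unfolding list_proj_def L_map[OF j]
        by (rule gen_proj_conj[OF MsC tc[OF j] pauli_group_unitary[OF tp[OF j]]])
      also have "\<dots> = fam_proj ?d c v ({j} \<times> ?A)"
        unfolding Ms(3)[symmetric] by (rule fam_proj_translate[symmetric]) (rule tc[OF j] w v_eq[OF j])+
      finally show ?thesis .
    qed
    have len: "length (L j) = n - k" for j using Ms(2) by (simp add: L_def)
    have commuting: "pairwise_commuting n (L j)" if j: "j < m" for j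
      unfolding pairwise_commuting_def
    proof (intro ballI)
      fix p q assume "p \<in> set (L j)" "q \<in> set (L j)"
      then obtain A B where AB: "A \<in> set Ms" "B \<in> set Ms" "signed_pauli n p = t j * A * mat_adjoint (t j)"
        "signed_pauli n q = t j * B * mat_adjoint (t j)"
        using sp[OF j] unfolding L_def by auto
      have conj_mult: "(t j * A * mat_adjoint (t j)) * (t j * B * mat_adjoint (t j)) = t j * (A * B) * mat_adjoint (t j)"
        if "A \<in> set Ms" "B \<in> set Ms" for A B
      proof -
        note T = tc[OF j] and T' = mat_adjoint_carrier[OF tc[OF j]]
        have A: "A \<in> carrier_mat ?d ?d" and B: "B \<in> carrier_mat ?d ?d" using that MsC by auto
        have "(t j * A * mat_adjoint (t j)) * (t j * B * mat_adjoint (t j)) =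
            t j * (A * ((mat_adjoint (t j) * t j) * (B * mat_adjoint (t j))))"
          using T T' A B by (simp add: mult_assoc_sq[of _ ?d] mult_carrier_mat[of _ ?d ?d])
        also have "\<dots> = t j * (A * (B * mat_adjoint (t j)))"
          unfolding pauli_group_unitary(2)[OF tp[OF j]] left_mult_one_mat[OF mult_carrier_mat[OF B T']] ..
        also have "\<dots> = t j * (A * B) * mat_adjoint (t j)"
          using T T' A B by (simp add: mult_assoc_sq[of _ ?d] mult_carrier_mat[of _ ?d ?d])
        finally show ?thesis .
      qed
      have "A * B = B * A" using AB(1,2) Ms(1) by (intro G.comm) auto
      then show "signed_pauli n p * signed_pauli n q = signed_pauli n q * signed_pauli n p"
        unfolding AB(3,4) conj_mult[OF AB(1,2)] conj_mult[OF AB(2,1)] by simp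
    qed
    have orth_L: "list_proj n (L i) * list_proj n (L j) = 0\<^sub>m ?d ?d" if "i < m" "j < m" "i \<noteq> j" for i j
    proof -
      have "({i} \<times> ?A) \<inter> ({j} \<times> ?A) = {}" using that(3) by auto
      then show ?thesis
        unfolding proj_L[OF that(1)] proj_L[OF that(2)]
        using O.proj_mult[of "{i} \<times> ?A" "{j} \<times> ?A"] that(1,2) by (auto simp: fam_proj_empty)
    qed
    have sum_L: "P = proj_sum n (map L [0..<m])"
    proof -
      have "proj_sum n (map L [0..<m]) = fam_proj ?d c v (set [0..<m] \<times> ?A)"
        by (rule proj_sum_fam_proj) (simp_all add: proj_L)
      then show ?thesis by (simp add: P atLeast0LessThan)
    qed
    have meas: "implements_measurement n (n - k + 2) P (meas_circuit n (map L [0..<m]))"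
      unfolding sum_L
    proof (rule implements_meas_circuit[OF refl])
      show "length ps = n - k \<and> pairwise_commuting n ps" if "ps \<in> set (map L [0..<m])" for ps
        using that len commuting by auto
      show "sorted_wrt (\<lambda>ps qs. list_proj n qs * list_proj n ps = 0\<^sub>m ?d ?d) (map L [0..<m])"
        unfolding sorted_wrt_iff_nth_less by (auto intro!: orth_L)
    qed
    show ?thesis
    proof (cases "n - k = 0")
      case True
      then have "L j = []" for j using len[of j] by simp
      then have one: "list_proj n (L j) = 1\<^sub>m ?d" for j by (simp add: list_proj_def)
      \<comment> \<open>With an empty list of factors each translate is the whole space, and two
        copies of the whole space cannot be orthogonal.\<close>
      have "m = 1"
      proof (rule ccontr)
        assume "m \<noteq> 1"
        then have "1\<^sub>m ?d * 1\<^sub>m ?d = (0\<^sub>m ?d ?d :: complex mat)"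
          using orth_L[of 0 1] m0 unfolding one by simp
        then have "(1\<^sub>m ?d :: complex mat) $$ (0, 0) = 0\<^sub>m ?d ?d $$ (0, 0)" by simp
        then show False by simp
      qed
      then have "P = 1\<^sub>m ?d" unfolding sum_L by (simp add: proj_sum_simps one)
      then have "implements_measurement n 1 P []" using implements_trivial_measurement by simp
      moreover have "two_qubit_count [] \<le> 2 * m * (n - k) * (n + 3)" by (simp add: two_qubit_count_def)
      ultimately show ?thesis by blast
    next
      case False
      have "two_qubit_count (meas_circuit n (map L [0..<m])) = m * (2 * (n - k) * (n + 2) + 1)"
        using two_qubit_count_meas_circuit[of "map L [0..<m]" "n - k" n] len by auto
      also have "\<dots> \<le> m * (2 * (n - k) * (n + 3))"
      proof (rule mult_le_mono2)
        \<comment> \<open>The CNOT of the block is paid for by the slack \<open>2 * r\<close>, which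
          is positive as \<open>r\<close> is nonzero.\<close>
        have "2 * r * (n + 2) + 1 \<le> 2 * r * (n + 3)" if "r \<noteq> 0" for r
          using that by (simp add: algebra_simps)
        then show "2 * (n - k) * (n + 2) + 1 \<le> 2 * (n - k) * (n + 3)" using False by blast
      qed
      also have "\<dots> = 2 * m * (n - k) * (n + 3)" by (simp add: mult_ac)
      finally show ?thesis using meas by blast
    qed
  qed
qed

end
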